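(* Let $\Omega\subset\mathbb R^n$ be open with a flat symmetric connection $\tilde\nabla$ and let $\mathfrak R=\{\mathbf r_1,\dots,\mathbf r_m\}$ be a partial frame on $\Omega$ in involution. Choose a completion $\{\mathbf r_1,\dots,\mathbf r_m,\mathbf s_{m+1},\dots,\mathbf s_n\}$ of $\mathfrak R$ to a frame, with structure functions $c_{ij}^k$ and Christoffel symbols $\Gamma_{ij}^k$, and consider the following system (the $\lambda$-system) for functions $\lambda^1,\dots,\lambda^m$: $$\mathbf r_i(\lambda^j)=\Gamma^j_{ji}(\lambda^i-\lambda^j)\quad\text{for all }1\le i\ne j\le m,$$ $$\lambda^j\Gamma_{ij}^k-\lambda^i\Gamma_{ji}^k-c_{ij}^k\lambda^k=0\quad\text{for all triples of distinct } i,j,k\in\{1,\dots,m\},$$ $$(\lambda^j-\lambda^i)\,\Gamma_{ji}^l=0\quad\text{for all }1\le i\ne j\le m\text{ and } l=m+1,\dots,n.$$ Then: 1) For every vector field $\mathbf f\in\mathcal F(\mathfrak R)$, the functions $\lambda^1,\dots,\lambda^m$ determined by $\tilde\nabla_{\mathbf r_i}\mathbf f=\lambda^i\mathbf r_i$, $i=1,\dots,m$, satisfy the $\lambda$-system. 2) For every solution $\lambda^1,\dots,\lambda^m$ of the $\lambda$-system, and any smooth initial data for $\mathbf f$ prescribed along any embedded submanifold $\Xi\subset\Omega$ of codimension $m$ transverse to $\mathfrak R$, there is a unique smooth local solution $\mathbf f$ of the system $\tilde\nabla_{\mathbf r_i}\mathbf f=\lambda^i\mathbf r_i$, $i=1,\dots,m$.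 In other words, given an arbitrary smooth vector field $\tilde{\mathbf f}$ on $\Xi$ (with values in $T\Omega|_\Xi$), there is an open subset $\Omega'\subset\Omega$ containing $\Xi$ and a unique smooth extension $\mathbf f$ of $\tilde{\mathbf f}$ to $\Omega'$ satisfying this system.
   Context: All objects are $C^\infty$-smooth. A connection $\tilde\nabla$ is symmetric if $\tilde\nabla_{\mathbf r}\mathbf s-\tilde\nabla_{\mathbf s}\mathbf r=[\mathbf r,\mathbf s]$ and flat if $\tilde\nabla_{\mathbf r}\tilde\nabla_{\mathbf s}\mathbf t-\tilde\nabla_{\mathbf s}\tilde\nabla_{\mathbf r}\mathbf t=\tilde\nabla_{[\mathbf r,\mathbf s]}\mathbf t$ for all vector fields; concretely, $\tilde\nabla$ may be taken as the connection on $\Omega\subset\mathbb R^n$ with $\tilde\nabla_{\partial/\partial u^i}\partial/\partial u^j=0$ for fixed coordinates $u^1,\dots,u^n$. A partial frame on $\Omega$ is a set of $m\le n$ smooth vector fields linearly independent at every point (a frame if $m=n$); it is in involution if all brackets $[\mathbf r_i,\mathbf r_j]$ lie in the $C^\infty(\Omega)$-span of $\mathbf r_1,\dots,\mathbf r_m$. For a fixed point $\bar u\in\Omega$, $\mathcal F(\mathfrak R)$ is the set of smooth vector fields $\mathbf f$ defined near $\bar u$ for which there exist smooth functions $\lambda^i$ near $\bar u$ with $\tilde\nabla_{\mathbf r_i}\mathbf f=\lambda^i\mathbf r_i$, $i=1,\dots,m$. Structure functions and Christoffel symbols of a frame $\{\mathbf r_1,\dots,\mathbf r_m,\mathbf s_{m+1},\dots,\mathbf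 s_n\}$: $[\mathbf r_i,\mathbf r_j]=\sum_{k=1}^m c_{ij}^k\mathbf r_k+\sum_{l=m+1}^n c_{ij}^l\mathbf s_l$ and $\tilde\nabla_{\mathbf r_i}\mathbf r_j=\sum_{k=1}^m\Gamma_{ij}^k\mathbf r_k+\sum_{l=m+1}^n\Gamma_{ij}^l\mathbf s_l$. $\Xi$ is transverse to $\mathfrak R$ if $\operatorname{span}_{\mathbb R}\{\mathbf r_1|_u,\dots,\mathbf r_m|_u\}\oplus T_u\Xi=\mathbb R^n$ for every $u\in\Xi$. *)

theory Defs
  imports "HOL-Analysis.Analysis"
begin

(* Smoothness on open sets: for open S in a Euclidean space, "Ck_on k S f" says that all iterated
   directional derivatives of f up to order k exist and are continuous on S. *)

primrec Ck_on :: "nat \<Rightarrow> 'a::euclidean_space set \<Rightarrow> ('a \<Rightarrow> 'b::real_normed_vector) \<Rightarrow> bool" where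
  "Ck_on 0 S f \<longleftrightarrow> continuous_on S f"
| "Ck_on (Suc k) S f \<longleftrightarrow>
     (\<forall>x\<in>S. f differentiable (at x)) \<and>
     (\<forall>v. Ck_on k S (\<lambda>x. frechet_derivative f (at x) v))"

definition smooth_on :: "'a::euclidean_space set \<Rightarrow> ('a \<Rightarrow> 'b::real_normed_vector) \<Rightarrow> bool" where
  "smooth_on S f \<longleftrightarrow> (\<forall>k. Ck_on k S f)"


(* A vector field on an open subset of real^'n is given by its components with respect to the
   standard coordinates; values outside the open set under consideration are irrelevant. *)

type_synonym 'n vfield = "real^'n \<Rightarrow> real^'n"

definition lie_deriv :: "'n::finite vfield \<Rightarrow> (real^'n \<Rightarrow> 'b::real_normed_vector) \<Rightarrow> real^'n \<Rightarrow> 'b" where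
  "lie_deriv X f u = frechet_derivative f (at u) (X u)"

definition lie_bracket :: "'n::finite vfield \<Rightarrow> 'n vfield \<Rightarrow> 'n vfield" where
  "lie_bracket X Y u = lie_deriv X Y u - lie_deriv Y X u"


(* An affine connection on Omega, acting on vector fields over all open subsets of Omega.
   Compatibility with restriction need not be postulated: applying the axioms over U with a
   factor g that vanishes on U but not outside U shows that "nabla X Y" on U only depends on
   X and Y on U.  Homogeneity over the reals is the case of a constant g. *)

definition connection_on :: "(real^'n::finite) set \<Rightarrow> ('n vfield \<Rightarrow> 'n vfield \<Rightarrow> 'n vfield) \<Rightarrow> bool" where
  "connection_on \<Omega> nabla \<longleftrightarrow>
    (\<forall>U X Y Z g. open U \<longrightarrow> U \<subseteq> \<Omega> \<longrightarrow>
       smooth_on U X \<longrightarrow> smooth_on U Y \<longrightarrow> smooth_on U Z \<longrightarrow> smooth_on U (g :: real^'n \<Rightarrow> real) \<longrightarrow>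
         smooth_on U (nabla X Y) \<and>
         (\<forall>u\<in>U.
            nabla (\<lambda>x. X x + Y x) Z u = nabla X Z u + nabla Y Z u \<and>
            nabla (\<lambda>x. g x *\<^sub>R X x) Y u = g u *\<^sub>R nabla X Y u \<and>
            nabla X (\<lambda>x. Y x + Z x) u = nabla X Y u + nabla X Z u \<and>
            nabla X (\<lambda>x. g x *\<^sub>R Y x) u = lie_deriv X g u *\<^sub>R Y u + g u *\<^sub>R nabla X Y u))"

definition symmetric_connection_on :: "(real^'n::finite) set \<Rightarrow> ('n vfield \<Rightarrow> 'n vfield \<Rightarrow> 'n vfield) \<Rightarrow> bool" where
  "symmetric_connection_on \<Omega> nabla \<longleftrightarrow>
    (\<forall>X Y. smooth_on \<Omega> X \<longrightarrow> smooth_on \<Omega> Y \<longrightarrow>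
       (\<forall>u\<in>\<Omega>. nabla X Y u - nabla Y X u = lie_bracket X Y u))"

definition flat_connection_on :: "(real^'n::finite) set \<Rightarrow> ('n vfield \<Rightarrow> 'n vfield \<Rightarrow> 'n vfield) \<Rightarrow> bool" where
  "flat_connection_on \<Omega> nabla \<longleftrightarrow>
    (\<forall>X Y Z. smooth_on \<Omega> X \<longrightarrow> smooth_on \<Omega> Y \<longrightarrow> smooth_on \<Omega> Z \<longrightarrow>
       (\<forall>u\<in>\<Omega>. nabla X (nabla Y Z) u - nabla Y (nabla X Z) u = nabla (lie_bracket X Y) Z u))"


(* Families of m vector fields are indexed by {1..m}. *)

definition partial_frame :: "(real^'n::finite) set \<Rightarrow> nat \<Rightarrow> (nat \<Rightarrow> 'n vfield) \<Rightarrow> bool" where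
  "partial_frame \<Omega> m r \<longleftrightarrow>
     m \<le> CARD('n) \<and>
     (\<forall>i\<in>{1..m}. smooth_on \<Omega> (r i)) \<and>
     (\<forall>u\<in>\<Omega>. inj_on (\<lambda>i. r i u) {1..m} \<and> independent ((\<lambda>i. r i u) ` {1..m}))"

definition in_involution :: "(real^'n::finite) set \<Rightarrow> nat \<Rightarrow> (nat \<Rightarrow> 'n vfield) \<Rightarrow> bool" where
  "in_involution \<Omega> m r \<longleftrightarrow>
     (\<forall>i\<in>{1..m}. \<forall>j\<in>{1..m}. \<exists>a :: nat \<Rightarrow> real^'n \<Rightarrow> real.
        (\<forall>k\<in>{1..m}. smooth_on \<Omega> (a k)) \<and>
        (\<forall>u\<in>\<Omega>. lie_bracket (r i) (r j) u = (\<Sum>k=1..m. a k u *\<^sub>R r k u)))"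

(* r_1, ..., r_m, s_{m+1}, ..., s_n is a frame, n = CARD('n). *)

definition frame_completion ::
  "(real^'n::finite) set \<Rightarrow> nat \<Rightarrow> (nat \<Rightarrow> 'n vfield) \<Rightarrow> (nat \<Rightarrow> 'n vfield) \<Rightarrow> bool" where
  "frame_completion \<Omega> m r s \<longleftrightarrow>
     m \<le> CARD('n) \<and> partial_frame \<Omega> CARD('n) (\<lambda>k. if k \<le> m then r k else s k)"

(* "c i j k" is c_{ij}^k and "\<Gamma> i j k" is Gamma_{ij}^k (upper index last).  For a frame
   the following two equations determine these coefficients uniquely on Omega. *)

definition structure_functions ::
  "(real^'n::finite) set \<Rightarrow> nat \<Rightarrow> (nat \<Rightarrow> 'n vfield) \<Rightarrow> (nat \<Rightarrow> 'n vfield) \<Rightarrow>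
   (nat \<Rightarrow> nat \<Rightarrow> nat \<Rightarrow> real^'n \<Rightarrow> real) \<Rightarrow> bool" where
  "structure_functions \<Omega> m r s c \<longleftrightarrow>
     (\<forall>i\<in>{1..m}. \<forall>j\<in>{1..m}. \<forall>u\<in>\<Omega>.
        lie_bracket (r i) (r j) u =
          (\<Sum>k=1..m. c i j k u *\<^sub>R r k u) + (\<Sum>l=m+1..CARD('n). c i j l u *\<^sub>R s l u))"

definition christoffel_symbols ::
  "(real^'n::finite) set \<Rightarrow> ('n vfield \<Rightarrow> 'n vfield \<Rightarrow> 'n vfield) \<Rightarrow> nat \<Rightarrow>
   (nat \<Rightarrow> 'n vfield) \<Rightarrow> (nat \<Rightarrow> 'n vfield) \<Rightarrow>
   (nat \<Rightarrow> nat \<Rightarrow> nat \<Rightarrow> real^'n \<Rightarrow> real) \<Rightarrow> bool" where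
  "christoffel_symbols \<Omega> nabla m r s \<Gamma> \<longleftrightarrow>
     (\<forall>i\<in>{1..m}. \<forall>j\<in>{1..m}. \<forall>u\<in>\<Omega>.
        nabla (r i) (r j) u =
          (\<Sum>k=1..m. \<Gamma> i j k u *\<^sub>R r k u) + (\<Sum>l=m+1..CARD('n). \<Gamma> i j l u *\<^sub>R s l u))"

definition lambda_system ::
  "(real^'n::finite) set \<Rightarrow> nat \<Rightarrow> (nat \<Rightarrow> 'n vfield) \<Rightarrow>
   (nat \<Rightarrow> nat \<Rightarrow> nat \<Rightarrow> real^'n \<Rightarrow> real) \<Rightarrow> (nat \<Rightarrow> nat \<Rightarrow> nat \<Rightarrow> real^'n \<Rightarrow> real) \<Rightarrow>
   (nat \<Rightarrow> real^'n \<Rightarrow> real) \<Rightarrow> bool" where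
  "lambda_system U m r c \<Gamma> lam \<longleftrightarrow>
     (\<forall>i\<in>{1..m}. \<forall>j\<in>{1..m}. i \<noteq> j \<longrightarrow> (\<forall>u\<in>U.
        lie_deriv (r i) (lam j) u = \<Gamma> j i j u * (lam i u - lam j u))) \<and>
     (\<forall>i\<in>{1..m}. \<forall>j\<in>{1..m}. \<forall>k\<in>{1..m}. i \<noteq> j \<longrightarrow> j \<noteq> k \<longrightarrow> i \<noteq> k \<longrightarrow> (\<forall>u\<in>U.
        lam j u * \<Gamma> i j k u - lam i u * \<Gamma> j i k u - c i j k u * lam k u = 0)) \<and>
     (\<forall>i\<in>{1..m}. \<forall>j\<in>{1..m}. i \<noteq> j \<longrightarrow> (\<forall>l\<in>{m+1..CARD('n)}. \<forall>u\<in>U.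
        (lam j u - lam i u) * \<Gamma> j i l u = 0))"

definition f_system ::
  "(real^'n::finite) set \<Rightarrow> ('n vfield \<Rightarrow> 'n vfield \<Rightarrow> 'n vfield) \<Rightarrow> nat \<Rightarrow> (nat \<Rightarrow> 'n vfield) \<Rightarrow>
   (nat \<Rightarrow> real^'n \<Rightarrow> real) \<Rightarrow> 'n vfield \<Rightarrow> bool" where
  "f_system U nabla m r lam f \<longleftrightarrow>
     (\<forall>i\<in>{1..m}. \<forall>u\<in>U. nabla (r i) f u = lam i u *\<^sub>R r i u)"

(* U, lam witness that f belongs to F(R) at the point p. *)

definition F_witness ::
  "(real^'n::finite) set \<Rightarrow> ('n vfield \<Rightarrow> 'n vfield \<Rightarrow> 'n vfield) \<Rightarrow> nat \<Rightarrow> (nat \<Rightarrow> 'n vfield) \<Rightarrow>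
   real^'n \<Rightarrow> 'n vfield \<Rightarrow> (real^'n) set \<Rightarrow> (nat \<Rightarrow> real^'n \<Rightarrow> real) \<Rightarrow> bool" where
  "F_witness \<Omega> nabla m r p f U lam \<longleftrightarrow>
     open U \<and> p \<in> U \<and> U \<subseteq> \<Omega> \<and> smooth_on U f \<and>
     (\<forall>i\<in>{1..m}. smooth_on U (lam i)) \<and> f_system U nabla m r lam f"

definition F_set ::
  "(real^'n::finite) set \<Rightarrow> ('n vfield \<Rightarrow> 'n vfield \<Rightarrow> 'n vfield) \<Rightarrow> nat \<Rightarrow> (nat \<Rightarrow> 'n vfield) \<Rightarrow>
   real^'n \<Rightarrow> 'n vfield set" where
  "F_set \<Omega> nabla m r p = {f. \<exists>U lam. F_witness \<Omega> nabla m r p f U lam}"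


(* Embedded submanifolds of codimension m, by the local slice condition: near each of its points
   \<Xi> is carried by a diffeomorphism \<phi> (with inverse \<psi>) to a linear subspace. *)

definition embedded_submanifold :: "nat \<Rightarrow> (real^'n::finite) set \<Rightarrow> bool" where
  "embedded_submanifold m \<Xi> \<longleftrightarrow>
     (\<forall>p\<in>\<Xi>. \<exists>W (\<phi> :: 'n vfield) (\<psi> :: 'n vfield) S.
        open W \<and> p \<in> W \<and> open (\<phi> ` W) \<and> smooth_on W \<phi> \<and> smooth_on (\<phi> ` W) \<psi> \<and>
        (\<forall>x\<in>W. \<psi> (\<phi> x) = x) \<and>
        subspace S \<and> dim S + m = CARD('n) \<and>
        \<phi> ` (\<Xi> \<inter> W) = \<phi> ` W \<inter> S)"

definition tangent_space :: "(real^'n::finite) set \<Rightarrow> real^'n \<Rightarrow> (real^'n) set" where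
  "tangent_space \<Xi> u =
     {v. \<exists>\<epsilon> (\<gamma> :: real \<Rightarrow> real^'n). \<epsilon> > 0 \<and> smooth_on {-\<epsilon><..<\<epsilon>} \<gamma> \<and> \<gamma> ` {-\<epsilon><..<\<epsilon>} \<subseteq> \<Xi> \<and>
           \<gamma> 0 = u \<and> (\<gamma> has_vector_derivative v) (at 0)}"

definition transverse :: "nat \<Rightarrow> (nat \<Rightarrow> 'n::finite vfield) \<Rightarrow> (real^'n) set \<Rightarrow> bool" where
  "transverse m r \<Xi> \<longleftrightarrow>
     (\<forall>u\<in>\<Xi>.
        {a + b |a b. a \<in> span ((\<lambda>i. r i u) ` {1..m}) \<and> b \<in> tangent_space \<Xi> u} = UNIV \<and>
        span ((\<lambda>i. r i u) ` {1..m}) \<inter> tangent_space \<Xi> u = {0})"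

(* Smoothness of a map on an embedded submanifold: local extendability to smooth maps on open
   subsets of the ambient space. *)

definition smooth_along :: "(real^'n::finite) set \<Rightarrow> 'n vfield \<Rightarrow> bool" where
  "smooth_along \<Xi> h \<longleftrightarrow>
     (\<forall>p\<in>\<Xi>. \<exists>W (H :: 'n vfield). open W \<and> p \<in> W \<and> smooth_on W H \<and> (\<forall>u\<in>\<Xi> \<inter> W. H u = h u))"

definition solves_initial_value_problem ::
  "(real^'n::finite) set \<Rightarrow> ('n vfield \<Rightarrow> 'n vfield \<Rightarrow> 'n vfield) \<Rightarrow> nat \<Rightarrow> (nat \<Rightarrow> 'n vfield) \<Rightarrow>
   (nat \<Rightarrow> real^'n \<Rightarrow> real) \<Rightarrow> (real^'n) set \<Rightarrow> 'n vfield \<Rightarrow> 'n vfield \<Rightarrow> bool" where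
  "solves_initial_value_problem U nabla m r lam \<Xi> h f \<longleftrightarrow>
     smooth_on U f \<and> f_system U nabla m r lam f \<and> (\<forall>u\<in>\<Xi>. f u = h u)"

end

theory Submission
  imports Defs
begin

text \<open>
  In coordinates a connection is \<open>nabla X Y = DY(X) + B(X, Y)\<close>; symmetry makes \<open>B\<close> symmetric and flatness is
  a curvature identity for \<open>B\<close>. Part 1 compares the coefficients of
  \<open>nabla_i (lam_j r_j) - nabla_j (lam_i r_i) = nabla_{[r_i, r_j]} f\<close> in the frame.

  For part 2, near a point \<open>p\<close> of \<open>\<Xi>\<close> let \<open>P(u)\<close> be the projection onto the span of the \<open>r_i(u)\<close> along the fixed
  complement \<open>T_p \<Xi>\<close>. The fields \<open>P v\<close>, \<open>v\<close> constant, commute: their bracket lies both in the distribution and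
  in the complement. By the \<open>\<lambda>\<close>-system and flatness, their lifts to pairs \<open>(u, f(u))\<close> prescribed by the equations
  for \<open>f\<close> commute as well. Integrating the lifts for unit time from \<open>(\<sigma>, h(\<sigma>))\<close>, \<open>\<sigma>\<close> in \<open>\<Xi>\<close>, yields the
  graph of the solution. Smooth dependence of flows on initial values is obtained by solving the integral equation in
  the Banach space of bounded continuous curves.
\<close>

subsection \<open>Functions of class Ck\<close>

text \<open>\<open>Ck_on\<close> allows values in any normed space but only Euclidean domains. The
  flow is therefore differentiated as a map from a ball of initial values into a Banach space of
  curves, while on the curve space itself only first derivatives occur. The derivative of the flow
  is the inverse of an operator built from the flow, so regularity rises one order at a time. The
  direction \<open>v\<close> of \<open>P v\<close> is made a constant part of the state, so
  dependence on the direction becomes dependence on the initial value, and a single flow sweeps out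
  a whole leaf. With \<open>\<Lambda> r_i = lam_i r_i\<close> and
  \<open>T v = \<Lambda> (P v)\<close>, the \<lambda>-system makes
  \<open>nabla_{P v} (T w) - nabla_{P w} (T v)\<close> equal to \<Lambda> of the bracket of
  \<open>P v\<close> and \<open>P w\<close>. That bracket vanishes, and this is how the
  \<lambda>-system enters the commutation of the lifts. Uniqueness is available only on
  neighbourhoods in which every point is joined to \<Xi> inside its leaf. Such neighbourhoods may
  overlap away from \<Xi>, so the gluing compares their sizes.\<close>

lemma Ck_on_continuous: "Ck_on k S f \<Longrightarrow> continuous_on S f"
  by (cases k) (auto intro!: continuous_at_imp_continuous_on differentiable_imp_continuous_within)

lemma Ck_on_subset: "Ck_on k S f \<Longrightarrow> T \<subseteq> S \<Longrightarrow> Ck_on k T f"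
  by (induction k arbitrary: f) (auto intro: continuous_on_subset)

lemma Ck_on_cong:
  assumes "open S" "\<And>x. x \<in> S \<Longrightarrow> f x = g x" "Ck_on k S f"
  shows "Ck_on k S g"
  using assms(2,3)
proof (induction k arbitrary: f g)
  case 0
  then show ?case by (simp cong: continuous_on_cong_simp)
next
  case (Suc k)
  have d: "g differentiable at x" and
    e: "frechet_derivative f (at x) = frechet_derivative g (at x)" if "x \<in> S" for x
  proof -
    have f: "f differentiable at x" using Suc.prems that by simp
    then show "g differentiable at x"
      using differentiable_transform_within assms(1) that Suc.prems(1)
      by (metis frechet_derivative_works has_derivative_transform_within_open differentiable_def)
    show "frechet_derivative f (at x) = frechet_derivative g (at x)"
      by (rule frechet_derivative_transform_within_open[OF f assms(1) that Suc.prems(1)])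
  qed
  show ?case
    using Suc.IH[of "\<lambda>x. frechet_derivative f (at x) v" "\<lambda>x. frechet_derivative g (at x) v" for v]
      Suc.prems d e by auto
qed

lemma Ck_on_SucD: "Ck_on (Suc k) S f \<Longrightarrow> Ck_on k S f"
proof (induction k arbitrary: f)
  case 0
  then show ?case using Ck_on_continuous by fastforce
next
  case (Suc k)
  then show ?case by (metis Ck_on.simps(2))
qed

text \<open>Frees later inductions from \<open>frechet_derivative\<close>: by uniqueness of
  derivatives, any explicit formula for the derivative may be used.\<close>

lemma Ck_on_SucI:
  assumes "open S" "\<And>x. x \<in> S \<Longrightarrow> (f has_derivative f' x) (at x)" "\<And>v. Ck_on k S (\<lambda>x. f' x v)"
  shows "Ck_on (Suc k) S f"
proof -
  have "f' x = frechet_derivative f (at x)" if "x \<in> S" for x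
    using assms(2)[OF that] by (rule frechet_derivative_at)
  then show ?thesis
    using assms Ck_on_cong[OF assms(1), of "\<lambda>x. f' x v" "\<lambda>x. frechet_derivative f (at x) v" for v]
    by (auto simp: differentiable_def)
qed

lemma Ck_on_has_derivative:
  assumes "Ck_on (Suc k) S f" "x \<in> S"
  shows "(f has_derivative frechet_derivative f (at x)) (at x)"
  using assms by (simp add: frechet_derivative_works)

lemma Ck_on_local:
  assumes "\<And>x. x \<in> S \<Longrightarrow> \<exists>T. open T \<and> x \<in> T \<and> Ck_on k T f"
  shows "Ck_on k S f"
  using assms
proof (induction k arbitrary: f)
  case 0
  then show ?case
    by (auto intro!: continuous_at_imp_continuous_on)
      (metis continuous_on_eq_continuous_at)
next
  case (Suc k)
  show ?case
    using Suc.prems by (auto intro!: Suc.IH) blast+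
qed

lemma Ck_on_const: "Ck_on k S (\<lambda>x. c)"
  by (induction k arbitrary: c) auto

lemma Ck_on_ident: "Ck_on k S (\<lambda>x. x)"
  by (cases k) (auto simp: Ck_on_const)

lemma Ck_on_linear:
  assumes "bounded_linear L" "open S" "Ck_on k S f"
  shows "Ck_on k S (\<lambda>x. L (f x))"
  using assms(3)
proof (induction k arbitrary: f)
  case 0
  then show ?case by (simp add: assms(1) bounded_linear.continuous_on)
next
  case (Suc k)
  show ?case
  proof (rule Ck_on_SucI[OF assms(2)])
    show "((\<lambda>x. L (f x)) has_derivative (\<lambda>v. L (frechet_derivative f (at x) v))) (at x)" if "x \<in> S" for x
      using bounded_linear.has_derivative[OF assms(1)] Ck_on_has_derivative[OF Suc.prems that] by blast
  qed (use Suc in auto)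
qed

lemma Ck_on_add:
  assumes "open S" "Ck_on k S f" "Ck_on k S g"
  shows "Ck_on k S (\<lambda>x. f x + g x)"
  using assms(2,3)
proof (induction k arbitrary: f g)
  case 0
  then show ?case by (simp add: continuous_on_add)
next
  case (Suc k)
  show ?case
    by (rule Ck_on_SucI[OF assms(1) has_derivative_add[OF Ck_on_has_derivative Ck_on_has_derivative]])
      (use Suc in auto)
qed

lemma Ck_on_bilinear:
  assumes "bounded_bilinear b" "open S" "Ck_on k S f" "Ck_on k S g"
  shows "Ck_on k S (\<lambda>x. b (f x) (g x))"
  using assms(3,4)
proof (induction k arbitrary: f g)
  case 0
  then show ?case by (simp add: assms(1) bounded_bilinear.continuous_on)
next
  case (Suc k)
  show ?case
    by (rule Ck_on_SucI[OF assms(2) bounded_bilinear.FDERIV[OF assms(1) Ck_on_has_derivative Ck_on_has_derivative]])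
      (use Suc Ck_on_SucD[of k S f] Ck_on_SucD[of k S g] in \<open>auto intro!: Ck_on_add[OF assms(2)]\<close>)
qed

lemma Ck_on_sum:
  assumes "open S" "\<And>i. i \<in> I \<Longrightarrow> Ck_on k S (f i)"
  shows "Ck_on k S (\<lambda>x. \<Sum>i\<in>I. f i x)"
  using assms(2)
  by (induction I rule: infinite_finite_induct) (auto intro: Ck_on_const Ck_on_add[OF assms(1)])

lemma frechet_derivative_sum_Basis:
  fixes f :: "'a::euclidean_space \<Rightarrow> 'b::real_normed_vector"
  assumes "f differentiable at x"
  shows "frechet_derivative f (at x) v = (\<Sum>b\<in>Basis. (v \<bullet> b) *\<^sub>R frechet_derivative f (at x) b)"
proof -
  have l: "linear (frechet_derivative f (at x))" using assms by (rule linear_frechet_derivative)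
  show ?thesis
    by (subst euclidean_representation[of v, symmetric]) (simp add: linear_sum[OF l] linear_cmul[OF l])
qed

text \<open>The induction hypothesis covers derivatives of \<open>g\<close> in fixed directions
  only, whereas the chain rule applies the derivative of \<open>g\<close> to a vector that moves
  with \<open>x\<close>. Expanding that vector in the basis separates the two.\<close>

lemma Ck_on_compose:
  fixes g :: "'b::euclidean_space \<Rightarrow> 'c::real_normed_vector"
  assumes "open S" "Ck_on k T g" "Ck_on k S f" "f ` S \<subseteq> T"
  shows "Ck_on k S (\<lambda>x. g (f x))"
  using assms(2,3)
proof (induction k arbitrary: g)
  case 0
  then show ?case
    using continuous_on_compose2 assms(4) by auto
next
  case (Suc k)
  have T: "f x \<in> T" if "x \<in> S" for x using assms(4) that by auto
  show ?case
  proof (rule Ck_on_SucI[OF assms(1)])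
    show "((\<lambda>x. g (f x)) has_derivative
      (\<lambda>v. \<Sum>b\<in>Basis. (frechet_derivative f (at x) v \<bullet> b) *\<^sub>R frechet_derivative g (at (f x)) b)) (at x)"
      if x: "x \<in> S" for x
    proof -
      have g: "g differentiable at (f x)" using Suc.prems T x by simp
      show ?thesis
        unfolding frechet_derivative_sum_Basis[OF g, symmetric]
        using diff_chain_at[OF Ck_on_has_derivative[OF Suc.prems(2) x]
            Ck_on_has_derivative[OF Suc.prems(1) T[OF x]]] by (simp add: o_def)
    qed
    show "Ck_on k S (\<lambda>x. \<Sum>b\<in>Basis. (frechet_derivative f (at x) v \<bullet> b) *\<^sub>R frechet_derivative g (at (f x)) b)"
      for v
      using Suc.prems Suc.IH Ck_on_SucD[OF Suc.prems(2)]
      by (auto intro!: Ck_on_sum assms(1) Ck_on_bilinear[OF bounded_bilinear_scaleR]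
          Ck_on_linear[OF bounded_linear_inner_left])
  qed
qed

subsection \<open>Smooth functions\<close>

named_theorems smooth_intros

lemma smooth_on_continuous: "smooth_on S f \<Longrightarrow> continuous_on S f"
  unfolding smooth_on_def using Ck_on_continuous by blast

lemma smooth_on_subset: "smooth_on S f \<Longrightarrow> T \<subseteq> S \<Longrightarrow> smooth_on T f"
  unfolding smooth_on_def using Ck_on_subset by blast

lemma smooth_on_cong:
  "open S \<Longrightarrow> (\<And>x. x \<in> S \<Longrightarrow> f x = g x) \<Longrightarrow> smooth_on S f \<Longrightarrow> smooth_on S g"
  unfolding smooth_on_def using Ck_on_cong by blast

lemma smooth_on_local:
  "(\<And>x. x \<in> S \<Longrightarrow> \<exists>T. open T \<and> x \<in> T \<and> smooth_on T f) \<Longrightarrow> smooth_on S f"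
  unfolding smooth_on_def by (metis Ck_on_local)

lemma smooth_on_differentiable: "smooth_on S f \<Longrightarrow> x \<in> S \<Longrightarrow> f differentiable at x"
  unfolding smooth_on_def by (metis Ck_on.simps(2))

lemma smooth_on_has_derivative:
  "smooth_on S f \<Longrightarrow> x \<in> S \<Longrightarrow> (f has_derivative frechet_derivative f (at x)) (at x)"
  using smooth_on_differentiable frechet_derivative_works by blast

lemma smooth_on_frechet_derivative_const:
  "smooth_on S f \<Longrightarrow> smooth_on S (\<lambda>x. frechet_derivative f (at x) v)"
  unfolding smooth_on_def by (metis Ck_on.simps(2))

lemma smooth_on_const [smooth_intros]: "smooth_on S (\<lambda>x. c)"
  by (simp add: smooth_on_def Ck_on_const)

lemma smooth_on_ident [smooth_intros]: "smooth_on S (\<lambda>x. x)"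
  by (simp add: smooth_on_def Ck_on_ident)

lemma smooth_on_linear:
  "bounded_linear L \<Longrightarrow> open S \<Longrightarrow> smooth_on S f \<Longrightarrow> smooth_on S (\<lambda>x. L (f x))"
  by (simp add: smooth_on_def Ck_on_linear)

lemma smooth_on_bilinear:
  "bounded_bilinear b \<Longrightarrow> open S \<Longrightarrow> smooth_on S f \<Longrightarrow> smooth_on S g \<Longrightarrow> smooth_on S (\<lambda>x. b (f x) (g x))"
  by (simp add: smooth_on_def Ck_on_bilinear)

lemma smooth_on_add [smooth_intros]:
  "open S \<Longrightarrow> smooth_on S f \<Longrightarrow> smooth_on S g \<Longrightarrow> smooth_on S (\<lambda>x. f x + g x)"
  by (simp add: smooth_on_def Ck_on_add)

lemma smooth_on_sum [smooth_intros]: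
  "open S \<Longrightarrow> (\<And>i. i \<in> I \<Longrightarrow> smooth_on S (f i)) \<Longrightarrow> smooth_on S (\<lambda>x. \<Sum>i\<in>I. f i x)"
  by (simp add: smooth_on_def Ck_on_sum)

lemma smooth_on_minus [smooth_intros]:
  "open S \<Longrightarrow> smooth_on S f \<Longrightarrow> smooth_on S (\<lambda>x. - f x)"
  by (rule smooth_on_linear[OF bounded_linear_minus[OF bounded_linear_ident]])

lemma smooth_on_diff [smooth_intros]:
  "open S \<Longrightarrow> smooth_on S f \<Longrightarrow> smooth_on S g \<Longrightarrow> smooth_on S (\<lambda>x. f x - g x)"
  using smooth_on_add[of S f "\<lambda>x. - g x"] smooth_on_minus[of S g] by simp

lemmas smooth_on_bilinear_intros [smooth_intros] =
  smooth_on_bilinear[OF bounded_bilinear_scaleR]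
  smooth_on_bilinear[OF bounded_bilinear_inner]
  smooth_on_bilinear[OF bounded_bilinear_mult]
  smooth_on_bilinear[OF bounded_bilinear_blinfun_apply]

lemmas smooth_on_linear_intros [smooth_intros] =
  smooth_on_linear[OF bounded_linear_fst]
  smooth_on_linear[OF bounded_linear_snd]

lemma smooth_on_Pair [smooth_intros]:
  assumes "open S" "smooth_on S f" "smooth_on S g"
  shows "smooth_on S (\<lambda>x. (f x, g x))"
proof -
  have "bounded_linear (\<lambda>x. (x, 0))" "bounded_linear (\<lambda>x. (0, x))"
    by (auto intro: bounded_linear_Pair bounded_linear_ident bounded_linear_zero)
  from this[THEN smooth_on_linear, OF assms(1)]
  have "smooth_on S (\<lambda>x. (f x, 0) + (0, g x))"
    using assms by (intro smooth_on_add)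
  then show ?thesis by simp
qed

lemma smooth_on_compose:
  fixes g :: "'b::euclidean_space \<Rightarrow> 'c::real_normed_vector"
  shows "open S \<Longrightarrow> smooth_on T g \<Longrightarrow> smooth_on S f \<Longrightarrow> f ` S \<subseteq> T \<Longrightarrow> smooth_on S (\<lambda>x. g (f x))"
  unfolding smooth_on_def using Ck_on_compose by blast

lemma smooth_on_frechet_derivative [smooth_intros]:
  fixes f :: "'a::euclidean_space \<Rightarrow> 'b::real_normed_vector"
  assumes "open S" "smooth_on S f" "smooth_on S w"
  shows "smooth_on S (\<lambda>x. frechet_derivative f (at x) (w x))"
proof (rule smooth_on_cong[OF assms(1)])
  show "(\<Sum>b\<in>Basis. (w x \<bullet> b) *\<^sub>R frechet_derivative f (at x) b) = frechet_derivative f (at x) (w x)"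
    if "x \<in> S" for x
    using frechet_derivative_sum_Basis[OF smooth_on_differentiable[OF assms(2) that], of "w x"] by simp
qed (intro smooth_intros assms smooth_on_frechet_derivative_const)

section \<open>Symmetry of second derivatives\<close>

text \<open>The second difference treats \<open>v\<close> and \<open>w\<close> alike, so comparing
  it with one mixed derivative is enough for symmetry. The mean value inequality is applied twice:
  along \<open>w\<close> to the derivative of \<open>f\<close> in direction \<open>v\<close>, then
  along \<open>v\<close> to a difference of values of \<open>f\<close>. Each use contributes a
  factor \<open>t\<close>.\<close>

lemma frechet_derivative_symmetric_aux:
  fixes f :: "'a::euclidean_space \<Rightarrow> 'b::real_normed_vector"
  assumes "open S" "smooth_on S f" "u \<in> S" "e > 0"
  obtains d where "d > 0" "\<And>t. 0 < t \<Longrightarrow> t < d \<Longrightarrow>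
    norm (f (u + t *\<^sub>R v + t *\<^sub>R w) - f (u + t *\<^sub>R v) - f (u + t *\<^sub>R w) + f u
      - (t * t) *\<^sub>R frechet_derivative (\<lambda>x. frechet_derivative f (at x) v) (at u) w) \<le> e * (t * t)"
proof -
  define g where "g = (\<lambda>x. frechet_derivative f (at x) v)"
  define D where "D = (\<lambda>x. frechet_derivative g (at x) w)"
  have g: "smooth_on S g" unfolding g_def by (rule smooth_on_frechet_derivative_const[OF assms(2)])
  have "continuous_on S D" unfolding D_def
    by (intro smooth_on_continuous smooth_on_frechet_derivative_const g)
  then have "isCont D u" using assms continuous_on_eq_continuous_at by blast
  then obtain d1 where d1: "d1 > 0" "\<And>x. dist x u < d1 \<Longrightarrow> dist (D x) (D u) < e"
    unfolding continuous_at_eps_delta using assms(4) by metis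
  obtain d2 where d2: "d2 > 0" "ball u d2 \<subseteq> S" using assms(1,3) open_contains_ball by blast
  \<comment> \<open>Scaled so that the whole parallelogram of side parameter \<open>t < d\<close>
    stays within \<open>d1\<close> and \<open>d2\<close> of \<open>u\<close>; the summand 1 keeps
    the denominator positive when both vectors vanish.\<close>
  define d where "d = min d1 d2 / (norm v + norm w + 1)"
  have N: "norm v + norm w + 1 > 0" by (simp add: add_nonneg_pos)
  have dpos: "d > 0" unfolding d_def using d1 d2 N by simp
  have near: "dist (u + s *\<^sub>R v + r *\<^sub>R w) u < min d1 d2" if "0 \<le> s" "s \<le> t" "0 \<le> r" "r \<le> t" "t < d" for s r t
  proof -
    have "dist (u + s *\<^sub>R v + r *\<^sub>R w) u \<le> norm (s *\<^sub>R v) + norm (r *\<^sub>R w)"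
      by (simp add: dist_norm) (metis add.assoc add_diff_cancel_left' norm_scaleR norm_triangle_ineq)
    also have "\<dots> \<le> t * norm v + t * norm w"
      using that by (auto intro!: add_mono mult_right_mono)
    also have "\<dots> \<le> t * (norm v + norm w + 1)" using that by (simp add: algebra_simps)
    also have "\<dots> < d * (norm v + norm w + 1)" using that N by (simp add: mult_strict_right_mono)
    also have "\<dots> = min d1 d2" unfolding d_def using N by simp
    finally show ?thesis .
  qed
  have "norm (f (u + t *\<^sub>R v + t *\<^sub>R w) - f (u + t *\<^sub>R v) - f (u + t *\<^sub>R w) + f u - (t * t) *\<^sub>R D u) \<le> e * (t * t)"
    if t: "0 < t" "t < d" for t
  proof -
    have inS: "u + s *\<^sub>R v + r *\<^sub>R w \<in> S" if "s \<in> {0..t}" "r \<in> {0..t}" for s r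
      using near[of s t r] that t d2 by (auto simp: dist_commute subset_iff)
    have inner_est: "norm (g (u + s *\<^sub>R v + t *\<^sub>R w) - g (u + s *\<^sub>R v) - t *\<^sub>R D u) \<le> t * e"
      if s: "s \<in> {0..t}" for s
    proof -
      define q where "q = (\<lambda>r. g (u + s *\<^sub>R v + r *\<^sub>R w) - r *\<^sub>R D u)"
      have q': "(q has_vector_derivative (D (u + s *\<^sub>R v + r *\<^sub>R w) - D u)) (at r within {0..t})" if "r \<in> {0..t}" for r
      proof -
        have "((\<lambda>r. u + s *\<^sub>R v + r *\<^sub>R w) has_vector_derivative w) (at r within {0..t})"
          by (auto intro!: derivative_eq_intros simp: has_vector_derivative_def)
        from vector_derivative_diff_chain_within[OF this has_derivative_at_withinI[OF smooth_on_has_derivative[OF g inS[OF s that]]]]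
        have "((\<lambda>r. g (u + s *\<^sub>R v + r *\<^sub>R w)) has_vector_derivative D (u + s *\<^sub>R v + r *\<^sub>R w)) (at r within {0..t})"
          by (simp add: D_def o_def)
        then show ?thesis unfolding q_def
          by (auto intro!: derivative_eq_intros simp: has_vector_derivative_def scaleR_diff_right)
      qed
      have "norm (q t - q 0) \<le> e * norm (t - 0)"
      proof (rule differentiable_bound[of "{0..t}" q "\<lambda>r h. h *\<^sub>R (D (u + s *\<^sub>R v + r *\<^sub>R w) - D u)"])
        show "onorm (\<lambda>h. h *\<^sub>R (D (u + s *\<^sub>R v + r *\<^sub>R w) - D u)) \<le> e" if "r \<in> {0..t}" for r
        proof (rule onorm_le)
          fix h
          have "norm (D (u + s *\<^sub>R v + r *\<^sub>R w) - D u) \<le> e"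
            using d1(2)[of "u + s *\<^sub>R v + r *\<^sub>R w"] near[of s t r] s that t by (simp add: dist_norm less_imp_le)
          then show "norm (h *\<^sub>R (D (u + s *\<^sub>R v + r *\<^sub>R w) - D u)) \<le> e * norm h"
            by (simp add: mult.commute[of e] mult_left_mono)
        qed
      qed (use t q' in \<open>auto simp: has_vector_derivative_def\<close>)
      then show ?thesis using t by (simp add: q_def algebra_simps)
    qed
    define p where "p = (\<lambda>s. f (u + s *\<^sub>R v + t *\<^sub>R w) - f (u + s *\<^sub>R v) - (s * t) *\<^sub>R D u)"
    have p': "(p has_vector_derivative (g (u + s *\<^sub>R v + t *\<^sub>R w) - g (u + s *\<^sub>R v) - t *\<^sub>R D u)) (at s within {0..t})"
      if s: "s \<in> {0..t}" for s
    proof -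
      have *: "((\<lambda>s. f (u + s *\<^sub>R v + r *\<^sub>R w)) has_vector_derivative g (u + s *\<^sub>R v + r *\<^sub>R w)) (at s within {0..t})"
        if "r \<in> {0..t}" for r
      proof -
        have "((\<lambda>s. u + s *\<^sub>R v + r *\<^sub>R w) has_vector_derivative v) (at s within {0..t})"
          by (auto intro!: derivative_eq_intros simp: has_vector_derivative_def)
        from vector_derivative_diff_chain_within[OF this has_derivative_at_withinI[OF smooth_on_has_derivative[OF assms(2) inS[OF s that]]]]
        show ?thesis by (simp add: g_def o_def)
      qed
      have D: "((\<lambda>s. (s * t) *\<^sub>R D u) has_vector_derivative (t *\<^sub>R D u)) (at s within {0..t})"
        by (auto intro!: derivative_eq_intros simp: has_vector_derivative_def)
      show ?thesis unfolding p_def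
        using *[of t] *[of 0] t D by (intro has_vector_derivative_diff) auto
    qed
    have "norm (p t - p 0) \<le> (t * e) * norm (t - 0)"
    proof (rule differentiable_bound[of "{0..t}" p "\<lambda>s h. h *\<^sub>R (g (u + s *\<^sub>R v + t *\<^sub>R w) - g (u + s *\<^sub>R v) - t *\<^sub>R D u)"])
      show "onorm (\<lambda>h. h *\<^sub>R (g (u + s *\<^sub>R v + t *\<^sub>R w) - g (u + s *\<^sub>R v) - t *\<^sub>R D u)) \<le> t * e" if "s \<in> {0..t}" for s
        by (rule onorm_le) (use inner_est[OF that] in \<open>simp add: mult.commute mult_left_mono\<close>)
    qed (use t p' in \<open>auto simp: has_vector_derivative_def\<close>)
    then show ?thesis using t by (simp add: p_def algebra_simps)
  qed
  with dpos show ?thesis using that unfolding D_def g_def by blast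
qed

lemma frechet_derivative_symmetric:
  fixes f :: "'a::euclidean_space \<Rightarrow> 'b::real_normed_vector"
  assumes "open S" "smooth_on S f" "u \<in> S"
  shows "frechet_derivative (\<lambda>x. frechet_derivative f (at x) v) (at u) w
       = frechet_derivative (\<lambda>x. frechet_derivative f (at x) w) (at u) v" (is "?A = ?B")
proof (rule ccontr)
  assume "?A \<noteq> ?B"
  \<comment> \<open>Both mixed derivatives match the same second difference up to
    \<open>e * (t * t)\<close>, hence differ by at most \<open>2 * e\<close>, which contradicts a
    distance of \<open>3 * e\<close>.\<close>
  define e where "e = norm (?A - ?B) / 3"
  have e: "e > 0" using \<open>?A \<noteq> ?B\<close> by (simp add: e_def)
  obtain d1 where d1: "d1 > 0" "\<And>t. 0 < t \<Longrightarrow> t < d1 \<Longrightarrow>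
    norm (f (u + t *\<^sub>R v + t *\<^sub>R w) - f (u + t *\<^sub>R v) - f (u + t *\<^sub>R w) + f u - (t * t) *\<^sub>R ?A) \<le> e * (t * t)"
    using frechet_derivative_symmetric_aux[OF assms e] by blast
  obtain d2 where d2: "d2 > 0" "\<And>t. 0 < t \<Longrightarrow> t < d2 \<Longrightarrow>
    norm (f (u + t *\<^sub>R w + t *\<^sub>R v) - f (u + t *\<^sub>R w) - f (u + t *\<^sub>R v) + f u - (t * t) *\<^sub>R ?B) \<le> e * (t * t)"
    using frechet_derivative_symmetric_aux[OF assms e] by blast
  define t where "t = min d1 d2 / 2"
  have t: "0 < t" "t < d1" "t < d2" using d1 d2 by (auto simp: t_def)
  define q where "q = f (u + t *\<^sub>R v + t *\<^sub>R w) - f (u + t *\<^sub>R v) - f (u + t *\<^sub>R w) + f u"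
  have 1: "norm (q - (t * t) *\<^sub>R ?A) \<le> e * (t * t)" using d1 t by (auto simp: q_def)
  have "u + t *\<^sub>R w + t *\<^sub>R v = u + t *\<^sub>R v + t *\<^sub>R w" by simp
  then have 2: "norm (q - (t * t) *\<^sub>R ?B) \<le> e * (t * t)"
    using d2(2)[OF t(1,3)] by (simp add: q_def algebra_simps)
  have "(t * t) *\<^sub>R (?A - ?B) = (q - (t * t) *\<^sub>R ?B) - (q - (t * t) *\<^sub>R ?A)" by (simp add: algebra_simps)
  then have "norm ((t * t) *\<^sub>R (?A - ?B)) \<le> 2 * (e * (t * t))"
    using 1 2 norm_triangle_ineq4[of "q - (t * t) *\<^sub>R ?B" "q - (t * t) *\<^sub>R ?A"] by simp
  then have "(t * t) * norm (?A - ?B) \<le> (t * t) * (2 * e)"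
    using t by (simp only: norm_scaleR abs_mult) (simp add: ac_simps)
  then have "norm (?A - ?B) \<le> 2 * e" using t by simp
  then show False using e unfolding e_def by simp
qed

section \<open>Regularity of operator inverses\<close>

text \<open>Where one factor of a product vanishes, continuity of the other factor suffices for the
  product rule. This allows an inverse that is so far only known to be continuous to be
  differentiated.\<close>

lemma bilinear_has_derivative_zero:
  assumes b: "bounded_bilinear b" and c: "isCont c x" and d: "(d has_derivative d') (at x)" and 0: "d x = 0"
  shows "((\<lambda>y. b (c y) (d y)) has_derivative (\<lambda>h. b (c x) (d' h))) (at x)"
proof -
  interpret b: bounded_bilinear b by (rule b)
  have 1: "((\<lambda>y. b (c x) (d y)) has_derivative (\<lambda>h. b (c x) (d' h))) (at x)"
    by (rule bounded_linear.has_derivative[OF b.bounded_linear_right d])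
  obtain K where K: "K > 0" "\<And>u v. norm (b u v) \<le> norm u * norm v * K" using b.pos_bounded by blast
  have bd: "bounded_linear d'" using d by (rule has_derivative_bounded_linear)
  \<comment> \<open>The first factor tends to zero and the second is at most linear in
    \<open>norm (y - x)\<close>, so this part of the product is of smaller order.\<close>
  have 2: "((\<lambda>y. b (c y - c x) (d y)) has_derivative (\<lambda>h. 0)) (at x)"
    unfolding has_derivative_at_alt
  proof (intro conjI allI impI)
    fix e :: real assume e: "e > 0"
    obtain d1 where d1: "d1 > 0" "\<And>y. norm (y - x) < d1 \<Longrightarrow> norm (d y - d x - d' (y - x)) \<le> 1 * norm (y - x)"
      using d unfolding has_derivative_at_alt by (meson zero_less_one)
    define C where "C = 1 + onorm d'"
    have C: "C > 0" unfolding C_def using onorm_pos_le[OF bd] by simp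
    have dC: "norm (d y) \<le> C * norm (y - x)" if "norm (y - x) < d1" for y
    proof -
      have "norm (d y) \<le> norm (d y - d x - d' (y - x)) + norm (d' (y - x))"
        using norm_triangle_sub[of "d y" "d' (y - x)"] by (simp add: 0)
      also have "\<dots> \<le> norm (y - x) + onorm d' * norm (y - x)"
        using d1(2)[OF that] onorm[OF bd, of "y - x"] by simp
      finally show ?thesis by (simp add: C_def algebra_simps)
    qed
    have "e / (C * K) > 0" using e C K by simp
    then obtain d2 where d2: "d2 > 0" "\<And>y. dist y x < d2 \<Longrightarrow> dist (c y) (c x) < e / (C * K)"
      using c unfolding continuous_at_eps_delta by blast
    show "\<exists>\<delta>>0. \<forall>y. norm (y - x) < \<delta> \<longrightarrow>
        norm (b (c y - c x) (d y) - b (c x - c x) (d x) - 0) \<le> e * norm (y - x)"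
    proof (intro exI[of _ "min d1 d2"] conjI allI impI)
      fix y assume y: "norm (y - x) < min d1 d2"
      have "norm (b (c y - c x) (d y)) \<le> norm (c y - c x) * norm (d y) * K" by (rule K)
      also have "\<dots> \<le> (e / (C * K)) * (C * norm (y - x)) * K"
        using y d2(2)[of y] dC[of y] K C e by (intro mult_right_mono mult_mono) (auto simp: dist_norm)
      also have "\<dots> = e * norm (y - x)" using K C by simp
      finally show "norm (b (c y - c x) (d y) - b (c x - c x) (d x) - 0) \<le> e * norm (y - x)"
        by (simp add: b.zero_left)
    qed (use d1 d2 in auto)
  qed simp
  have "(\<lambda>y. b (c y) (d y)) = (\<lambda>y. b (c x) (d y) + b (c y - c x) (d y))"
    by (simp add: b.add_left[symmetric])
  then show ?thesis using has_derivative_add[OF 1 2] by simp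
qed

text \<open>The resolvent identity: a difference of inverses contains the factor
  \<open>Ly - Lx\<close>, which passes the regularity of \<open>L\<close> on to
  \<open>N\<close>.\<close>

lemma blinfun_inverse_diff:
  assumes "Ny o\<^sub>L Ly = id_blinfun" "Lx o\<^sub>L Nx = id_blinfun"
  shows "Ny = Nx - (Ny o\<^sub>L ((Ly - Lx) o\<^sub>L Nx))"
proof (rule blinfun_eqI)
  fix v
  have "Ny (Ly w) = w" for w by (metis assms(1) blinfun_apply_blinfun_compose blinfun_apply_id_blinfun)
  moreover have "Lx (Nx v) = v" by (metis assms(2) blinfun_apply_blinfun_compose blinfun_apply_id_blinfun)
  ultimately show "Ny v = (Nx - (Ny o\<^sub>L ((Ly - Lx) o\<^sub>L Nx))) v"
    by (simp add: blinfun.bilinear_simps)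
qed

lemma isCont_blinfun_inverse:
  fixes L N :: "'a::real_normed_vector \<Rightarrow> 'b::real_normed_vector \<Rightarrow>\<^sub>L 'b"
  assumes "open S" "x \<in> S" "isCont L x"
    "\<And>x. x \<in> S \<Longrightarrow> N x o\<^sub>L L x = id_blinfun" "\<And>x. x \<in> S \<Longrightarrow> L x o\<^sub>L N x = id_blinfun"
    "\<And>x. x \<in> S \<Longrightarrow> norm (N x) \<le> C"
  shows "isCont N x"
proof -
  have "((\<lambda>y. N y - N x) \<longlongrightarrow> 0) (at x)"
  proof (rule Lim_null_comparison)
    show "\<forall>\<^sub>F y in at x. norm (N y - N x) \<le> C * (norm (L y - L x) * norm (N x))"
      unfolding eventually_at_topological
    proof (intro exI[of _ S] conjI ballI impI assms(1,2))
      fix y assume y: "y \<in> S"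
      have "N y - N x = - (N y o\<^sub>L ((L y - L x) o\<^sub>L N x))"
        using blinfun_inverse_diff[OF assms(4)[OF y] assms(5)[OF assms(2)]] by (simp add: algebra_simps)
      then have "norm (N y - N x) \<le> norm (N y) * norm ((L y - L x) o\<^sub>L N x)"
        using norm_blinfun_compose[of "N y" "(L y - L x) o\<^sub>L N x"] by simp
      also have "\<dots> \<le> C * (norm (L y - L x) * norm (N x))"
        using assms(6)[OF y] order_trans[OF norm_ge_zero assms(6)[OF y]] by (intro mult_mono norm_blinfun_compose) auto
      finally show "norm (N y - N x) \<le> C * (norm (L y - L x) * norm (N x))" .
    qed
    have "((\<lambda>y. L y - L x) \<longlongrightarrow> 0) (at x)" using assms(3) unfolding isCont_def by (simp add: LIM_zero)
    from tendsto_norm_zero[OF this]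
    show "((\<lambda>y. C * (norm (L y - L x) * norm (N x))) \<longlongrightarrow> 0) (at x)"
      by (rule tendsto_mult_right_zero[OF tendsto_mult_left_zero])
  qed
  then show ?thesis unfolding isCont_def by (simp add: LIM_zero_iff)
qed

text \<open>The resolvent identity writes \<open>N\<close> near \<open>x\<close> as a constant minus
  a product with a factor vanishing at \<open>x\<close>. Continuity of \<open>N\<close> then already
  gives the derivative, minus \<open>N\<close> times the derivative of \<open>L\<close> times
  \<open>N\<close>, and this formula has one order of regularity to spare for the induction.\<close>

lemma Ck_on_blinfun_inverse_bounded:
  fixes L N :: "'a::euclidean_space \<Rightarrow> 'b::real_normed_vector \<Rightarrow>\<^sub>L 'b"
  assumes S: "open S" and L: "Ck_on k S L"
    and NL: "\<And>x. x \<in> S \<Longrightarrow> N x o\<^sub>L L x = id_blinfun" and LN: "\<And>x. x \<in> S \<Longrightarrow> L x o\<^sub>L N x = id_blinfun"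
    and C: "\<And>x. x \<in> S \<Longrightarrow> norm (N x) \<le> C"
  shows "Ck_on k S N"
proof -
  have cont: "isCont N x" if "x \<in> S" for x
  proof -
    have "isCont L x" using Ck_on_continuous[OF L] S that continuous_on_eq_continuous_at by blast
    then show ?thesis by (rule isCont_blinfun_inverse[OF S that _ NL LN C])
  qed
  show ?thesis
    using L
  proof (induction k)
    case 0
    show ?case using cont by (simp add: continuous_at_imp_continuous_on)
  next
    case (Suc k)
    show ?case
    proof (rule Ck_on_SucI[OF S])
      fix x assume x: "x \<in> S"
      let ?L = "frechet_derivative L (at x)"
      have "((\<lambda>y. (L y - L x) o\<^sub>L N x) has_derivative (\<lambda>h. ?L h o\<^sub>L N x)) (at x)"
        using bounded_linear.has_derivative[OF bounded_bilinear.bounded_linear_left[OF bounded_bilinear_blinfun_compose]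
            has_derivative_diff[OF Ck_on_has_derivative[OF Suc.prems x] has_derivative_const[of "L x"]], of "N x"]
        by simp
      from bilinear_has_derivative_zero[OF bounded_bilinear_blinfun_compose cont[OF x] this]
      have "((\<lambda>y. N x - (N y o\<^sub>L ((L y - L x) o\<^sub>L N x))) has_derivative (\<lambda>h. 0 - (N x o\<^sub>L (?L h o\<^sub>L N x)))) (at x)"
        by (intro has_derivative_diff has_derivative_const) auto
      then show "(N has_derivative (\<lambda>h. 0 - (N x o\<^sub>L (?L h o\<^sub>L N x)))) (at x)"
        by (rule has_derivative_transform_within_open[OF _ S x])
          (use blinfun_inverse_diff[OF NL LN] x in auto)
    next
      fix v
      have "Ck_on k S N" by (rule Suc.IH[OF Ck_on_SucD[OF Suc.prems]])
      moreover have "Ck_on k S (\<lambda>x. frechet_derivative L (at x) v)" using Suc.prems by simp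
      ultimately have "Ck_on k S (\<lambda>x. N x o\<^sub>L (frechet_derivative L (at x) v o\<^sub>L N x))"
        by (intro Ck_on_bilinear[OF bounded_bilinear_blinfun_compose] S)
      from Ck_on_linear[OF bounded_linear_minus[OF bounded_linear_ident] S this]
      show "Ck_on k S (\<lambda>x. 0 - (N x o\<^sub>L (frechet_derivative L (at x) v o\<^sub>L N x)))" by simp
    qed
  qed
qed

lemma Ck_on_blinfun_inverse:
  fixes L N :: "'a::euclidean_space \<Rightarrow> 'b::real_normed_vector \<Rightarrow>\<^sub>L 'b"
  assumes S: "open S" and L: "Ck_on k S L"
    and NL: "\<And>x. x \<in> S \<Longrightarrow> N x o\<^sub>L L x = id_blinfun" and LN: "\<And>x. x \<in> S \<Longrightarrow> L x o\<^sub>L N x = id_blinfun"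
  shows "Ck_on k S N"
proof (rule Ck_on_local)
  fix x0 assume x0: "x0 \<in> S"
  have "isCont L x0" using Ck_on_continuous[OF L] S x0 continuous_on_eq_continuous_at by blast
  \<comment> \<open>With this tolerance \<open>norm (L y - L x0) * norm (N x0)\<close> is at most
    1/2. The resolvent identity then bounds \<open>norm (N y)\<close> by
    \<open>norm (N x0) + norm (N y) / 2\<close>, and the last term is absorbed on the left.\<close>
  moreover have "1 / (2 * (norm (N x0) + 1)) > 0" by (simp add: add_nonneg_pos)
  ultimately obtain d where d: "d > 0" "\<And>y. dist y x0 < d \<Longrightarrow> dist (L y) (L x0) < 1 / (2 * (norm (N x0) + 1))"
    unfolding continuous_at_eps_delta by blast
  define T where "T = ball x0 d \<inter> S"
  have T: "open T" "x0 \<in> T" "T \<subseteq> S" using d S x0 by (auto simp: T_def)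
  have "norm (N y) \<le> 2 * norm (N x0)" if "y \<in> T" for y
  proof -
    have y: "y \<in> S" "dist y x0 < d" using that by (auto simp: T_def dist_commute)
    have "norm (L y - L x0) * norm (N x0) \<le> (1 / (2 * (norm (N x0) + 1))) * norm (N x0)"
      using d(2)[OF y(2)] by (intro mult_right_mono) (auto simp: dist_norm)
    also have "\<dots> \<le> 1 / 2" using norm_ge_zero[of "N x0"] by (auto simp add: divide_simps simp del: norm_ge_zero)
    finally have h: "norm ((L y - L x0) o\<^sub>L N x0) \<le> 1 / 2" using norm_blinfun_compose order_trans by blast
    have "norm (N y) \<le> norm (N x0) + norm (N y o\<^sub>L ((L y - L x0) o\<^sub>L N x0))"
      using blinfun_inverse_diff[OF NL[OF y(1)] LN[OF x0]] by (metis norm_triangle_ineq4)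
    also have "\<dots> \<le> norm (N x0) + norm (N y) * norm ((L y - L x0) o\<^sub>L N x0)"
      using norm_blinfun_compose by (simp add: norm_blinfun_compose)
    also have "\<dots> \<le> norm (N x0) + norm (N y) * (1 / 2)"
      using h by (intro add_left_mono mult_left_mono) auto
    finally show ?thesis by simp
  qed
  then have "Ck_on k T N"
    using Ck_on_blinfun_inverse_bounded[OF T(1), of k L N] Ck_on_subset[OF L T(3)] NL LN T(3) by blast
  then show "\<exists>T. open T \<and> x0 \<in> T \<and> Ck_on k T N" using T by blast
qed

lemma smooth_on_blinfun_inverse:
  fixes L N :: "'a::euclidean_space \<Rightarrow> 'b::real_normed_vector \<Rightarrow>\<^sub>L 'b"
  shows "open S \<Longrightarrow> smooth_on S L \<Longrightarrow> (\<And>x. x \<in> S \<Longrightarrow> N x o\<^sub>L L x = id_blinfun) \<Longrightarrow>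
    (\<And>x. x \<in> S \<Longrightarrow> L x o\<^sub>L N x = id_blinfun) \<Longrightarrow> smooth_on S N"
  unfolding smooth_on_def using Ck_on_blinfun_inverse by blast

section \<open>Derivatives as operator-valued functions\<close>

text \<open>An operator on a Euclidean space is a finite sum of rank-one operators formed from its
  values on the basis, so regularity of these values is regularity in operator norm.\<close>

lemma Ck_on_blinfun_componentwise:
  fixes L :: "'a::euclidean_space \<Rightarrow> 'b::euclidean_space \<Rightarrow>\<^sub>L 'c::real_normed_vector"
  assumes S: "open S" and "\<And>b. b \<in> Basis \<Longrightarrow> Ck_on k S (\<lambda>x. L x b)"
  shows "Ck_on k S L"
proof (rule Ck_on_cong[OF S])
  show "(\<Sum>b\<in>Basis. blinfun_scaleR_left (L x b) o\<^sub>L blinfun_inner_left b) = L x" for x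
  proof (rule blinfun_eqI)
    fix v
    have "(\<Sum>b\<in>Basis. (v \<bullet> b) *\<^sub>R L x b) = L x (\<Sum>b\<in>Basis. (v \<bullet> b) *\<^sub>R b)"
      by (simp add: blinfun.bilinear_simps blinfun.sum_right)
    then show "(\<Sum>b\<in>Basis. blinfun_scaleR_left (L x b) o\<^sub>L blinfun_inner_left b) v = L x v"
      by (simp add: blinfun.sum_left euclidean_representation blinfun_inner_left.rep_eq)
  qed
  have "Ck_on k S (\<lambda>x. blinfun_scaleR_left (L x b) o\<^sub>L blinfun_inner_left b)" if "b \<in> Basis" for b
    by (rule Ck_on_linear[OF bounded_linear_compose[OF
          bounded_bilinear.bounded_linear_left[OF bounded_bilinear_blinfun_compose]
          bounded_linear_blinfun_scaleR_left] S assms(2)[OF that]])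
  then show "Ck_on k S (\<lambda>x. \<Sum>b\<in>Basis. blinfun_scaleR_left (L x b) o\<^sub>L blinfun_inner_left b)"
    by (intro Ck_on_sum S)
qed

lemma smooth_on_blinfun_componentwise:
  fixes L :: "'a::euclidean_space \<Rightarrow> 'b::euclidean_space \<Rightarrow>\<^sub>L 'c::real_normed_vector"
  shows "open S \<Longrightarrow> (\<And>b. smooth_on S (\<lambda>x. L x b)) \<Longrightarrow> smooth_on S L"
  unfolding smooth_on_def by (blast intro: Ck_on_blinfun_componentwise)

text \<open>\<open>frechet_derivative\<close> is a bare function; packed as a bounded operator it
  has a norm, can be uniformly continuous on a compact set, can be inverted and can itself be
  differentiated.\<close>

definition blinfun_deriv :: "('a::real_normed_vector \<Rightarrow> 'b::real_normed_vector) \<Rightarrow> 'a \<Rightarrow> 'a \<Rightarrow>\<^sub>L 'b" where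
  "blinfun_deriv f x = Blinfun (frechet_derivative f (at x))"

lemma blinfun_deriv_apply:
  assumes "f differentiable at x"
  shows "blinfun_apply (blinfun_deriv f x) = frechet_derivative f (at x)"
  unfolding blinfun_deriv_def
  by (rule bounded_linear_Blinfun_apply) (use assms frechet_derivative_works has_derivative_bounded_linear in blast)

lemma smooth_on_blinfun_deriv:
  assumes "open S" "smooth_on S f"
  shows "smooth_on S (blinfun_deriv f)"
proof (rule smooth_on_blinfun_componentwise[OF assms(1)])
  show "smooth_on S (\<lambda>x. blinfun_deriv f x b)" for b
    by (rule smooth_on_cong[OF assms(1) _ smooth_on_frechet_derivative_const[OF assms(2), of b]])
      (simp add: blinfun_deriv_apply smooth_on_differentiable[OF assms(2)])
qed

lemma has_derivative_blinfun_deriv: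
  "smooth_on S f \<Longrightarrow> x \<in> S \<Longrightarrow> (f has_derivative blinfun_apply (blinfun_deriv f x)) (at x)"
  by (simp add: blinfun_deriv_apply smooth_on_differentiable smooth_on_has_derivative)

text \<open>One \<open>d\<close> serves all base points of \<open>K\<close>. For a curve with values
  in \<open>K\<close> the remainder is thus small uniformly in time, as the supremum norm
  requires.\<close>

lemma C1_uniformly_differentiable_on_compact:
  fixes f :: "'a::euclidean_space \<Rightarrow> 'b::real_normed_vector"
  assumes S: "open S" and f: "smooth_on S f" and K: "compact K" "K \<subseteq> S" and e: "e > 0"
  obtains d where "d > 0"
    "\<And>a h. a \<in> K \<Longrightarrow> norm h \<le> d \<Longrightarrow> a + h \<in> S"
    "\<And>a h. a \<in> K \<Longrightarrow> norm h \<le> d \<Longrightarrow> norm (f (a + h) - f a - blinfun_deriv f a h) \<le> e * norm h"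
proof -
  obtain d0 where d0: "d0 > 0" "(\<Union>x\<in>K. cball x d0) \<subseteq> S"
    using compact_subset_open_imp_cball_epsilon_subset[OF K(1) S K(2)] by blast
  \<comment> \<open>A compact neighbourhood of \<open>K\<close> inside \<open>S\<close>: the
    derivative is compared at points of \<open>K\<close> and at nearby points, which may lie outside
    \<open>K\<close>.\<close>
  define K' where "K' = (\<lambda>(x, y). x + y) ` (K \<times> cball 0 d0)"
  have K': "compact K'" unfolding K'_def
    by (intro compact_continuous_image compact_Times K compact_cball) (auto intro!: continuous_intros simp: split_beta)
  have inK': "a + h \<in> K'" if "a \<in> K" "norm h \<le> d0" for a h
    using that by (force simp: K'_def)
  have K'S: "K' \<subseteq> S"
  proof
    fix x assume "x \<in> K'"
    then obtain a h where "x = a + h" "a \<in> K" "norm h \<le> d0" by (auto simp: K'_def)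
    then have "x \<in> cball a d0" by (simp add: dist_norm)
    then show "x \<in> S" using d0 \<open>a \<in> K\<close> by blast
  qed
  have "uniformly_continuous_on K' (blinfun_deriv f)"
    using compact_uniformly_continuous[OF _ K'] continuous_on_subset[OF smooth_on_continuous[OF smooth_on_blinfun_deriv[OF S f]] K'S]
    by blast
  then obtain d1 where d1: "d1 > 0"
    "\<And>x y. x \<in> K' \<Longrightarrow> y \<in> K' \<Longrightarrow> dist y x < d1 \<Longrightarrow> dist (blinfun_deriv f y) (blinfun_deriv f x) < e"
    using e unfolding uniformly_continuous_on_def by metis
  define d where "d = min d0 (d1 / 2)"
  have d: "d > 0" "d \<le> d0" "d < d1" using d0 d1 by (auto simp: d_def)
  have est: "norm (f (a + h) - f a - blinfun_deriv f a h) \<le> e * norm h" if a: "a \<in> K" and h: "norm h \<le> d" for a h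
  proof -
    have "norm (f (a + h) - f a - blinfun_deriv f a (a + h - a)) \<le> norm (a + h - a) * e"
    proof (rule differentiable_bound_linearization[where S = "cball a d"])
      show "a + t *\<^sub>R (a + h - a) \<in> cball a d" if "t \<in> {0..1}" for t
      proof -
        have "norm (t *\<^sub>R h) \<le> 1 * norm h" using that by (simp add: mult_left_le_one_le)
        then show ?thesis using h by (simp add: dist_norm)
      qed
      fix x assume x: "x \<in> cball a d"
      then have xh: "x = a + (x - a)" "norm (x - a) \<le> d" by (auto simp: dist_norm norm_minus_commute)
      then have xK: "x \<in> K'" using inK'[OF a, of "x - a"] d by simp
      then show "(f has_derivative blinfun_deriv f x) (at x within cball a d)"
        using has_derivative_blinfun_deriv[OF f] K'S has_derivative_at_withinI by blast
      have "dist x a < d1" using xh d by (simp add: dist_norm)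
      then have "dist (blinfun_deriv f x) (blinfun_deriv f a) < e"
        using d1(2)[of a x] xK inK'[OF a, of 0] d0 by simp
      then have "norm (blinfun_deriv f x - blinfun_deriv f a) \<le> e" by (simp add: dist_norm)
      then show "onorm (blinfun_apply (blinfun_deriv f x) - blinfun_apply (blinfun_deriv f a)) \<le> e"
        by (simp add: norm_blinfun.rep_eq blinfun.diff_left[abs_def] fun_diff_def)
    qed (use d in auto)
    then show ?thesis by (simp add: mult.commute)
  qed
  show ?thesis
  proof (rule that[OF d(1) _ est])
    show "a + h \<in> S" if "a \<in> K" "norm h \<le> d" for a h
      using inK'[of a h] that d K'S by auto
  qed
qed

subsection \<open>Bounded continuous curves\<close>

definition bcontfun_bilinear ::
  "('a::real_normed_vector \<Rightarrow> 'b::real_normed_vector \<Rightarrow> 'c::real_normed_vector) \<Rightarrow>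
    ('t::topological_space \<Rightarrow>\<^sub>C 'a) \<Rightarrow> ('t \<Rightarrow>\<^sub>C 'b) \<Rightarrow> ('t \<Rightarrow>\<^sub>C 'c)" where
  "bcontfun_bilinear b f g = Bcontfun (\<lambda>t. b (apply_bcontfun f t) (apply_bcontfun g t))"

lemma apply_bcontfun_bilinear:
  assumes "bounded_bilinear b"
  shows "apply_bcontfun (bcontfun_bilinear b f g) = (\<lambda>t. b (apply_bcontfun f t) (apply_bcontfun g t))"
proof -
  obtain K where K: "K > 0" "\<And>u v. norm (b u v) \<le> norm u * norm v * K"
    using bounded_bilinear.pos_bounded[OF assms] by blast
  have "(\<lambda>t. b (apply_bcontfun f t) (apply_bcontfun g t)) \<in> bcontfun"
  proof (rule bcontfun_normI)
    show "continuous_on UNIV (\<lambda>t. b (apply_bcontfun f t) (apply_bcontfun g t))"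
      by (rule bounded_bilinear.continuous_on[OF assms]) auto
    show "norm (b (apply_bcontfun f t) (apply_bcontfun g t)) \<le> norm f * norm g * K" for t
      by (rule order_trans[OF K(2)]) (use K in \<open>intro mult_right_mono mult_mono norm_bounded, auto\<close>)
  qed
  then show ?thesis unfolding bcontfun_bilinear_def by (rule Bcontfun_inverse)
qed

lemma bounded_bilinear_bcontfun_bilinear:
  assumes "bounded_bilinear b"
  shows "bounded_bilinear (bcontfun_bilinear b)"
proof -
  interpret b: bounded_bilinear b by (rule assms)
  obtain K where K: "K > 0" "\<And>u v. norm (b u v) \<le> norm u * norm v * K"
    using b.pos_bounded by blast
  show ?thesis
  proof
    show "\<exists>K. \<forall>f g. norm (bcontfun_bilinear b f g) \<le> norm f * norm g * K"
    proof (intro exI[of _ K] allI norm_bound)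
      fix f g t
      show "norm (apply_bcontfun (bcontfun_bilinear b f g) t) \<le> norm f * norm g * K"
        unfolding apply_bcontfun_bilinear[OF assms]
        by (rule order_trans[OF K(2)]) (use K in \<open>intro mult_right_mono mult_mono norm_bounded, auto\<close>)
    qed
  qed (auto intro!: bcontfun_eqI simp: apply_bcontfun_bilinear[OF assms] b.add_left b.add_right b.scaleR_left b.scaleR_right)
qed

text \<open>The superposition operator on curves. It is meaningful only for curves on which
  \<open>Y\<close> is continuous and bounded, so each use first confines the values of the curve to
  a compact set.\<close>

definition nemytskii :: "('a::metric_space \<Rightarrow> 'b::metric_space) \<Rightarrow> ('t::topological_space \<Rightarrow>\<^sub>C 'a) \<Rightarrow> ('t \<Rightarrow>\<^sub>C 'b)" where
  "nemytskii Y w = Bcontfun (\<lambda>t. Y (apply_bcontfun w t))"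

lemma apply_nemytskii:
  assumes "compact K" "continuous_on K Y" "range (apply_bcontfun w) \<subseteq> K"
  shows "apply_bcontfun (nemytskii Y w) = (\<lambda>t. Y (apply_bcontfun w t))"
proof -
  have "(\<lambda>t. Y (apply_bcontfun w t)) \<in> bcontfun"
    unfolding bcontfun_def
  proof (intro CollectI conjI)
    show "continuous_on UNIV (\<lambda>t. Y (apply_bcontfun w t))"
      using continuous_on_compose2[OF assms(2), of UNIV "apply_bcontfun w"] assms(3) by auto
    have "bounded (Y ` K)" by (intro compact_imp_bounded compact_continuous_image assms)
    then show "bounded (range (\<lambda>t. Y (apply_bcontfun w t)))"
      by (rule bounded_subset) (use assms(3) in auto)
  qed
  then show ?thesis unfolding nemytskii_def by (rule Bcontfun_inverse)
qed

text \<open>The derivative is pointwise multiplication by the derivative of \<open>Y\<close> along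
  \<open>w\<close>. It is a derivative for the supremum norm because the remainder of
  \<open>Y\<close> is uniform over \<open>K\<close>.\<close>

lemma nemytskii_has_derivative:
  fixes Y :: "'a::euclidean_space \<Rightarrow> 'b::real_normed_vector" and w :: "'t::topological_space \<Rightarrow>\<^sub>C 'a"
  assumes S: "open S" and Y: "smooth_on S Y" and K: "compact K" "K \<subseteq> S" and w: "range (apply_bcontfun w) \<subseteq> K"
  shows "(nemytskii Y has_derivative bcontfun_bilinear blinfun_apply (nemytskii (blinfun_deriv Y) w)) (at w)"
  unfolding has_derivative_at_alt
proof (intro conjI allI impI)
  show "bounded_linear (bcontfun_bilinear blinfun_apply (nemytskii (blinfun_deriv Y) w))"
    by (rule bounded_bilinear.bounded_linear_right[OF bounded_bilinear_bcontfun_bilinear[OF bounded_bilinear_blinfun_apply]])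
  have DY: "apply_bcontfun (nemytskii (blinfun_deriv Y) w) = (\<lambda>t. blinfun_deriv Y (apply_bcontfun w t))"
    by (rule apply_nemytskii[OF K(1) continuous_on_subset[OF smooth_on_continuous[OF smooth_on_blinfun_deriv[OF S Y]] K(2)] w])
  fix e :: real assume e: "e > 0"
  obtain d where d: "d > 0" "\<And>a h. a \<in> K \<Longrightarrow> norm h \<le> d \<Longrightarrow> a + h \<in> S"
    "\<And>a h. a \<in> K \<Longrightarrow> norm h \<le> d \<Longrightarrow> norm (Y (a + h) - Y a - blinfun_deriv Y a h) \<le> e * norm h"
    using C1_uniformly_differentiable_on_compact[OF S Y K e] by blast
  \<comment> \<open>Contains the values of all curves within distance \<open>d\<close> of
    \<open>w\<close>, so \<open>nemytskii Y\<close> acts as genuine composition on a whole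
    ball.\<close>
  define K' where "K' = (\<lambda>(x, y). x + y) ` (K \<times> cball 0 d)"
  have K': "compact K'" unfolding K'_def
    by (intro compact_continuous_image compact_Times K compact_cball) (auto intro!: continuous_intros simp: split_beta)
  have K'S: "K' \<subseteq> S" using d(2) by (auto simp: K'_def)
  have N: "apply_bcontfun (nemytskii Y v) = (\<lambda>t. Y (apply_bcontfun v t))" if "norm (v - w) < d" for v
  proof (rule apply_nemytskii[OF K' continuous_on_subset[OF smooth_on_continuous[OF Y] K'S]], safe)
    fix t
    have "norm (apply_bcontfun v t - apply_bcontfun w t) \<le> d"
      using that norm_bounded[of "v - w" t] by simp
    moreover have "apply_bcontfun v t = apply_bcontfun w t + (apply_bcontfun v t - apply_bcontfun w t)" by simp
    ultimately show "apply_bcontfun v t \<in> K'" unfolding K'_def using w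
      by (metis (no_types, lifting) SigmaI mem_cball_0 pair_imageI range_subsetD)
  qed
  show "\<exists>d>0. \<forall>v. norm (v - w) < d \<longrightarrow>
     norm (nemytskii Y v - nemytskii Y w - bcontfun_bilinear blinfun_apply (nemytskii (blinfun_deriv Y) w) (v - w))
       \<le> e * norm (v - w)"
  proof (intro exI[of _ d] conjI d(1) allI impI norm_bound)
    fix v t assume v: "norm (v - w) < d"
    have h: "norm (apply_bcontfun (v - w) t) \<le> norm (v - w)" by (rule norm_bounded)
    have "norm (Y (apply_bcontfun w t + apply_bcontfun (v - w) t) - Y (apply_bcontfun w t)
        - blinfun_deriv Y (apply_bcontfun w t) (apply_bcontfun (v - w) t)) \<le> e * norm (apply_bcontfun (v - w) t)"
      using w v h by (intro d(3)) auto
    also have "\<dots> \<le> e * norm (v - w)" using h e by simp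
    finally show "norm (apply_bcontfun (nemytskii Y v - nemytskii Y w
        - bcontfun_bilinear blinfun_apply (nemytskii (blinfun_deriv Y) w) (v - w)) t) \<le> e * norm (v - w)"
      using N[OF v] N[of w] d(1) by (simp add: apply_bcontfun_bilinear[OF bounded_bilinear_blinfun_apply] DY)
  qed
qed

text \<open>Stated along a family of curves with Euclidean parameter, as \<open>Ck_on\<close>
  demands. The derivative is expanded in the basis so that it involves superposition only with
  directional derivatives of \<open>Y\<close>; these are again smooth, and the induction hypothesis
  applies with them in place of \<open>Y\<close>.\<close>

lemma Ck_on_nemytskii:
  fixes Y :: "'a::euclidean_space \<Rightarrow> 'b::real_normed_vector"
    and f :: "'p::euclidean_space \<Rightarrow> ('t::topological_space \<Rightarrow>\<^sub>C 'a)"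
  assumes S: "open S" and K: "compact K" "K \<subseteq> S" and Q: "open Q"
    and fK: "\<And>q. q \<in> Q \<Longrightarrow> range (apply_bcontfun (f q)) \<subseteq> K"
    and f: "Ck_on k Q f" and Y: "smooth_on S Y"
  shows "Ck_on k Q (\<lambda>q. nemytskii Y (f q))"
  using f Y
proof (induction k arbitrary: Y)
  case 0
  show ?case unfolding Ck_on.simps
  proof (intro continuous_at_imp_continuous_on ballI)
    fix q assume q: "q \<in> Q"
    have "isCont (nemytskii Y) (f q)"
      by (rule has_derivative_continuous[OF nemytskii_has_derivative[OF S 0(2) K fK[OF q]]])
    moreover have "isCont f q" using 0(1) Q q continuous_on_eq_continuous_at by auto
    ultimately show "isCont (\<lambda>q. nemytskii Y (f q)) q" by (rule isCont_o2[rotated])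
  qed
next
  case (Suc k)
  let ?D = "\<lambda>q v. \<Sum>b\<in>Basis. bcontfun_bilinear (*\<^sub>R)
      (bcontfun_bilinear (\<bullet>) (frechet_derivative f (at q) v) (const_bcontfun b))
      (nemytskii (\<lambda>x. frechet_derivative Y (at x) b) (f q))"
  show ?case
  proof (rule Ck_on_SucI[OF Q])
    fix q assume q: "q \<in> Q"
    have *: "bcontfun_bilinear blinfun_apply (nemytskii (blinfun_deriv Y) (f q)) (frechet_derivative f (at q) v) = ?D q v" for v
    proof (rule bcontfun_eqI)
      fix t
      define c where "c = apply_bcontfun (f q) t"
      define h where "h = apply_bcontfun (frechet_derivative f (at q) v) t"
      have c: "c \<in> S" using fK[OF q] K unfolding c_def by auto
      have "apply_bcontfun (nemytskii (blinfun_deriv Y) (f q)) t = blinfun_deriv Y c"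
        using apply_nemytskii[OF K(1) continuous_on_subset[OF smooth_on_continuous[OF smooth_on_blinfun_deriv[OF S Suc.prems(2)]] K(2)] fK[OF q]]
        by (simp add: c_def)
      then have l: "apply_bcontfun (bcontfun_bilinear blinfun_apply (nemytskii (blinfun_deriv Y) (f q)) (frechet_derivative f (at q) v)) t
        = frechet_derivative Y (at c) h"
        by (simp add: apply_bcontfun_bilinear[OF bounded_bilinear_blinfun_apply] h_def
            blinfun_deriv_apply[OF smooth_on_differentiable[OF Suc.prems(2) c]])
      have s: "apply_bcontfun (\<Sum>b\<in>B. F b) t = (\<Sum>b\<in>B. apply_bcontfun (F b) t)" for B and F :: "'a \<Rightarrow> ('t \<Rightarrow>\<^sub>C 'b)"
        by (induction B rule: infinite_finite_induct) auto
      have n: "apply_bcontfun (nemytskii (\<lambda>x. frechet_derivative Y (at x) b) (f q)) t = frechet_derivative Y (at c) b" for b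
        using apply_nemytskii[OF K(1) continuous_on_subset[OF smooth_on_continuous[OF smooth_on_frechet_derivative_const[OF Suc.prems(2)]] K(2)] fK[OF q]]
        by (simp add: c_def)
      have "apply_bcontfun (?D q v) t = (\<Sum>b\<in>Basis. (h \<bullet> b) *\<^sub>R frechet_derivative Y (at c) b)"
        by (simp add: s n apply_bcontfun_bilinear[OF bounded_bilinear_scaleR] apply_bcontfun_bilinear[OF bounded_bilinear_inner]
            h_def const_bcontfun.rep_eq)
      then show "apply_bcontfun (bcontfun_bilinear blinfun_apply (nemytskii (blinfun_deriv Y) (f q)) (frechet_derivative f (at q) v)) t
        = apply_bcontfun (?D q v) t"
        unfolding l frechet_derivative_sum_Basis[OF smooth_on_differentiable[OF Suc.prems(2) c], of h] by simp
    qed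
    have "((\<lambda>q. nemytskii Y (f q)) has_derivative
        (\<lambda>v. bcontfun_bilinear blinfun_apply (nemytskii (blinfun_deriv Y) (f q)) (frechet_derivative f (at q) v))) (at q)"
      using diff_chain_at[OF Ck_on_has_derivative[OF Suc.prems(1) q] nemytskii_has_derivative[OF S Suc.prems(2) K fK[OF q]]]
      by (simp add: o_def)
    then show "((\<lambda>q. nemytskii Y (f q)) has_derivative ?D q) (at q)" unfolding * .
  next
    fix v
    have "Ck_on k Q (\<lambda>q. frechet_derivative f (at q) v)" using Suc.prems by simp
    moreover have "Ck_on k Q (\<lambda>q. nemytskii (\<lambda>x. frechet_derivative Y (at x) b) (f q))" for b
      by (rule Suc.IH[OF Ck_on_SucD[OF Suc.prems(1)] smooth_on_frechet_derivative_const[OF Suc.prems(2)]])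
    ultimately show "Ck_on k Q (\<lambda>q. ?D q v)"
      by (intro Ck_on_sum Q Ck_on_bilinear[OF bounded_bilinear_bcontfun_bilinear[OF bounded_bilinear_scaleR]]
          Ck_on_bilinear[OF bounded_bilinear_bcontfun_bilinear[OF bounded_bilinear_inner]] Ck_on_const) auto
  qed
qed

text \<open>Curves are defined on the whole line, so the time is clamped to \<open>{0..\<tau>}\<close>.\<close>

definition bcontfun_integral :: "real \<Rightarrow> (real \<Rightarrow>\<^sub>C 'a::euclidean_space) \<Rightarrow> (real \<Rightarrow>\<^sub>C 'a)" where
  "bcontfun_integral \<tau> w = Bcontfun (\<lambda>t. integral {0..max 0 (min \<tau> t)} (apply_bcontfun w))"

lemma apply_bcontfun_integral:
  assumes "0 \<le> \<tau>"
  shows "apply_bcontfun (bcontfun_integral \<tau> w) = (\<lambda>t. integral {0..max 0 (min \<tau> t)} (apply_bcontfun w))"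
    and "norm (bcontfun_integral \<tau> w) \<le> \<tau> * norm w"
proof -
  let ?f = "\<lambda>t. integral {0..max 0 (min \<tau> t)} (apply_bcontfun w)"
  have i: "apply_bcontfun w integrable_on {0..s}" for s
    by (rule integrable_continuous_real) simp
  have bd: "norm (?f t) \<le> \<tau> * norm w" for t
  proof -
    have "norm (?f t) \<le> norm w * (max 0 (min \<tau> t) - 0)"
      by (rule integral_bound) (auto intro: norm_bounded)
    also have "\<dots> \<le> norm w * \<tau>" using assms by (intro mult_left_mono) auto
    finally show ?thesis by (simp add: mult.commute)
  qed
  have "?f \<in> bcontfun"
  proof (rule bcontfun_normI[OF _ bd])
    have "continuous_on {0..\<tau>} (\<lambda>s. integral {0..s} (apply_bcontfun w))"
      by (rule indefinite_integral_continuous_1[OF i])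
    moreover have "continuous_on UNIV (\<lambda>t. max 0 (min \<tau> t))" by (intro continuous_intros)
    ultimately show "continuous_on UNIV ?f"
      by (rule continuous_on_compose2) (use assms in auto)
  qed
  then show *: "apply_bcontfun (bcontfun_integral \<tau> w) = ?f"
    unfolding bcontfun_integral_def by (rule Bcontfun_inverse)
  show "norm (bcontfun_integral \<tau> w) \<le> \<tau> * norm w"
    by (rule norm_bound) (simp add: * bd)
qed

lemma bounded_linear_bcontfun_integral:
  assumes "0 \<le> \<tau>"
  shows "bounded_linear (bcontfun_integral \<tau>)"
proof (rule bounded_linear_intro[where K = \<tau>])
  have i: "apply_bcontfun w integrable_on {0..s}" for s and w :: "real \<Rightarrow>\<^sub>C 'a"
    by (rule integrable_continuous_real) simp
  show "bcontfun_integral \<tau> (v + w) = bcontfun_integral \<tau> v + bcontfun_integral \<tau> w" for v w :: "real \<Rightarrow>\<^sub>C 'a"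
    by (rule bcontfun_eqI) (simp add: apply_bcontfun_integral(1)[OF assms] integral_add[OF i i])
  show "bcontfun_integral \<tau> (c *\<^sub>R w) = c *\<^sub>R bcontfun_integral \<tau> w" for c and w :: "real \<Rightarrow>\<^sub>C 'a"
    by (rule bcontfun_eqI) (simp add: apply_bcontfun_integral(1)[OF assms])
  show "norm (bcontfun_integral \<tau> w) \<le> norm w * \<tau>" for w :: "real \<Rightarrow>\<^sub>C 'a"
    using apply_bcontfun_integral(2)[OF assms, of w] by (simp add: mult.commute)
qed

lemma bcontfun_integral_has_vector_derivative:
  assumes "t \<in> {0..\<tau>}"
  shows "(apply_bcontfun (bcontfun_integral \<tau> w) has_vector_derivative apply_bcontfun w t) (at t within {0..\<tau>})"
proof -
  have \<tau>: "0 \<le> \<tau>" using assms by simp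
  have "((\<lambda>u. integral {0..u} (apply_bcontfun w)) has_vector_derivative apply_bcontfun w t) (at t within {0..\<tau>})"
    by (rule integral_has_vector_derivative) (use assms in auto)
  then show ?thesis
    by (rule has_vector_derivative_transform[OF assms, rotated]) (auto simp: apply_bcontfun_integral(1)[OF \<tau>])
qed

text \<open>Solving \<open>(id - K) w = y\<close> means finding the fixed point of \<open>w\<close>
  to \<open>y + K w\<close>, a contraction with factor 1/2. The same factor gives
  \<open>norm w\<close> at most \<open>norm y + norm w / 2\<close>, hence the bound 2.\<close>

lemma blinfun_neumann:
  fixes K :: "'b::{real_normed_vector,complete_space} \<Rightarrow>\<^sub>L 'b"
  assumes K: "norm K \<le> 1 / 2"
  shows "\<exists>N. N o\<^sub>L (id_blinfun - K) = id_blinfun \<and> (id_blinfun - K) o\<^sub>L N = id_blinfun \<and> norm N \<le> 2"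
proof -
  have bK: "norm (K x) \<le> norm x / 2" for x
    using norm_blinfun[of K x] mult_right_mono[OF K, of "norm x"] by simp
  have ex: "\<exists>!w. y + K w = w" for y
  proof (rule banach_fix_type[of "1/2"])
    show "\<forall>v w. dist (y + K v) (y + K w) \<le> 1 / 2 * dist v w"
      using bK by (simp add: dist_norm blinfun.bilinear_simps[symmetric])
  qed auto
  define n where "n y = (THE w. y + K w = w)" for y
  have n: "y + K (n y) = n y" for y unfolding n_def by (rule theI'[OF ex])
  have n_unique: "n y = w" if "y + K w = w" for y w
    using ex[of y] n[of y] that by blast
  have bl: "bounded_linear n"
  proof (rule bounded_linear_intro[where K = 2])
    show "n (x + y) = n x + n y" for x y
      by (rule n_unique) (metis n blinfun.add_right add.assoc add.left_commute)
    show "n (c *\<^sub>R y) = c *\<^sub>R n y" for c y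
      by (rule n_unique) (metis n blinfun.scaleR_right scaleR_right_distrib)
    show "norm (n y) \<le> norm y * 2" for y
      using norm_triangle_ineq[of y "K (n y)"] bK[of "n y"] unfolding n by simp
  qed
  define N where "N = Blinfun n"
  have N: "blinfun_apply N = n" unfolding N_def by (rule bounded_linear_Blinfun_apply[OF bl])
  have "N o\<^sub>L (id_blinfun - K) = id_blinfun"
    by (rule blinfun_eqI) (simp add: N blinfun.bilinear_simps n_unique)
  moreover have "(id_blinfun - K) o\<^sub>L N = id_blinfun"
  proof (rule blinfun_eqI)
    fix y show "((id_blinfun - K) o\<^sub>L N) y = id_blinfun y"
      using n[of y] by (simp add: N blinfun.bilinear_simps algebra_simps)
  qed
  moreover have "norm N \<le> 2"
  proof (rule norm_blinfun_bound)
    show "norm (N y) \<le> 2 * norm y" for y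
      using norm_triangle_ineq[of y "K (n y)"] bK[of "n y"] unfolding n N by simp
  qed simp
  ultimately show ?thesis by blast
qed

subsection \<open>Local flows of smooth vector fields\<close>

text \<open>A solution curve is a fixed point of \<open>z + I (NX w)\<close> in the space of bounded
  continuous curves. Both the contraction estimate and the invertibility of the linearised equation
  come from the same short time. The last conclusion is the variational equation, which the
  integration of commuting fields relies on.\<close>

theorem smooth_local_flow:
  fixes X :: "'a::euclidean_space \<Rightarrow> 'a"
  assumes S: "open S" and X: "smooth_on S X" and a0: "a0 \<in> S"
  obtains \<tau> R \<phi> where "\<tau> > 0" "R > 0"
    "\<And>x. x \<in> ball a0 R \<Longrightarrow> \<phi> 0 x = x"
    "\<And>t x. x \<in> ball a0 R \<Longrightarrow> \<phi> t x \<in> S"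
    "\<And>t x. x \<in> ball a0 R \<Longrightarrow> t \<in> {0..\<tau>} \<Longrightarrow>
      ((\<lambda>t. \<phi> t x) has_vector_derivative X (\<phi> t x)) (at t within {0..\<tau>})"
    "\<And>t. smooth_on (ball a0 R) (\<phi> t)"
    "\<And>t x e. x \<in> ball a0 R \<Longrightarrow> t \<in> {0..\<tau>} \<Longrightarrow>
      ((\<lambda>t. frechet_derivative (\<phi> t) (at x) e) has_vector_derivative
        frechet_derivative X (at (\<phi> t x)) (frechet_derivative (\<phi> t) (at x) e)) (at t within {0..\<tau>})"
proof -
  obtain R0 where R0: "R0 > 0" "cball a0 R0 \<subseteq> S" using S a0 open_contains_cball by blast
  \<comment> \<open>Half of the radius \<open>R0\<close> is left for the initial value, the other
    half for the displacement along the flow.\<close>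
  define R where "R = R0 / 2"
  define K where "K = cball a0 R0"
  have R: "R > 0" "R0 = R + R" using R0 by (auto simp: R_def)
  have K: "compact K" "K \<subseteq> S" "convex K" "closed K" using R0 by (auto simp: K_def)
  have DX: "smooth_on S (blinfun_deriv X)" by (rule smooth_on_blinfun_deriv[OF S X])
  have cX: "continuous_on K X" and cDX: "continuous_on K (blinfun_deriv X)"
    using smooth_on_continuous[OF X] smooth_on_continuous[OF DX] K continuous_on_subset by blast+
  obtain M where M: "M > 0" "\<And>a. a \<in> K \<Longrightarrow> norm (X a) \<le> M"
    using compact_imp_bounded[OF compact_continuous_image[OF cX K(1)]] unfolding bounded_pos by auto
  obtain L where L: "L > 0" "\<And>a. a \<in> K \<Longrightarrow> norm (blinfun_deriv X a) \<le> L"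
    using compact_imp_bounded[OF compact_continuous_image[OF cDX K(1)]] unfolding bounded_pos by auto
  \<comment> \<open>Up to time \<open>R / M\<close> a curve of speed at most \<open>M\<close> moves
    by at most \<open>R\<close>; the bound \<open>1 / (2 * L)\<close> makes the integral map and its
    linearisation contract by 1/2.\<close>
  define \<tau> where "\<tau> = min (R / M) (1 / (2 * L))"
  have \<tau>: "\<tau> > 0" "\<tau> * M \<le> R" "\<tau> * L \<le> 1 / 2"
  proof -
    show "\<tau> > 0" using R M L by (simp add: \<tau>_def)
    have "\<tau> * M \<le> (R / M) * M" unfolding \<tau>_def using M by (intro mult_right_mono) auto
    then show "\<tau> * M \<le> R" using M by simp
    have "\<tau> * L \<le> (1 / (2 * L)) * L" unfolding \<tau>_def using L by (intro mult_right_mono) auto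
    then show "\<tau> * L \<le> 1 / 2" using L by simp
  qed
  have \<tau>0: "0 \<le> \<tau>" using \<tau> by simp
  define I :: "(real \<Rightarrow>\<^sub>C 'a) \<Rightarrow> (real \<Rightarrow>\<^sub>C 'a)" where "I = bcontfun_integral \<tau>"
  have I: "bounded_linear I" unfolding I_def by (rule bounded_linear_bcontfun_integral[OF \<tau>0])
  have nI: "norm (I w) \<le> \<tau> * norm w" for w unfolding I_def by (rule apply_bcontfun_integral(2)[OF \<tau>0])
  define NX :: "(real \<Rightarrow>\<^sub>C 'a) \<Rightarrow> (real \<Rightarrow>\<^sub>C 'a)" where "NX = nemytskii X"
  define D :: "(real \<Rightarrow>\<^sub>C 'a) set" where "D = {w. range (apply_bcontfun w) \<subseteq> K}"
  have D_PiC: "D = PiC UNIV (\<lambda>_. K)" unfolding D_def by (auto simp: mem_PiC_iff image_subset_iff Pi_iff)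
  have cD: "complete D" unfolding complete_eq_closed D_PiC by (intro closed_PiC K)
  have NX: "apply_bcontfun (NX w) = (\<lambda>t. X (apply_bcontfun w t))" if "w \<in> D" for w
    unfolding NX_def by (rule apply_nemytskii[OF K(1) cX]) (use that in \<open>auto simp: D_def\<close>)
  have lipX: "norm (X a - X b) \<le> L * norm (a - b)" if "a \<in> K" "b \<in> K" for a b
  proof (rule differentiable_bound[OF K(3) _ _ that])
    show "(X has_derivative blinfun_deriv X x) (at x within K)" if "x \<in> K" for x
      using has_derivative_blinfun_deriv[OF X] K(2) that has_derivative_at_withinI by blast
    show "onorm (blinfun_apply (blinfun_deriv X x)) \<le> L" if "x \<in> K" for x
      using L(2)[OF that] by (simp add: norm_blinfun.rep_eq)
  qed
  \<comment> \<open>The inhomogeneity \<open>z\<close> ranges over an open set of curves instead of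
    constants only, so that the solution map \<open>g\<close> inverts a map between open parts of
    one Banach space.\<close>
  define Z :: "(real \<Rightarrow>\<^sub>C 'a) set" where "Z = ball (const_bcontfun a0) R"
  have step_in: "z + I (NX w) \<in> D" if "z \<in> Z" "w \<in> D" for z w
    unfolding D_def
  proof safe
    fix t
    have "norm (NX w) \<le> M"
      by (rule norm_bound) (use NX[OF that(2)] M(2) that(2) in \<open>auto simp: D_def\<close>)
    then have "norm (I (NX w)) \<le> \<tau> * M" using nI[of "NX w"] \<tau>0 by (meson mult_left_mono order_trans)
    then have 1: "norm (apply_bcontfun (I (NX w)) t) \<le> R" using norm_bounded[of "I (NX w)" t] \<tau> by linarith
    have 2: "dist a0 (apply_bcontfun z t) < R"
      using dist_fun_lt_imp_dist_val_lt[of "const_bcontfun a0" z R t] that(1) by (simp add: Z_def const_bcontfun.rep_eq)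
    have "dist a0 (apply_bcontfun (z + I (NX w)) t) \<le> dist a0 (apply_bcontfun z t) + norm (apply_bcontfun (I (NX w)) t)"
      using dist_triangle[of a0 "apply_bcontfun (z + I (NX w)) t" "apply_bcontfun z t"] by (simp add: dist_norm)
    then show "apply_bcontfun (z + I (NX w)) t \<in> K" using 1 2 R by (simp add: K_def)
  qed
  have contr: "norm (I (NX v) - I (NX w)) \<le> 1 / 2 * norm (v - w)" if "v \<in> D" "w \<in> D" for v w
  proof -
    have "norm (NX v - NX w) \<le> L * norm (v - w)"
    proof (rule norm_bound)
      fix t
      have "norm (apply_bcontfun (NX v - NX w) t) \<le> L * norm (apply_bcontfun v t - apply_bcontfun w t)"
        using lipX[of "apply_bcontfun v t" "apply_bcontfun w t"] that by (auto simp: D_def NX[OF that(1)] NX[OF that(2)])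
      also have "\<dots> \<le> L * norm (v - w)" using L norm_bounded[of "v - w" t] by (intro mult_left_mono) auto
      finally show "norm (apply_bcontfun (NX v - NX w) t) \<le> L * norm (v - w)" .
    qed
    then have "norm (I (NX v - NX w)) \<le> \<tau> * (L * norm (v - w))"
      using nI[of "NX v - NX w"] \<tau>0 by (meson mult_left_mono order_trans)
    also have "\<dots> \<le> (1 / 2) * norm (v - w)"
      using mult_right_mono[OF \<tau>(3), of "norm (v - w)"] by (simp add: mult.assoc)
    finally show ?thesis by (simp add: linear_diff[OF bounded_linear.linear[OF I]])
  qed
  have ex: "\<exists>!w. w \<in> D \<and> z + I (NX w) = w" if z: "z \<in> Z" for z
  proof -
    have "const_bcontfun a0 \<in> D" using R0 by (auto simp: D_def K_def const_bcontfun.rep_eq)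
    then have "D \<noteq> {}" by blast
    then have "\<exists>!w\<in>D. z + I (NX w) = w"
      by (rule Banach_fix[OF cD _ _ _ _, of "1/2"]) (use contr step_in[OF z] in \<open>auto simp: dist_norm\<close>)
    then show ?thesis by blast
  qed
  define g where "g z = (THE w. w \<in> D \<and> z + I (NX w) = w)" for z
  have g: "g z \<in> D" "z + I (NX (g z)) = g z" if "z \<in> Z" for z
    using theI'[OF ex[OF that]] unfolding g_def by auto
  have glip: "norm (g y - g z) \<le> 2 * norm (y - z)" if "y \<in> Z" "z \<in> Z" for y z
  proof -
    have "g y - g z = (y - z) + (I (NX (g y)) - I (NX (g z)))"
      using g(2)[OF that(1)] g(2)[OF that(2)] by (metis add_diff_add)
    then have "norm (g y - g z) \<le> norm (y - z) + 1 / 2 * norm (g y - g z)"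
      using norm_triangle_ineq[of "y - z" "I (NX (g y)) - I (NX (g z))"] contr[OF g(1)[OF that(1)] g(1)[OF that(2)]] by simp
    then show ?thesis by simp
  qed
  have oZ: "open Z" by (simp add: Z_def)
  have gcont: "isCont g z" if z: "z \<in> Z" for z
  proof -
    have "((\<lambda>y. g y - g z) \<longlongrightarrow> 0) (at z)"
    proof (rule Lim_null_comparison)
      show "\<forall>\<^sub>F y in at z. norm (g y - g z) \<le> 2 * norm (y - z)"
        unfolding eventually_at_topological using glip z oZ by blast
      have "((\<lambda>y. y - z) \<longlongrightarrow> 0) (at z)" by (simp add: LIM_zero)
      then show "((\<lambda>y. 2 * norm (y - z)) \<longlongrightarrow> 0) (at z)"
        by (rule tendsto_mult_right_zero[OF tendsto_norm_zero])
    qed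
    then show ?thesis unfolding isCont_def by (simp add: LIM_zero_iff)
  qed
  define I' where "I' = Blinfun I"
  have I': "blinfun_apply I' = I" unfolding I'_def by (rule bounded_linear_Blinfun_apply[OF I])
  \<comment> \<open>Multiplication by the operator-valued curve \<open>c\<close>, followed by
    integration. Taken at the derivative of \<open>X\<close> along \<open>w\<close>, it is the
    linearisation of \<open>I (NX w)\<close>.\<close>
  define A where "A c = I' o\<^sub>L bounded_bilinear.prod_right (bcontfun_bilinear blinfun_apply) c" for c :: "real \<Rightarrow>\<^sub>C 'a \<Rightarrow>\<^sub>L 'a"
  note bba = bounded_bilinear_bcontfun_bilinear[OF bounded_bilinear_blinfun_apply]
  have blA: "bounded_linear A" unfolding A_def
    by (rule bounded_linear_compose[OF bounded_bilinear.bounded_linear_right[OF bounded_bilinear_blinfun_compose]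
        bounded_bilinear.bounded_linear_prod_right[OF bba]])
  have A: "blinfun_apply (A c) = (\<lambda>h. I (bcontfun_bilinear blinfun_apply c h))" for c
    by (rule ext) (simp add: A_def I' bounded_bilinear.prod_right.rep_eq[OF bba])
  define ND where "ND w = nemytskii (blinfun_deriv X) w" for w :: "real \<Rightarrow>\<^sub>C 'a"
  have ND: "apply_bcontfun (ND w) = (\<lambda>t. blinfun_deriv X (apply_bcontfun w t))" if "w \<in> D" for w
    unfolding ND_def by (rule apply_nemytskii[OF K(1) cDX]) (use that in \<open>auto simp: D_def\<close>)
  have nA: "norm (A (ND w)) \<le> 1 / 2" if "w \<in> D" for w
  proof (rule norm_blinfun_bound)
    fix h
    have "norm (bcontfun_bilinear blinfun_apply (ND w) h) \<le> L * norm h"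
    proof (rule norm_bound)
      fix t
      have "norm (blinfun_deriv X (apply_bcontfun w t) (apply_bcontfun h t))
         \<le> norm (blinfun_deriv X (apply_bcontfun w t)) * norm (apply_bcontfun h t)" by (rule norm_blinfun)
      also have "\<dots> \<le> L * norm h" using that L by (intro mult_mono norm_bounded) (auto simp: D_def)
      finally show "norm (apply_bcontfun (bcontfun_bilinear blinfun_apply (ND w) h) t) \<le> L * norm h"
        by (simp add: apply_bcontfun_bilinear[OF bounded_bilinear_blinfun_apply] ND[OF that])
    qed
    then have "norm (A (ND w) h) \<le> \<tau> * (L * norm h)"
      using nI[of "bcontfun_bilinear blinfun_apply (ND w) h"] \<tau>0 unfolding A by (meson mult_left_mono order_trans)
    also have "\<dots> \<le> (1 / 2) * norm h"
      using mult_right_mono[OF \<tau>(3), of "norm h"] by (simp add: mult.assoc)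
    finally show "norm (A (ND w) h) \<le> (1 / 2) * norm h" .
  qed simp
  define N where "N w = (SOME N. N o\<^sub>L (id_blinfun - A (ND w)) = id_blinfun \<and> (id_blinfun - A (ND w)) o\<^sub>L N = id_blinfun \<and> norm N \<le> 2)"
    for w
  have N: "N w o\<^sub>L (id_blinfun - A (ND w)) = id_blinfun" "(id_blinfun - A (ND w)) o\<^sub>L N w = id_blinfun" "norm (N w) \<le> 2"
    if "w \<in> D" for w
    using someI_ex[OF blinfun_neumann[OF nA[OF that]]] unfolding N_def by blast+
  \<comment> \<open>\<open>g\<close> inverts the differentiable map \<open>w - I (NX w)\<close>;
    continuity of \<open>g\<close> and invertibility of the linearisation make the inverse
    differentiable.\<close>
  have gder: "(g has_derivative N (g z)) (at z)" if z: "z \<in> Z" for z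
  proof (rule has_derivative_inverse_basic[where f = "\<lambda>w. w - I (NX w)" and f' = "id_blinfun - A (ND (g z))" and T = Z])
    have "(NX has_derivative bcontfun_bilinear blinfun_apply (ND (g z))) (at (g z))"
      unfolding NX_def ND_def by (rule nemytskii_has_derivative[OF S X K(1,2)]) (use g(1)[OF z] in \<open>auto simp: D_def\<close>)
    then have "((\<lambda>w. w - I (NX w)) has_derivative (\<lambda>h. h - I (bcontfun_bilinear blinfun_apply (ND (g z)) h))) (at (g z))"
      by (intro has_derivative_diff has_derivative_ident bounded_linear.has_derivative[OF I])
    then show "((\<lambda>w. w - I (NX w)) has_derivative (id_blinfun - A (ND (g z)))) (at (g z))"
      by (simp add: blinfun.bilinear_simps A fun_diff_def minus_blinfun.rep_eq)
    show "blinfun_apply (N (g z)) \<circ> blinfun_apply (id_blinfun - A (ND (g z))) = id"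
      using arg_cong[OF N(1)[OF g(1)[OF z]], of blinfun_apply] by (auto simp: fun_eq_iff)
    show "g y - I (NX (g y)) = y" if "y \<in> Z" for y using g(2)[OF that] by (metis add_diff_cancel_right')
  qed (use gcont z oZ blinfun.bounded_linear_right in auto)
  define B where "B = ball a0 R"
  have oB: "open B" by (simp add: B_def)
  have BZ: "const_bcontfun x \<in> Z" if "x \<in> B" for x
  proof -
    have "dist (const_bcontfun a0 :: real \<Rightarrow>\<^sub>C 'a) (const_bcontfun x) \<le> dist a0 x"
      by (rule dist_bound) (simp add: const_bcontfun.rep_eq)
    then show ?thesis using that by (simp add: B_def Z_def)
  qed
  have blc: "bounded_linear (const_bcontfun :: 'a \<Rightarrow> real \<Rightarrow>\<^sub>C 'a)"
  proof (rule bounded_linear_intro[where K = 1])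
    show "norm (const_bcontfun x :: real \<Rightarrow>\<^sub>C 'a) \<le> norm x * 1" for x :: 'a
      by (rule norm_bound) (simp add: const_bcontfun.rep_eq)
  qed (auto intro!: bcontfun_eqI simp: const_bcontfun.rep_eq)
  define G where "G x = g (const_bcontfun x)" for x
  have GD: "G x \<in> D" if "x \<in> B" for x unfolding G_def by (rule g(1)[OF BZ[OF that]])
  have Gder: "(G has_derivative (\<lambda>e. N (G x) (const_bcontfun e))) (at x)" if "x \<in> B" for x
  proof -
    have 1: "(const_bcontfun has_derivative (const_bcontfun :: 'a \<Rightarrow> real \<Rightarrow>\<^sub>C 'a)) (at x)"
      by (rule bounded_linear_imp_has_derivative[OF blc])
    have 2: "(g has_derivative N (g (const_bcontfun x))) (at (const_bcontfun x))"
      by (rule gder[OF BZ[OF that]])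
    have "(g \<circ> const_bcontfun has_derivative (blinfun_apply (N (g (const_bcontfun x))) \<circ> const_bcontfun)) (at x)"
      by (rule diff_chain_at) (fact 1, fact 2)
    then show ?thesis by (simp add: G_def[abs_def] o_def)
  qed
  \<comment> \<open>Bootstrapping: the derivative of \<open>G\<close> is obtained from
    \<open>G\<close> by superposition and inversion, both of which preserve class \<open>Ck\<close>,
    so class \<open>k\<close> of \<open>G\<close> gives class \<open>Suc k\<close>.\<close>
  have "Ck_on k B G" for k
  proof (induction k)
    case 0
    show ?case using Gder has_derivative_continuous by (fastforce intro!: continuous_at_imp_continuous_on)
  next
    case (Suc k)
    have "Ck_on k B (\<lambda>x. ND (G x))" unfolding ND_def
      by (rule Ck_on_nemytskii[OF S K(1,2) oB _ Suc DX]) (use GD in \<open>auto simp: D_def\<close>)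
    then have "Ck_on k B (\<lambda>x. id_blinfun + - A (ND (G x)))"
      by (intro Ck_on_add oB Ck_on_const Ck_on_linear[OF bounded_linear_minus[OF blA]])
    then have "Ck_on k B (\<lambda>x. id_blinfun - A (ND (G x)))" by simp
    then have "Ck_on k B (\<lambda>x. N (G x))"
      by (rule Ck_on_blinfun_inverse_bounded[OF oB _ _ _ N(3)]) (use N GD in auto)
    then show ?case
      by (intro Ck_on_SucI[OF oB Gder] Ck_on_bilinear[OF bounded_bilinear_blinfun_apply oB] Ck_on_const)
  qed
  then have Gs: "smooth_on B G" by (simp add: smooth_on_def)
  have ble: "bounded_linear (\<lambda>w :: real \<Rightarrow>\<^sub>C 'a. apply_bcontfun w t)" for t
    by (rule bounded_linear_intro[where K = 1]) (auto intro: norm_bounded)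
  define \<phi> where "\<phi> t x = apply_bcontfun (G x) t" for t x
  have \<phi>der: "frechet_derivative (\<phi> t) (at x) = (\<lambda>e. apply_bcontfun (N (G x) (const_bcontfun e)) t)" if "x \<in> B" for t x
    using frechet_derivative_at[OF bounded_linear.has_derivative[OF ble Gder[OF that], of t]]
    unfolding \<phi>_def[abs_def] by simp
  have G_eq: "G x = const_bcontfun x + I (NX (G x))" if "x \<in> B" for x
    using g(2)[OF BZ[OF that]] unfolding G_def by simp
  \<comment> \<open>The operator equation for \<open>N\<close> read as an integral equation in time,
    whose differentiated form is the variational equation.\<close>
  have J_eq: "N (G x) (const_bcontfun e) = const_bcontfun e + I (bcontfun_bilinear blinfun_apply (ND (G x)) (N (G x) (const_bcontfun e)))"
    if "x \<in> B" for x e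
    using arg_cong[OF N(2)[OF GD[OF that]], of "\<lambda>f. blinfun_apply f (const_bcontfun e)"]
    by (simp add: blinfun.bilinear_simps A algebra_simps)
  have int: "((\<lambda>t. apply_bcontfun (const_bcontfun x + I w) t) has_vector_derivative apply_bcontfun w t) (at t within {0..\<tau>})"
    if "t \<in> {0..\<tau>}" for x w t
    using has_vector_derivative_add[OF has_vector_derivative_const bcontfun_integral_has_vector_derivative[OF that, of w], of x]
    unfolding I_def by (simp add: const_bcontfun.rep_eq)
  show ?thesis
  proof (rule that[of \<tau> R \<phi>], fold B_def)
    show "\<tau> > 0" "R > 0" by (rule \<tau> R)+
    show "\<phi> 0 x = x" if "x \<in> B" for x
      unfolding \<phi>_def by (subst G_eq[OF that])
        (use \<tau>0 in \<open>simp add: I_def apply_bcontfun_integral(1)[OF \<tau>0] const_bcontfun.rep_eq\<close>)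
    show in_S: "\<phi> t x \<in> S" if "x \<in> B" for t x
      using GD[OF that] K(2) by (auto simp: D_def \<phi>_def)
    show "smooth_on B (\<phi> t)" for t unfolding \<phi>_def[abs_def] by (rule smooth_on_linear[OF ble oB Gs])
    fix t x assume x: "x \<in> B" and t: "t \<in> {0..\<tau>}"
    show "((\<lambda>t. \<phi> t x) has_vector_derivative X (\<phi> t x)) (at t within {0..\<tau>})"
      using int[OF t, of x "NX (G x)"] G_eq[OF x] NX[OF GD[OF x]] unfolding \<phi>_def by simp
    fix e
    show "((\<lambda>t. frechet_derivative (\<phi> t) (at x) e) has_vector_derivative
        frechet_derivative X (at (\<phi> t x)) (frechet_derivative (\<phi> t) (at x) e)) (at t within {0..\<tau>})"
      using int[OF t, of e "bcontfun_bilinear blinfun_apply (ND (G x)) (N (G x) (const_bcontfun e))"]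
      unfolding J_eq[OF x, symmetric] \<phi>der[OF x] apply_bcontfun_bilinear[OF bounded_bilinear_blinfun_apply] ND[OF GD[OF x]]
      using blinfun_deriv_apply[OF smooth_on_differentiable[OF X in_S[OF x, of t]]] unfolding \<phi>_def by simp
  qed
qed

text \<open>Gronwall's argument: \<open>exp (- (2 * L * t))\<close> times the squared norm of
  \<open>w\<close> cannot increase. With \<open>L = 0\<close> and zero derivative it also serves to
  show that a quantity is constant.\<close>

lemma linear_ode_zero:
  fixes w :: "real \<Rightarrow> 'a::real_inner"
  assumes w: "\<And>t. t \<in> {0..\<tau>} \<Longrightarrow> (w has_vector_derivative w' t) (at t within {0..\<tau>})"
    and b: "\<And>t. t \<in> {0..\<tau>} \<Longrightarrow> norm (w' t) \<le> L * norm (w t)"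
    and 0: "w 0 = 0" and t: "t \<in> {0..\<tau>}"
  shows "w t = 0"
proof -
  define q where "q s = exp (- (2 * L * s)) * (w s \<bullet> w s)" for s
  have q': "(q has_real_derivative (exp (- (2 * L * s)) * (2 * (w' s \<bullet> w s) - 2 * L * (w s \<bullet> w s)))) (at s within {0..\<tau>})"
    if s: "s \<in> {0..\<tau>}" for s
  proof -
    have "((\<lambda>s. w s \<bullet> w s) has_vector_derivative (w s \<bullet> w' s + w' s \<bullet> w s)) (at s within {0..\<tau>})"
      by (rule bounded_bilinear.has_vector_derivative[OF bounded_bilinear_inner w[OF s] w[OF s]])
    then have "((\<lambda>s. w s \<bullet> w s) has_real_derivative (2 * (w' s \<bullet> w s))) (at s within {0..\<tau>})"
      by (simp add: has_real_derivative_iff_has_vector_derivative inner_commute)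
    moreover have "((\<lambda>s. exp (- (2 * L * s))) has_real_derivative (- (2 * L) * exp (- (2 * L * s)))) (at s within {0..\<tau>})"
      by (auto intro!: derivative_eq_intros)
    ultimately have "(q has_real_derivative (- (2 * L) * exp (- (2 * L * s)) * (w s \<bullet> w s) + 2 * (w' s \<bullet> w s) * exp (- (2 * L * s))))
        (at s within {0..\<tau>})"
      unfolding q_def[abs_def] by (intro DERIV_mult)
    then show ?thesis by (rule DERIV_cong) (simp add: algebra_simps)
  qed
  have neg: "exp (- (2 * L * s)) * (2 * (w' s \<bullet> w s) - 2 * L * (w s \<bullet> w s)) \<le> 0" if s: "s \<in> {0..\<tau>}" for s
  proof -
    have "w' s \<bullet> w s \<le> norm (w' s) * norm (w s)" by (rule norm_cauchy_schwarz)
    also have "\<dots> \<le> L * norm (w s) * norm (w s)" by (intro mult_right_mono b s) auto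
    also have "\<dots> = L * (w s \<bullet> w s)" by (simp add: power2_norm_eq_inner[symmetric] power2_eq_square)
    finally show ?thesis by (simp add: mult_nonneg_nonpos)
  qed
  have "q t \<le> q 0"
  proof -
    have "\<exists>s\<in>{0..t}. q t - q 0 = (exp (- (2 * L * s)) * (2 * (w' s \<bullet> w s) - 2 * L * (w s \<bullet> w s))) * (t - 0)"
    proof (rule mvt_very_simple)
      show "(q has_derivative (*) (exp (- (2 * L * s)) * (2 * (w' s \<bullet> w s) - 2 * L * (w s \<bullet> w s)))) (at s within {0..t})"
        if "0 \<le> s" "s \<le> t" for s
        using has_derivative_subset[OF q'[unfolded has_field_derivative_def], of s "{0..t}"] that t by auto
    qed (use t in auto)
    then obtain s where s: "s \<in> {0..t}"
      and "q t - q 0 = (exp (- (2 * L * s)) * (2 * (w' s \<bullet> w s) - 2 * L * (w s \<bullet> w s))) * (t - 0)" by blast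
    then show ?thesis using mult_nonpos_nonneg[OF neg[of s], of "t - 0"] t by auto
  qed
  then have "q t \<le> 0" by (simp add: q_def 0)
  then have "w t \<bullet> w t \<le> 0" unfolding q_def by (simp add: mult_le_0_iff)
  then show ?thesis by (metis inner_ge_zero inner_eq_zero_iff order_antisym)
qed

subsection \<open>Integration of commuting families of vector fields\<close>

text \<open>\<open>\<Theta> (v, y)\<close> is the value at time one of the solution of
  \<open>y' = Q y v\<close> that starts at \<open>y\<close>. Commutativity makes its derivative in
  \<open>v\<close> the field \<open>Q\<close> itself, so for fixed \<open>y\<close> the map
  \<open>v\<close> to \<open>\<Theta> (v, y)\<close> parametrises the leaf through
  \<open>y\<close>.\<close>

theorem frobenius_commuting:
  fixes Q :: "'y::euclidean_space \<Rightarrow> 'e::euclidean_space \<Rightarrow> 'y"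
  assumes S: "open S" "y0 \<in> S"
    and lin: "\<And>y. y \<in> S \<Longrightarrow> linear (Q y)"
    and Q: "\<And>e. smooth_on S (\<lambda>y. Q y e)"
    and comm: "\<And>y e v. y \<in> S \<Longrightarrow> frechet_derivative (\<lambda>y. Q y e) (at y) (Q y v)
        = frechet_derivative (\<lambda>y. Q y v) (at y) (Q y e)"
  obtains \<delta> \<Theta> where "\<delta> > 0"
    "smooth_on (ball 0 \<delta> \<times> ball y0 \<delta>) \<Theta>"
    "\<And>v y. v \<in> ball 0 \<delta> \<Longrightarrow> y \<in> ball y0 \<delta> \<Longrightarrow> \<Theta> (v, y) \<in> S"
    "\<And>y. y \<in> ball y0 \<delta> \<Longrightarrow> \<Theta> (0, y) = y"
    "\<And>v y e. v \<in> ball 0 \<delta> \<Longrightarrow> y \<in> ball y0 \<delta> \<Longrightarrow>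
      frechet_derivative \<Theta> (at (v, y)) (e, 0) = Q (\<Theta> (v, y)) e"
proof -
  \<comment> \<open>The direction is the first component of the state and does not move. The sum
    over the basis exhibits joint smoothness; on \<open>S'\<close> linearity turns it into
    \<open>Q (snd p) (fst p)\<close>.\<close>
  define X :: "'e \<times> 'y \<Rightarrow> 'e \<times> 'y" where "X p = (0, \<Sum>b\<in>Basis. (fst p \<bullet> b) *\<^sub>R Q (snd p) b)" for p
  define S' :: "('e \<times> 'y) set" where "S' = UNIV \<times> S"
  have S': "open S'" "(0, y0) \<in> S'" using S by (auto simp: S'_def open_Times)
  have Qsum: "(\<Sum>b\<in>Basis. (v \<bullet> b) *\<^sub>R Q y b) = Q y v" if "y \<in> S" for v y
    using linear_sum[OF lin[OF that], of "\<lambda>b. (v \<bullet> b) *\<^sub>R b" Basis]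
    by (simp add: linear_cmul[OF lin[OF that]] euclidean_representation)
  have Xeq: "X p = (0, Q (snd p) (fst p))" if "p \<in> S'" for p
    using that by (auto simp: X_def S'_def Qsum)
  have "smooth_on S' (\<lambda>p. Q (snd p) b)" for b
    by (rule smooth_on_compose[OF S'(1) Q smooth_on_linear[OF bounded_linear_snd S'(1) smooth_on_ident]])
      (auto simp: S'_def)
  then have X: "smooth_on S' X" unfolding X_def[abs_def]
    by (intro smooth_intros S')
  have DQ: "((\<lambda>y. Q y v) has_derivative (\<lambda>j. \<Sum>b\<in>Basis. (v \<bullet> b) *\<^sub>R frechet_derivative (\<lambda>y. Q y b) (at y) j)) (at y)"
    if "y \<in> S" for v y
  proof (rule has_derivative_transform_within_open[OF _ S(1) that Qsum])
    show "((\<lambda>y. \<Sum>b\<in>Basis. (v \<bullet> b) *\<^sub>R Q y b) has_derivative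
        (\<lambda>j. \<Sum>b\<in>Basis. (v \<bullet> b) *\<^sub>R frechet_derivative (\<lambda>y. Q y b) (at y) j)) (at y)"
      by (intro has_derivative_sum has_derivative_scaleR_right smooth_on_has_derivative[OF Q that])
  qed
  have DX: "frechet_derivative X (at p) (e, j) = (0, Q (snd p) e + frechet_derivative (\<lambda>y. Q y (fst p)) (at (snd p)) j)"
    if "p \<in> S'" for p e j
  proof -
    have s: "snd p \<in> S" using that by (auto simp: S'_def)
    have b: "((\<lambda>p. Q (snd p) b) has_derivative (\<lambda>h. frechet_derivative (\<lambda>y. Q y b) (at (snd p)) (snd h))) (at p)" for b
      using diff_chain_at[OF has_derivative_snd[OF has_derivative_ident] smooth_on_has_derivative[OF Q s, of b]]
      by (simp add: o_def)
    have "((\<lambda>p. \<Sum>b\<in>Basis. (fst p \<bullet> b) *\<^sub>R Q (snd p) b) has_derivative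
      (\<lambda>h. \<Sum>b\<in>Basis. (fst p \<bullet> b) *\<^sub>R frechet_derivative (\<lambda>y. Q y b) (at (snd p)) (snd h) + (fst h \<bullet> b) *\<^sub>R Q (snd p) b)) (at p)"
      by (intro has_derivative_sum has_derivative_scaleR has_derivative_inner_left has_derivative_fst has_derivative_ident b)
    from has_derivative_Pair[OF has_derivative_const[of 0] this]
    have "frechet_derivative X (at p) = (\<lambda>h. (0, \<Sum>b\<in>Basis. (fst p \<bullet> b) *\<^sub>R frechet_derivative (\<lambda>y. Q y b) (at (snd p)) (snd h) + (fst h \<bullet> b) *\<^sub>R Q (snd p) b))"
      unfolding X_def[abs_def] by (rule frechet_derivative_at[symmetric])
    moreover have "frechet_derivative (\<lambda>y. Q y (fst p)) (at (snd p)) = (\<lambda>j. \<Sum>b\<in>Basis. (fst p \<bullet> b) *\<^sub>R frechet_derivative (\<lambda>y. Q y b) (at (snd p)) j)"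
      by (rule frechet_derivative_at[OF DQ[OF s], symmetric])
    ultimately show ?thesis by (simp add: sum.distrib Qsum[OF s] add.commute)
  qed
  obtain \<tau> R \<phi> where \<tau>: "\<tau> > 0" and R: "R > 0"
    and \<phi>0: "\<And>x. x \<in> ball (0, y0) R \<Longrightarrow> \<phi> 0 x = x"
    and \<phi>S: "\<And>t x. x \<in> ball (0, y0) R \<Longrightarrow> \<phi> t x \<in> S'"
    and \<phi>': "\<And>t x. x \<in> ball (0, y0) R \<Longrightarrow> t \<in> {0..\<tau>} \<Longrightarrow>
      ((\<lambda>t. \<phi> t x) has_vector_derivative X (\<phi> t x)) (at t within {0..\<tau>})"
    and \<phi>s: "\<And>t. smooth_on (ball (0, y0) R) (\<phi> t)"
    and J': "\<And>t x e. x \<in> ball (0, y0) R \<Longrightarrow> t \<in> {0..\<tau>} \<Longrightarrow>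
      ((\<lambda>t. frechet_derivative (\<phi> t) (at x) e) has_vector_derivative
        frechet_derivative X (at (\<phi> t x)) (frechet_derivative (\<phi> t) (at x) e)) (at t within {0..\<tau>})"
    using smooth_local_flow[OF S'(1) X S'(2)] by blast
  define B where "B = ball ((0::'e), y0) R"
  note \<phi>0 = \<phi>0[folded B_def] and \<phi>S = \<phi>S[folded B_def] and \<phi>' = \<phi>'[folded B_def]
    and \<phi>s = \<phi>s[folded B_def] and J' = J'[folded B_def]
  have oB: "open B" by (simp add: B_def)
  have snd_in: "snd (\<phi> t x) \<in> S" if "x \<in> B" for t x using \<phi>S[OF that, of t] by (auto simp: S'_def)
  have fst_\<phi>: "fst (\<phi> t x) = fst x" if x: "x \<in> B" and t: "t \<in> {0..\<tau>}" for t x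
  proof -
    have "fst (\<phi> t x) - fst x = 0"
    proof (rule linear_ode_zero[where L = 0 and w' = "\<lambda>_. 0" and \<tau> = \<tau>, OF _ _ _ t])
      show "((\<lambda>t. fst (\<phi> t x) - fst x) has_vector_derivative 0) (at t within {0..\<tau>})" if "t \<in> {0..\<tau>}" for t
        using has_vector_derivative_diff_const[THEN iffD2, OF bounded_linear.has_vector_derivative[OF bounded_linear_fst \<phi>'[OF x that]]]
        by (simp add: X_def)
    qed (use \<phi>0[OF x] in auto)
    then show ?thesis by simp
  qed
  have \<phi>eq: "X (\<phi> t x) = (0, Q (snd (\<phi> t x)) (fst x))" if "x \<in> B" "t \<in> {0..\<tau>}" for t x
    using Xeq[OF \<phi>S[OF that(1)]] fst_\<phi>[OF that] by simp
  have y': "((\<lambda>t. snd (\<phi> t x)) has_vector_derivative Q (snd (\<phi> t x)) (fst x)) (at t within {0..\<tau>})"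
    if "x \<in> B" "t \<in> {0..\<tau>}" for t x
    using bounded_linear.has_vector_derivative[OF bounded_linear_snd \<phi>'[OF that]] by (simp add: \<phi>eq[OF that])
  have D0: "frechet_derivative (\<phi> 0) (at x) e = e" if "x \<in> B" for x e
  proof -
    have "(\<phi> 0 has_derivative (\<lambda>e. e)) (at x)"
      by (rule has_derivative_transform_within_open[OF has_derivative_ident oB that]) (simp add: \<phi>0)
    from frechet_derivative_at[OF this] show ?thesis by metis
  qed
  have zero: "snd (\<phi> \<tau> (0, y)) = y" if x: "(0, y) \<in> B" for y
  proof -
    have "snd (\<phi> \<tau> (0, y)) - y = 0"
    proof (rule linear_ode_zero[where L = 0 and w' = "\<lambda>_. 0" and \<tau> = \<tau>])
      show "((\<lambda>t. snd (\<phi> t (0, y)) - y) has_vector_derivative 0) (at t within {0..\<tau>})" if "t \<in> {0..\<tau>}" for t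
        using has_vector_derivative_diff_const[THEN iffD2, OF y'[OF x that]] linear_0[OF lin[OF snd_in[OF x]]]
        by simp
    qed (use \<phi>0[OF x] \<tau> in auto)
    then show ?thesis by simp
  qed
  \<comment> \<open>With \<open>J = (e, j)\<close> the variation of the flow in direction \<open>(e, 0)\<close>, commutativity makes \<open>j(t) - t Q(y(t)) e\<close> solve a homogeneous linear equation.\<close>
  have key: "snd (frechet_derivative (\<phi> \<tau>) (at x) (e, 0)) = \<tau> *\<^sub>R Q (snd (\<phi> \<tau> x)) e" if x: "x \<in> B" for x e
  proof -
    define v where "v = fst x"
    define y where "y t = snd (\<phi> t x)" for t
    define J where "J t = frechet_derivative (\<phi> t) (at x) (e, 0)" for t
    have yS: "y t \<in> S" for t unfolding y_def by (rule snd_in[OF x])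
    have Jd: "(J has_vector_derivative (0, Q (y t) (fst (J t)) + frechet_derivative (\<lambda>y. Q y v) (at (y t)) (snd (J t)))) (at t within {0..\<tau>})"
      if t: "t \<in> {0..\<tau>}" for t
      using J'[OF x t, of "(e, 0)"] DX[OF \<phi>S[OF x, of t], of "fst (J t)" "snd (J t)"] fst_\<phi>[OF x t]
      unfolding J_def[symmetric] by (simp add: y_def v_def)
    have fJ: "fst (J t) = e" if t: "t \<in> {0..\<tau>}" for t
    proof -
      have "fst (J t) - e = 0"
      proof (rule linear_ode_zero[where L = 0 and w' = "\<lambda>_. 0" and \<tau> = \<tau>, OF _ _ _ t])
        show "((\<lambda>t. fst (J t) - e) has_vector_derivative 0) (at t within {0..\<tau>})" if "t \<in> {0..\<tau>}" for t
          using has_vector_derivative_diff_const[THEN iffD2, OF bounded_linear.has_vector_derivative[OF bounded_linear_fst Jd[OF that]]]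
          by simp
      qed (use D0[OF x] in \<open>auto simp: J_def\<close>)
      then show ?thesis by simp
    qed
    define A where "A = blinfun_deriv (\<lambda>y. Q y v)"
    have A: "blinfun_apply (A (y t)) = frechet_derivative (\<lambda>y. Q y v) (at (y t))" for t
      unfolding A_def by (rule blinfun_deriv_apply[OF smooth_on_differentiable[OF Q yS]])
    have cy: "continuous_on {0..\<tau>} y"
      using y'[OF x] unfolding y_def continuous_on_eq_continuous_within
      by (blast intro: has_vector_derivative_continuous)
    have "continuous_on {0..\<tau>} (\<lambda>t. A (y t))"
      by (rule continuous_on_compose2[OF smooth_on_continuous[OF smooth_on_blinfun_deriv[OF S(1) Q, of v, folded A_def]] cy])
        (use yS in auto)
    then have "bounded ((\<lambda>t. A (y t)) ` {0..\<tau>})"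
      by (intro compact_imp_bounded compact_continuous_image compact_Icc)
    then obtain L where "\<forall>x\<in>(\<lambda>t. A (y t)) ` {0..\<tau>}. norm x \<le> L" unfolding bounded_iff by blast
    then have L: "norm (A (y t)) \<le> L" if "t \<in> {0..\<tau>}" for t using that by blast
    have "snd (J \<tau>) - \<tau> *\<^sub>R Q (y \<tau>) e = 0"
    proof (rule linear_ode_zero[where L = L and w' = "\<lambda>t. A (y t) (snd (J t) - t *\<^sub>R Q (y t) e)" and \<tau> = \<tau>])
      fix t assume t: "t \<in> {0..\<tau>}"
      have 1: "((\<lambda>t. snd (J t)) has_vector_derivative (Q (y t) e + A (y t) (snd (J t)))) (at t within {0..\<tau>})"
        using bounded_linear.has_vector_derivative[OF bounded_linear_snd Jd[OF t]] by (simp add: fJ[OF t] A)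
      have "((\<lambda>t. Q (y t) e) has_vector_derivative frechet_derivative (\<lambda>y. Q y e) (at (y t)) (Q (y t) v)) (at t within {0..\<tau>})"
        using vector_derivative_diff_chain_within[OF y'[OF x t] has_derivative_at_withinI[OF smooth_on_has_derivative[OF Q snd_in[OF x]]], of e]
        by (simp add: o_def y_def v_def)
      then have "((\<lambda>t. Q (y t) e) has_vector_derivative A (y t) (Q (y t) e)) (at t within {0..\<tau>})"
        by (simp add: comm[OF yS] A)
      then have 2: "((\<lambda>t. t *\<^sub>R Q (y t) e) has_vector_derivative (t *\<^sub>R A (y t) (Q (y t) e) + 1 *\<^sub>R Q (y t) e)) (at t within {0..\<tau>})"
        by (intro has_vector_derivative_scaleR) (auto intro: DERIV_ident)
      show "((\<lambda>t. snd (J t) - t *\<^sub>R Q (y t) e) has_vector_derivative A (y t) (snd (J t) - t *\<^sub>R Q (y t) e)) (at t within {0..\<tau>})"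
        using has_vector_derivative_diff[OF 1 2] by (simp add: blinfun.bilinear_simps)
      show "norm (A (y t) (snd (J t) - t *\<^sub>R Q (y t) e)) \<le> L * norm (snd (J t) - t *\<^sub>R Q (y t) e)"
        by (rule order_trans[OF norm_blinfun mult_right_mono[OF L[OF t] norm_ge_zero]])
    qed (use D0[OF x] \<tau> in \<open>auto simp: J_def\<close>)
    then show ?thesis by (simp add: J_def y_def)
  qed
  \<comment> \<open>Gives the rescaled direction norm below \<open>R / 2\<close> and keeps the
    starting point within \<open>R / 2\<close> of \<open>y0\<close>; the sum of the two bounds the
    distance in the product.\<close>
  define \<delta> where "\<delta> = min (R * \<tau> / 2) (R / 2)"
  have \<delta>: "\<delta> > 0" using R \<tau> by (simp add: \<delta>_def)
  define T :: "('e \<times> 'y) set" where "T = ball 0 \<delta> \<times> ball y0 \<delta>"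
  have oT: "open T" by (simp add: T_def open_Times)
  \<comment> \<open>The flow is available only up to time \<tau>; following
    \<open>v / \<tau>\<close> for that time replaces following \<open>v\<close> for time
    one.\<close>
  define sc :: "'e \<times> 'y \<Rightarrow> 'e \<times> 'y" where "sc p = ((1 / \<tau>) *\<^sub>R fst p, snd p)" for p
  have scB: "sc p \<in> B" if "p \<in> T" for p
  proof -
    have p: "norm (fst p) < \<delta>" "dist y0 (snd p) < \<delta>" using that by (auto simp: T_def)
    have "norm ((1 / \<tau>) *\<^sub>R fst p) < R / 2"
      using p(1) \<tau> R unfolding \<delta>_def by (simp add: field_simps)
    moreover have "dist y0 (snd p) < R / 2" using p(2) unfolding \<delta>_def by simp
    ultimately have "norm ((1 / \<tau>) *\<^sub>R fst p) + dist y0 (snd p) < R" by linarith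
    moreover have "dist (0, y0) (sc p) \<le> norm ((1 / \<tau>) *\<^sub>R fst p) + dist y0 (snd p)"
      using sqrt_sum_squares_le_sum[of "norm ((1 / \<tau>) *\<^sub>R fst p)" "dist y0 (snd p)"] by (simp add: dist_prod_def sc_def)
    ultimately show ?thesis by (simp add: B_def)
  qed
  have blsc: "bounded_linear sc" unfolding sc_def[abs_def]
    by (intro bounded_linear_Pair bounded_linear_scaleR_right bounded_linear_snd
        bounded_linear_compose[OF bounded_linear_scaleR_right bounded_linear_fst])
  show ?thesis
  proof (rule that[of \<delta> "\<lambda>p. snd (\<phi> \<tau> (sc p))"], fold T_def)
    show "smooth_on T (\<lambda>p. snd (\<phi> \<tau> (sc p)))"
      by (rule smooth_on_linear[OF bounded_linear_snd oT smooth_on_compose[OF oT \<phi>s smooth_on_linear[OF blsc oT smooth_on_ident]]])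
        (use scB in auto)
    fix v y assume "v \<in> ball (0::'e) \<delta>" and y: "y \<in> ball y0 \<delta>"
    then have vy: "(v, y) \<in> T" by (simp add: T_def)
    show "snd (\<phi> \<tau> (sc (v, y))) \<in> S" by (rule snd_in[OF scB[OF vy]])
    fix e
    have "((\<lambda>p. snd (\<phi> \<tau> (sc p))) has_derivative (\<lambda>h. snd (frechet_derivative (\<phi> \<tau>) (at (sc (v, y))) (sc h)))) (at (v, y))"
      using has_derivative_snd[OF diff_chain_at[OF bounded_linear_imp_has_derivative[OF blsc] smooth_on_has_derivative[OF \<phi>s scB[OF vy]]]]
      by (simp add: o_def)
    from frechet_derivative_at[OF this]
    have "frechet_derivative (\<lambda>p. snd (\<phi> \<tau> (sc p))) (at (v, y)) (e, 0) = snd (frechet_derivative (\<phi> \<tau>) (at (sc (v, y))) ((1 / \<tau>) *\<^sub>R e, 0))"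
      by (metis sc_def fst_conv snd_conv)
    also have "\<dots> = Q (snd (\<phi> \<tau> (sc (v, y)))) e"
      using key[OF scB[OF vy], of "(1 / \<tau>) *\<^sub>R e"] \<tau> linear_cmul[OF lin[OF snd_in[OF scB[OF vy]]]] by simp
    finally show "frechet_derivative (\<lambda>p. snd (\<phi> \<tau> (sc p))) (at (v, y)) (e, 0) = Q (snd (\<phi> \<tau> (sc (v, y)))) e" .
  next
    fix y assume "y \<in> ball y0 \<delta>"
    then have "(0, y) \<in> T" using \<delta> by (simp add: T_def)
    from scB[OF this] show "snd (\<phi> \<tau> (sc (0, y))) = y" using zero[of y] by (simp add: sc_def)
  qed (rule \<delta>)
qed

subsection \<open>Dual frames\<close>

lemma dual_family:
  fixes e :: "'k \<Rightarrow> 'a::euclidean_space"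
  assumes "inj_on e I" "independent (e ` I)"
  obtains \<xi> :: "'k \<Rightarrow> 'a \<Rightarrow> real" where "\<And>k. linear (\<xi> k)"
    "\<And>k l. k \<in> I \<Longrightarrow> l \<in> I \<Longrightarrow> \<xi> k (e l) = (if l = k then 1 else 0)"
proof -
  have "\<exists>g :: 'a \<Rightarrow> real. linear g \<and> (\<forall>x\<in>e ` I. g x = (if x = e k then 1 else 0))" for k
    using linear_independent_extend[OF assms(2)] .
  then obtain \<xi> :: "'k \<Rightarrow> 'a \<Rightarrow> real" where
    "\<forall>k. linear (\<xi> k) \<and> (\<forall>x\<in>e ` I. \<xi> k x = (if x = e k then 1 else 0))"
    using choice[of "\<lambda>k g. linear g \<and> (\<forall>x\<in>e ` I. g x = (if x = e k then 1 else 0 :: real))"] by blast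
  then show ?thesis using that[of \<xi>] assms(1) by (simp add: inj_on_eq_iff)
qed

lemma dual_family_sum:
  fixes \<xi> :: "'a::real_vector \<Rightarrow> real"
  assumes "linear \<xi>" "finite I" "\<And>l. l \<in> I \<Longrightarrow> \<xi> (e l) = (if l = k then 1 else 0)"
  shows "\<xi> (\<Sum>l\<in>I. a l *\<^sub>R e l) = (if k \<in> I then a k else 0)"
proof -
  have "\<xi> (\<Sum>l\<in>I. a l *\<^sub>R e l) = (\<Sum>l\<in>I. a l * (if l = k then 1 else 0))"
    using assms(3) by (simp add: linear_sum[OF assms(1)] linear_cmul[OF assms(1)])
  also have "\<dots> = (if k \<in> I then a k else 0)"
    using sum.delta[OF assms(2), of k a] by (simp add: if_distrib cong: if_cong)
  finally show ?thesis .
qed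

lemma dual_frame_zero:
  fixes e :: "'k \<Rightarrow> 'a::euclidean_space" and \<xi> :: "'k \<Rightarrow> 'a \<Rightarrow> real"
  assumes "inj_on e I" "independent (e ` I)" "card I = DIM('a)" "finite I"
    and \<xi>: "\<And>k. linear (\<xi> k)" "\<And>k l. k \<in> I \<Longrightarrow> l \<in> I \<Longrightarrow> \<xi> k (e l) = (if l = k then 1 else 0)"
    and z: "\<And>k. k \<in> I \<Longrightarrow> \<xi> k v = 0"
  shows "v = 0"
proof -
  have "span (e ` I) = UNIV"
    using card_ge_dim_independent[of "e ` I" UNIV] assms(1-3) card_image[OF assms(1)] by auto
  then have "v \<in> span (e ` I)" by simp
  then obtain b where "v = (\<Sum>x\<in>e ` I. b x *\<^sub>R x)" using span_finite[of "e ` I"] assms(4) by auto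
  then have v: "v = (\<Sum>k\<in>I. b (e k) *\<^sub>R e k)" by (simp add: sum.reindex[OF assms(1)])
  have "b (e k) = 0" if "k \<in> I" for k
    using dual_family_sum[of "\<xi> k" I e k "\<lambda>k. b (e k)"] \<xi>(1)[of k] \<xi>(2)[OF that] assms(4) z[OF that] that by (simp add: v)
  then show ?thesis unfolding v by simp
qed

subsection \<open>Connections and Christoffel maps\<close>

lemma lie_deriv_const [simp]: "lie_deriv X (\<lambda>_. c) u = 0"
  by (simp add: lie_deriv_def)

lemma lie_deriv_const_fun [simp]: "lie_deriv X (\<lambda>_. c) = (\<lambda>_. 0)"
  by (rule ext) simp

lemma lie_deriv_eqI: "(f has_derivative f') (at u) \<Longrightarrow> lie_deriv X f u = f' (X u)"
  unfolding lie_deriv_def by (metis frechet_derivative_at)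

lemma lie_deriv_cong:
  assumes "open S" "u \<in> S" "smooth_on S f" "\<And>x. x \<in> S \<Longrightarrow> f x = g x"
  shows "lie_deriv X f u = lie_deriv X g u"
  unfolding lie_deriv_def
  using frechet_derivative_transform_within_open[OF smooth_on_differentiable[OF assms(3,2)] assms(1,2,4)] by simp

lemma smooth_on_lie_deriv [smooth_intros]:
  "open S \<Longrightarrow> smooth_on S X \<Longrightarrow> smooth_on S f \<Longrightarrow> smooth_on S (lie_deriv X f)"
  unfolding lie_deriv_def[abs_def] by (rule smooth_on_frechet_derivative)

lemma lie_deriv_scaleR:
  assumes "smooth_on S f" "smooth_on S g" "u \<in> S"
  shows "lie_deriv X (\<lambda>x. f x *\<^sub>R g x) u = lie_deriv X f u *\<^sub>R g u + f u *\<^sub>R lie_deriv X g u"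
  unfolding lie_deriv_def[of X f] lie_deriv_def[of X g]
  using lie_deriv_eqI[OF has_derivative_scaleR[OF assms(1,2)[THEN smooth_on_has_derivative, OF assms(3)]]]
  by (simp add: add.commute)

lemma lie_deriv_sum:
  assumes "open S" "finite I" "\<And>i. i \<in> I \<Longrightarrow> smooth_on S (f i)" "u \<in> S"
  shows "lie_deriv X (\<lambda>x. \<Sum>i\<in>I. f i x) u = (\<Sum>i\<in>I. lie_deriv X (f i) u)"
  unfolding lie_deriv_def[of X "f _"]
  by (rule lie_deriv_eqI[OF has_derivative_sum[OF smooth_on_has_derivative[OF assms(3,4)]]])

lemma linear_lie_deriv_arg:
  assumes "smooth_on S f" "u \<in> S" "finite I"
  shows "lie_deriv (\<lambda>x. \<Sum>i\<in>I. a i x *\<^sub>R Y i x) f u = (\<Sum>i\<in>I. a i u *\<^sub>R lie_deriv (Y i) f u)"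
  unfolding lie_deriv_def using linear_frechet_derivative[OF smooth_on_differentiable[OF assms(1,2)]]
  by (simp add: linear_sum linear_cmul)

text \<open>Both iterated derivatives contain the second derivative of \<open>f\<close> on
  \<open>X u\<close> and \<open>Y u\<close>, which cancels by symmetry; what is left is the first
  derivative of \<open>f\<close> on the bracket.\<close>

lemma lie_deriv_commutator:
  assumes S: "open S" "u \<in> S" and X: "smooth_on S X" and Y: "smooth_on S Y" and f: "smooth_on S f"
  shows "lie_deriv X (lie_deriv Y f) u - lie_deriv Y (lie_deriv X f) u = lie_deriv (lie_bracket X Y) f u"
proof -
  note Df = smooth_on_has_derivative[OF smooth_on_blinfun_deriv[OF S(1) f] S(2)]
  let ?D = "frechet_derivative (blinfun_deriv f) (at u)"
  have fd: "blinfun_apply (blinfun_deriv f x) = frechet_derivative f (at x)" if "x \<in> S" for x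
    by (rule blinfun_deriv_apply[OF smooth_on_differentiable[OF f that]])
  have DD: "?D h v = frechet_derivative (\<lambda>x. frechet_derivative f (at x) v) (at u) h" for h v
  proof -
    have "((\<lambda>x. blinfun_deriv f x v) has_derivative (\<lambda>h. ?D h v)) (at u)"
      using bounded_linear.has_derivative[OF bounded_bilinear.bounded_linear_left[OF bounded_bilinear_blinfun_apply] Df] .
    then have "((\<lambda>x. frechet_derivative f (at x) v) has_derivative (\<lambda>h. ?D h v)) (at u)"
      by (rule has_derivative_transform_within_open[OF _ S]) (simp add: fd)
    from frechet_derivative_at[OF this] show ?thesis by metis
  qed
  have sym: "?D h v = ?D v h" for h v unfolding DD by (rule frechet_derivative_symmetric[OF S(1) f S(2)])
  have *: "lie_deriv X (lie_deriv Y f) u = ?D (X u) (Y u) + frechet_derivative f (at u) (lie_deriv X Y u)"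
    if "smooth_on S Y" for X Y
  proof -
    have "((\<lambda>x. blinfun_deriv f x (Y x)) has_derivative
       (\<lambda>h. blinfun_deriv f u (frechet_derivative Y (at u) h) + ?D h (Y u))) (at u)"
      by (rule bounded_bilinear.FDERIV[OF bounded_bilinear_blinfun_apply Df smooth_on_has_derivative[OF that S(2)]])
    then have "(lie_deriv Y f has_derivative (\<lambda>h. blinfun_deriv f u (frechet_derivative Y (at u) h) + ?D h (Y u))) (at u)"
      by (rule has_derivative_transform_within_open[OF _ S]) (simp add: fd lie_deriv_def)
    from lie_deriv_eqI[OF this, of X] show ?thesis by (simp add: fd[OF S(2)] lie_deriv_def[of X Y])
  qed
  show ?thesis
    unfolding *[OF X] *[OF Y] lie_deriv_def[of "lie_bracket X Y"] lie_bracket_def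
    using linear_diff[OF linear_frechet_derivative[OF smooth_on_differentiable[OF f S(2)]]] sym[of "X u" "Y u"] by simp
qed

text \<open>The bilinear map with the Christoffel symbols of the coordinate fields as coefficients.
  It is assembled from basis values because \<open>nabla\<close> on constant fields is bilinear only
  at points of \<open>\<Omega>\<close>, and packed as nested operators so that its derivative in
  \<open>u\<close> makes sense.\<close>

definition christoffel_map ::
  "('n::finite vfield \<Rightarrow> 'n vfield \<Rightarrow> 'n vfield) \<Rightarrow> real^'n \<Rightarrow> (real^'n) \<Rightarrow>\<^sub>L (real^'n) \<Rightarrow>\<^sub>L (real^'n)" where
  "christoffel_map nabla u = Blinfun (\<lambda>x. Blinfun (\<lambda>y. \<Sum>b\<in>Basis. \<Sum>c\<in>Basis.
     (y \<bullet> b) *\<^sub>R (x \<bullet> c) *\<^sub>R nabla (\<lambda>_. c) (\<lambda>_. b) u))"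

lemma christoffel_map_apply:
  "christoffel_map nabla u x y = (\<Sum>b\<in>Basis. \<Sum>c\<in>Basis. (y \<bullet> b) *\<^sub>R (x \<bullet> c) *\<^sub>R nabla (\<lambda>_. c) (\<lambda>_. b) u)"
proof -
  let ?f = "\<lambda>x y. \<Sum>b\<in>Basis. \<Sum>c\<in>Basis. (y \<bullet> b) *\<^sub>R (x \<bullet> c) *\<^sub>R nabla (\<lambda>_. c) (\<lambda>_. b) u"
  have l: "linear (?f x)" for x
    by (rule linearI) (simp_all add: inner_add_left distrib_right scaleR_left_distrib sum.distrib scaleR_sum_right mult.assoc)
  have 1: "blinfun_apply (Blinfun (?f x)) = ?f x" for x
    by (rule bounded_linear_Blinfun_apply) (use l linear_conv_bounded_linear in blast)
  have *: "(\<Sum>b\<in>Basis. \<Sum>c\<in>Basis. (y \<bullet> b) *\<^sub>R ((x + x') \<bullet> c) *\<^sub>R nabla (\<lambda>_. c) (\<lambda>_. b) u) = ?f x y + ?f x' y" for x x' y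
    by (simp only: inner_add_left scaleR_left_distrib scaleR_right_distrib sum.distrib)
  have "linear (\<lambda>x. Blinfun (?f x))"
    by (rule linearI; rule blinfun_eqI; unfold blinfun.add_left blinfun.scaleR_left 1)
      (simp_all only: *, simp add: scaleR_sum_right mult.left_commute)
  then have "blinfun_apply (Blinfun (\<lambda>x. Blinfun (?f x))) = (\<lambda>x. Blinfun (?f x))"
    by (intro bounded_linear_Blinfun_apply) (use linear_conv_bounded_linear in blast)
  then show ?thesis by (simp only: christoffel_map_def 1)
qed

context
  fixes \<Omega> :: "(real^'n::finite) set" and nabla :: "'n vfield \<Rightarrow> 'n vfield \<Rightarrow> 'n vfield"
  assumes conn: "connection_on \<Omega> nabla"
begin

lemma connection_smooth:
  assumes "open U" "U \<subseteq> \<Omega>" "smooth_on U X" "smooth_on U Y"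
  shows "smooth_on U (nabla X Y)"
  using conn[unfolded connection_on_def, rule_format, OF assms smooth_on_const smooth_on_const] by blast

lemma
  assumes "open U" "U \<subseteq> \<Omega>" "u \<in> U" "smooth_on U X" "smooth_on U Y"
  shows connection_add_left: "smooth_on U X' \<Longrightarrow> nabla (\<lambda>x. X x + X' x) Y u = nabla X Y u + nabla X' Y u"
    and connection_add_right: "smooth_on U Y' \<Longrightarrow> nabla X (\<lambda>x. Y x + Y' x) u = nabla X Y u + nabla X Y' u"
    and connection_scaleR_left: "smooth_on U g \<Longrightarrow> nabla (\<lambda>x. g x *\<^sub>R X x) Y u = g u *\<^sub>R nabla X Y u"
    and connection_leibniz: "smooth_on U g \<Longrightarrow>
      nabla X (\<lambda>x. g x *\<^sub>R Y x) u = lie_deriv X g u *\<^sub>R Y u + g u *\<^sub>R nabla X Y u"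
proof -
  note ax = conn[unfolded connection_on_def, rule_format, OF assms(1,2)]
  show "nabla (\<lambda>x. X x + X' x) Y u = nabla X Y u + nabla X' Y u" if "smooth_on U X'"
    using ax[OF assms(4) that assms(5) smooth_on_const] assms(3) by blast
  show "nabla X (\<lambda>x. Y x + Y' x) u = nabla X Y u + nabla X Y' u" if "smooth_on U Y'"
    using ax[OF assms(4,5) that smooth_on_const] assms(3) by blast
  show "nabla (\<lambda>x. g x *\<^sub>R X x) Y u = g u *\<^sub>R nabla X Y u"
    and "nabla X (\<lambda>x. g x *\<^sub>R Y x) u = lie_deriv X g u *\<^sub>R Y u + g u *\<^sub>R nabla X Y u" if "smooth_on U g"
    using ax[OF assms(4,5,5) that] assms(3) by blast+
qed

lemma connection_sum_left:
  assumes U: "open U" "U \<subseteq> \<Omega>" "u \<in> U" and Y: "smooth_on U Y"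
    and "finite I" "\<And>i. i \<in> I \<Longrightarrow> smooth_on U (g i)" "\<And>i. i \<in> I \<Longrightarrow> smooth_on U (X i)"
  shows "nabla (\<lambda>x. \<Sum>i\<in>I. g i x *\<^sub>R X i x) Y u = (\<Sum>i\<in>I. g i u *\<^sub>R nabla (X i) Y u)"
  using assms(5-)
proof (induction I)
  case empty
  \<comment> \<open>The empty sum is the zero field, which is homogeneity with the constant factor
    0.\<close>
  show ?case
    using connection_scaleR_left[OF U smooth_on_const[of U 0] Y smooth_on_const[of U 0]] by simp
next
  case (insert i I)
  have "smooth_on U (\<lambda>x. \<Sum>i\<in>I. g i x *\<^sub>R X i x)" "smooth_on U (\<lambda>x. g i x *\<^sub>R X i x)"
    using insert.prems by (auto intro!: smooth_intros U(1))
  from connection_add_left[OF U this(2) Y this(1)] show ?case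
    using insert connection_scaleR_left[OF U _ Y, of "X i" "g i"] by simp
qed

lemma connection_sum_right:
  assumes U: "open U" "U \<subseteq> \<Omega>" "u \<in> U" and X: "smooth_on U X"
    and "finite I" "\<And>i. i \<in> I \<Longrightarrow> smooth_on U (g i)" "\<And>i. i \<in> I \<Longrightarrow> smooth_on U (Y i)"
  shows "nabla X (\<lambda>x. \<Sum>i\<in>I. g i x *\<^sub>R Y i x) u = (\<Sum>i\<in>I. lie_deriv X (g i) u *\<^sub>R Y i u + g i u *\<^sub>R nabla X (Y i) u)"
  using assms(5-)
proof (induction I)
  case empty
  show ?case
    using connection_leibniz[OF U X smooth_on_const[of U 0] smooth_on_const[of U 0]] by simp
next
  case (insert i I)
  have "smooth_on U (\<lambda>x. \<Sum>i\<in>I. g i x *\<^sub>R Y i x)" "smooth_on U (\<lambda>x. g i x *\<^sub>R Y i x)"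
    using insert.prems by (auto intro!: smooth_intros U(1))
  from connection_add_right[OF U X this(2) this(1)] show ?case
    using insert connection_leibniz[OF U X, of "Y i" "g i"] by simp
qed

text \<open>Expand \<open>Y\<close> in constant basis fields: the Leibniz rule produces the ordinary
  derivative, and linearity over functions in the first argument reduces the remaining terms to
  constant fields.\<close>

lemma connection_christoffel_map:
  assumes U: "open U" "U \<subseteq> \<Omega>" and X: "smooth_on U X" and Y: "smooth_on U Y" and u: "u \<in> U"
  shows "nabla X Y u = lie_deriv X Y u + christoffel_map nabla u (X u) (Y u)"
proof -
  have 1: "nabla X (\<lambda>_. b) u = (\<Sum>c\<in>Basis. (X u \<bullet> c) *\<^sub>R nabla (\<lambda>_. c) (\<lambda>_. b) u)" for b
    using connection_sum_left[OF U u smooth_on_const finite_Basis, of "\<lambda>c x. X x \<bullet> c" "\<lambda>c _. c" b]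
    by (simp add: euclidean_representation smooth_intros U(1) X)
  have "lie_deriv X (\<lambda>x. Y x \<bullet> b) u = lie_deriv X Y u \<bullet> b" for b
    unfolding lie_deriv_def[of X Y]
    by (rule lie_deriv_eqI[OF has_derivative_inner_left[OF smooth_on_has_derivative[OF Y u]]])
  then have "nabla X Y u = (\<Sum>b\<in>Basis. (lie_deriv X Y u \<bullet> b) *\<^sub>R b + (Y u \<bullet> b) *\<^sub>R nabla X (\<lambda>_. b) u)"
    using connection_sum_right[OF U u X finite_Basis, of "\<lambda>b x. Y x \<bullet> b" "\<lambda>b _. b"]
    by (simp add: euclidean_representation smooth_intros U(1) Y)
  then show ?thesis
    by (simp add: sum.distrib euclidean_representation 1 christoffel_map_apply scaleR_sum_right)
qed

lemma smooth_on_christoffel_map: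
  assumes "open \<Omega>"
  shows "smooth_on \<Omega> (christoffel_map nabla)"
  by (intro smooth_on_blinfun_componentwise assms)
    (auto simp: christoffel_map_apply
      intro!: smooth_on_sum smooth_on_bilinear[OF bounded_bilinear_scaleR] smooth_on_const assms connection_smooth)

lemma christoffel_map_const:
  assumes "open \<Omega>" "u \<in> \<Omega>"
  shows "nabla (\<lambda>_. x) (\<lambda>_. y) u = christoffel_map nabla u x y"
  using connection_christoffel_map[OF assms(1) order_refl smooth_on_const smooth_on_const assms(2)] by simp

lemma christoffel_map_symmetric:
  assumes "open \<Omega>" "symmetric_connection_on \<Omega> nabla" "u \<in> \<Omega>"
  shows "christoffel_map nabla u x y = christoffel_map nabla u y x"
  using assms(2)[unfolded symmetric_connection_on_def, rule_format, OF smooth_on_const smooth_on_const assms(3), of x y]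
  by (simp add: lie_bracket_def christoffel_map_const[OF assms(1,3)])

text \<open>Constant fields have vanishing bracket, so flatness applied to three of them leaves only
  the curvature expression in \<open>B\<close> and its first derivative.\<close>

lemma christoffel_map_flat:
  assumes \<Omega>: "open \<Omega>" and flat: "flat_connection_on \<Omega> nabla" and u: "u \<in> \<Omega>"
  defines "B \<equiv> christoffel_map nabla"
  defines "B' \<equiv> frechet_derivative B (at u)"
  shows "B' x y z + B u x (B u y z) = B' y x z + B u y (B u x z)"
proof -
  have n: "nabla (\<lambda>_. x) (nabla (\<lambda>_. y) (\<lambda>_. z)) u = B' x y z + B u x (B u y z)" for x y z
  proof -
    have "(B has_derivative B') (at u)"
      unfolding B'_def B_def by (rule smooth_on_has_derivative[OF smooth_on_christoffel_map[OF \<Omega>] u])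
    then have "((\<lambda>w. B w y) has_derivative (\<lambda>h. B' h y)) (at u)"
      by (rule bounded_linear.has_derivative[OF blinfun.bounded_linear_left])
    then have "((\<lambda>w. B w y z) has_derivative (\<lambda>h. B' h y z)) (at u)"
      by (rule bounded_linear.has_derivative[OF blinfun.bounded_linear_left])
    then have "(nabla (\<lambda>_. y) (\<lambda>_. z) has_derivative (\<lambda>h. B' h y z)) (at u)"
      by (rule has_derivative_transform_within_open[OF _ \<Omega> u]) (simp add: B_def christoffel_map_const[OF \<Omega>])
    from lie_deriv_eqI[OF this] show ?thesis
      using connection_christoffel_map[OF \<Omega> order_refl smooth_on_const
          connection_smooth[OF \<Omega> order_refl smooth_on_const smooth_on_const] u]
      by (simp add: B_def christoffel_map_const[OF \<Omega> u])
  qed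
  have "nabla (lie_bracket (\<lambda>_. x) (\<lambda>_. y)) (\<lambda>_. z) u = 0"
    using christoffel_map_const[OF \<Omega> u, of 0 z] by (simp add: lie_bracket_def[abs_def] blinfun.bilinear_simps)
  then show ?thesis
    using flat[unfolded flat_connection_on_def, rule_format, OF smooth_on_const smooth_on_const smooth_on_const u, of x y z]
    unfolding n by simp
qed

end

subsection \<open>Covariant derivatives of a flat symmetric connection\<close>

text \<open>Replaces the axiomatic connection by the explicit operator \<open>cov\<close>. The
  latter depends on its first argument only through the value at the point and on the second only
  through its germ, so calculations need no restrictions to open sets.\<close>

locale flat_christoffel =
  fixes \<Omega> :: "(real^'n::finite) set" and B :: "real^'n \<Rightarrow> (real^'n) \<Rightarrow>\<^sub>L (real^'n) \<Rightarrow>\<^sub>L (real^'n)"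
  assumes open_domain: "open \<Omega>"
    and B_smooth: "smooth_on \<Omega> B"
    and B_symmetric: "\<And>u x y. u \<in> \<Omega> \<Longrightarrow> B u x y = B u y x"
    and B_flat: "\<And>u x y z. u \<in> \<Omega> \<Longrightarrow>
      frechet_derivative B (at u) x y z + B u x (B u y z) = frechet_derivative B (at u) y x z + B u y (B u x z)"
begin

definition cov :: "'n vfield \<Rightarrow> 'n vfield \<Rightarrow> 'n vfield" where
  "cov X Y u = lie_deriv X Y u + B u (X u) (Y u)"

lemma cov_symmetric: "u \<in> \<Omega> \<Longrightarrow> cov X Y u - cov Y X u = lie_bracket X Y u"
  by (simp add: cov_def lie_bracket_def B_symmetric)

lemma B_has_derivative:
  assumes "U \<subseteq> \<Omega>" "u \<in> U" "smooth_on U Y" "smooth_on U Z"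
  shows "((\<lambda>w. B w (Y w) (Z w)) has_derivative
    (\<lambda>h. B u (Y u) (frechet_derivative Z (at u) h) +
        (B u (frechet_derivative Y (at u) h) (Z u) + frechet_derivative B (at u) h (Y u) (Z u)))) (at u)"
proof -
  have "u \<in> \<Omega>" using assms(1,2) by blast
  from bounded_bilinear.FDERIV[OF bounded_bilinear_blinfun_apply smooth_on_has_derivative[OF B_smooth this]
      smooth_on_has_derivative[OF assms(3,2)]]
  have "((\<lambda>w. B w (Y w)) has_derivative
     (\<lambda>h. B u (frechet_derivative Y (at u) h) + frechet_derivative B (at u) h (Y u))) (at u)" .
  from bounded_bilinear.FDERIV[OF bounded_bilinear_blinfun_apply this smooth_on_has_derivative[OF assms(4,2)]]
  show ?thesis by (simp add: blinfun.bilinear_simps)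
qed

text \<open>The second derivatives of \<open>Z\<close> are handled by
  \<open>lie_deriv_commutator\<close>, the mixed terms with one derivative of \<open>Z\<close>
  cancel in pairs, and \<open>B_flat\<close> removes the terms quadratic in \<open>B\<close>
  together with its derivative.\<close>

lemma cov_curvature:
  assumes U: "open U" "U \<subseteq> \<Omega>" "u \<in> U" and X: "smooth_on U X" and Y: "smooth_on U Y" and Z: "smooth_on U Z"
  shows "cov X (cov Y Z) u - cov Y (cov X Z) u = cov (lie_bracket X Y) Z u"
proof -
  have *: "cov X (cov Y Z) u = lie_deriv X (lie_deriv Y Z) u + (B u (Y u) (lie_deriv X Z u)
      + (B u (lie_deriv X Y u) (Z u) + frechet_derivative B (at u) (X u) (Y u) (Z u)))
      + B u (X u) (lie_deriv Y Z u) + B u (X u) (B u (Y u) (Z u))"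
    if "smooth_on U X" "smooth_on U Y" for X Y
  proof -
    have "(cov Y Z has_derivative (\<lambda>h. frechet_derivative (lie_deriv Y Z) (at u) h +
       (B u (Y u) (frechet_derivative Z (at u) h) +
        (B u (frechet_derivative Y (at u) h) (Z u) + frechet_derivative B (at u) h (Y u) (Z u))))) (at u)"
      unfolding cov_def[abs_def]
      by (intro has_derivative_add B_has_derivative[OF U(2,3) that(2) Z]
          smooth_on_has_derivative[OF smooth_on_lie_deriv[OF U(1) that(2) Z] U(3)])
    from lie_deriv_eqI[OF this, of X] show ?thesis
      by (simp add: cov_def[of X "cov Y Z"] cov_def[of Y Z u] blinfun.bilinear_simps
          lie_deriv_def[of X "lie_deriv Y Z"] lie_deriv_def[of X Z] lie_deriv_def[of X Y])
  qed
  have u: "u \<in> \<Omega>" using U(2,3) by blast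
  have 1: "frechet_derivative B (at u) (X u) (Y u) (Z u)
      = frechet_derivative B (at u) (Y u) (X u) (Z u) + B u (Y u) (B u (X u) (Z u)) - B u (X u) (B u (Y u) (Z u))"
    using B_flat[OF u, of "X u" "Y u" "Z u"] by (simp only: eq_diff_eq)
  have 2: "B u (lie_bracket X Y u) (Z u) = B u (lie_deriv X Y u) (Z u) - B u (lie_deriv Y X u) (Z u)"
    unfolding lie_bracket_def by (simp only: blinfun.diff_left blinfun.diff_right)
  have 3: "(l1 + (c1 + (b1 + (f + d2 - d1))) + c2 + d1) - (l2 + (c2 + (b2 + f)) + c1 + d2) = l1 - l2 + (b1 - b2)"
    for l1 c1 b1 f d2 d1 c2 l2 b2 :: "real^'n"
    by simp
  show ?thesis
    unfolding *[OF X Y] *[OF Y X] cov_def[of "lie_bracket X Y"] lie_deriv_commutator[OF U(1,3) X Y Z, symmetric] 1 2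
    by (rule 3)
qed

lemma cov_cong:
  assumes "open S" "u \<in> S" "smooth_on S Y" "\<And>x. x \<in> S \<Longrightarrow> Y x = Z x"
  shows "cov X Y u = cov X Z u"
  using lie_deriv_cong[OF assms] assms(2,4) by (simp add: cov_def)

lemma cov_scaleR:
  assumes "smooth_on U g" "smooth_on U Y" "u \<in> U"
  shows "cov X (\<lambda>w. g w *\<^sub>R Y w) u = lie_deriv X g u *\<^sub>R Y u + g u *\<^sub>R cov X Y u"
  by (simp add: cov_def lie_deriv_scaleR[OF assms] blinfun.bilinear_simps algebra_simps)

lemma cov_sum:
  assumes "open U" "finite I" "\<And>i. i \<in> I \<Longrightarrow> smooth_on U (Y i)" "u \<in> U"
  shows "cov X (\<lambda>w. \<Sum>i\<in>I. Y i w) u = (\<Sum>i\<in>I. cov X (Y i) u)"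
  by (simp add: cov_def lie_deriv_sum[OF assms] blinfun.sum_right sum.distrib)

text \<open>Tensoriality in the first argument: the expansion of \<open>X\<close> is needed only at
  \<open>u\<close>, with plain numbers as coefficients.\<close>

lemma cov_linear_left:
  assumes "smooth_on U Y" "u \<in> U" "X u = (\<Sum>i\<in>I. a i *\<^sub>R Z i u)"
  shows "cov X Y u = (\<Sum>i\<in>I. a i *\<^sub>R cov (Z i) Y u)"
proof -
  have l: "linear (frechet_derivative Y (at u))"
    by (rule linear_frechet_derivative[OF smooth_on_differentiable[OF assms(1,2)]])
  have "B u (X u) (Y u) = (\<Sum>i\<in>I. a i *\<^sub>R B u (Z i u) (Y u))"
    unfolding assms(3) by (simp only: blinfun.sum_right blinfun.sum_left blinfun.scaleR_right blinfun.scaleR_left)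
  moreover have "lie_deriv X Y u = (\<Sum>i\<in>I. a i *\<^sub>R lie_deriv (Z i) Y u)"
    unfolding lie_deriv_def assms(3) by (simp only: linear_sum[OF l] linear_cmul[OF l])
  ultimately show ?thesis unfolding cov_def scaleR_right_distrib sum.distrib by simp
qed

end

text \<open>Exchanging the summation indices in the second double sum leaves a contraction with
  \<open>E j i - E i j\<close>. It is applied with \<open>l = 1\<close> to brackets and with
  \<open>l = lam\<close> to their images under \<Lambda>, which makes the two sets of coefficients
  comparable.\<close>

lemma antisymmetrized_sum:
  fixes E :: "nat \<Rightarrow> nat \<Rightarrow> 'a::real_vector"
  assumes "\<And>i j. i \<in> I \<Longrightarrow> j \<in> I \<Longrightarrow> E j i - E i j = (\<Sum>k\<in>I. (c j i k * l k) *\<^sub>R r k)"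
  shows "(\<Sum>i\<in>I. \<Sum>j\<in>I. (q i * p j) *\<^sub>R E j i) - (\<Sum>i\<in>I. \<Sum>j\<in>I. (p i * q j) *\<^sub>R E j i)
    = (\<Sum>k\<in>I. ((\<Sum>i\<in>I. \<Sum>j\<in>I. q i * p j * c j i k) * l k) *\<^sub>R r k)"
proof -
  have "(\<Sum>i\<in>I. \<Sum>j\<in>I. (p i * q j) *\<^sub>R E j i) = (\<Sum>i\<in>I. \<Sum>j\<in>I. (q i * p j) *\<^sub>R E i j)"
    by (subst sum.swap) (simp add: mult.commute)
  then have "(\<Sum>i\<in>I. \<Sum>j\<in>I. (q i * p j) *\<^sub>R E j i) - (\<Sum>i\<in>I. \<Sum>j\<in>I. (p i * q j) *\<^sub>R E j i)
    = (\<Sum>i\<in>I. \<Sum>j\<in>I. (q i * p j) *\<^sub>R (E j i - E i j))"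
    by (simp add: sum_subtractf scaleR_diff_right)
  also have "\<dots> = (\<Sum>i\<in>I. \<Sum>j\<in>I. \<Sum>k\<in>I. (q i * p j * c j i k * l k) *\<^sub>R r k)"
    using assms by (intro sum.cong refl) (simp add: scaleR_sum_right mult.assoc)
  also have "\<dots> = (\<Sum>i\<in>I. \<Sum>k\<in>I. \<Sum>j\<in>I. (q i * p j * c j i k * l k) *\<^sub>R r k)"
    by (intro sum.cong refl sum.swap)
  also have "\<dots> = (\<Sum>k\<in>I. \<Sum>i\<in>I. \<Sum>j\<in>I. (q i * p j * c j i k * l k) *\<^sub>R r k)"
    by (rule sum.swap)
  also have "\<dots> = (\<Sum>k\<in>I. ((\<Sum>i\<in>I. \<Sum>j\<in>I. q i * p j * c j i k) * l k) *\<^sub>R r k)"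
    by (simp add: scaleR_sum_left sum_distrib_right)
  finally show ?thesis .
qed

section \<open>The \<lambda>-system in a frame in involution\<close>

locale flat_frame = flat_christoffel \<Omega> B for \<Omega> :: "(real^'n::finite) set" and B +
  fixes m :: nat and r s :: "nat \<Rightarrow> 'n vfield" and c \<Gamma> :: "nat \<Rightarrow> nat \<Rightarrow> nat \<Rightarrow> real^'n \<Rightarrow> real"
  assumes frame: "partial_frame \<Omega> m r"
    and involution: "in_involution \<Omega> m r"
    and completion: "frame_completion \<Omega> m r s"
    and structure_eqs: "structure_functions \<Omega> m r s c"
    and christoffel: "christoffel_symbols \<Omega> cov m r s \<Gamma>"
begin

lemma m_le: "m \<le> CARD('n)"
  using frame by (simp add: partial_frame_def)

lemma r_smooth: "i \<in> {1..m} \<Longrightarrow> U \<subseteq> \<Omega> \<Longrightarrow> smooth_on U (r i)"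
  using frame smooth_on_subset unfolding partial_frame_def by blast

text \<open>The dual basis at one point, described through the two sums in which the structure
  equations present vectors. It serves to compare coefficients at a fixed point.\<close>

definition coframe_at :: "real^'n \<Rightarrow> (nat \<Rightarrow> real^'n \<Rightarrow> real) \<Rightarrow> bool" where
  "coframe_at u \<xi> \<longleftrightarrow> (\<forall>k. linear (\<xi> k)) \<and>
    (\<forall>k\<in>{1..CARD('n)}. \<forall>a. \<xi> k (\<Sum>l=1..m. a l *\<^sub>R r l u) = (if k \<le> m then a k else 0)) \<and>
    (\<forall>k\<in>{1..CARD('n)}. \<forall>a. \<xi> k (\<Sum>l=m+1..CARD('n). a l *\<^sub>R s l u) = (if k \<le> m then 0 else a k)) \<and>
    (\<forall>v. (\<forall>k\<in>{1..CARD('n)}. \<xi> k v = 0) \<longrightarrow> v = 0) \<and>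
    (\<forall>k\<in>{1..CARD('n)}. \<forall>l\<in>{1..m}. \<xi> k (r l u) = (if k = l then 1 else 0))"

lemma coframe_atD:
  assumes "coframe_at u \<xi>"
  shows "linear (\<xi> k)"
    "k \<in> {1..CARD('n)} \<Longrightarrow> \<xi> k (\<Sum>l=1..m. a l *\<^sub>R r l u) = (if k \<le> m then a k else 0)"
    "k \<in> {1..CARD('n)} \<Longrightarrow> \<xi> k (\<Sum>l=m+1..CARD('n). a l *\<^sub>R s l u) = (if k \<le> m then 0 else a k)"
    "(\<And>k. k \<in> {1..CARD('n)} \<Longrightarrow> \<xi> k v = 0) \<Longrightarrow> v = 0"
    "k \<in> {1..CARD('n)} \<Longrightarrow> l \<in> {1..m} \<Longrightarrow> \<xi> k (r l u) = (if k = l then 1 else 0)"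
  using assms unfolding coframe_at_def by blast+

lemma coframe_at_exists:
  assumes u: "u \<in> \<Omega>"
  shows "\<exists>\<xi>. coframe_at u \<xi>"
proof -
  define e where "e k = (if k \<le> m then r k u else s k u)" for k
  have eq: "(\<lambda>k. (if k \<le> m then r k else s k) u) = e" by (auto simp: e_def)
  have ind: "inj_on e {1..CARD('n)}" "independent (e ` {1..CARD('n)})"
    using completion[unfolded frame_completion_def partial_frame_def, THEN conjunct2, THEN conjunct2, THEN conjunct2,
        rule_format, OF u] unfolding eq by blast+
  obtain \<xi> :: "nat \<Rightarrow> real^'n \<Rightarrow> real" where \<xi>: "\<And>k. linear (\<xi> k)"
    "\<And>k l. k \<in> {1..CARD('n)} \<Longrightarrow> l \<in> {1..CARD('n)} \<Longrightarrow> \<xi> k (e l) = (if l = k then 1 else 0)"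
    using dual_family[OF ind] by metis
  have "coframe_at u \<xi>"
    unfolding coframe_at_def
  proof (intro conjI ballI allI impI \<xi>(1))
    fix k a assume k: "k \<in> {1..CARD('n)}"
    have "(\<Sum>l=1..m. a l *\<^sub>R r l u) = (\<Sum>l=1..m. a l *\<^sub>R e l)" by (simp add: e_def)
    then show "\<xi> k (\<Sum>l=1..m. a l *\<^sub>R r l u) = (if k \<le> m then a k else 0)"
      using dual_family_sum[of "\<xi> k" "{1..m}" e k a, OF \<xi>(1)] \<xi>(2)[OF k] m_le k by simp
  next
    fix k a assume k: "k \<in> {1..CARD('n)}"
    have "(\<Sum>l=m+1..CARD('n). a l *\<^sub>R s l u) = (\<Sum>l=m+1..CARD('n). a l *\<^sub>R e l)" by (simp add: e_def)
    then show "\<xi> k (\<Sum>l=m+1..CARD('n). a l *\<^sub>R s l u) = (if k \<le> m then 0 else a k)"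
      using dual_family_sum[of "\<xi> k" "{m+1..CARD('n)}" e k a, OF \<xi>(1)] \<xi>(2)[OF k] m_le k by auto
  next
    fix k l assume k: "k \<in> {1..CARD('n)}" and "l \<in> {1..m}"
    then show "\<xi> k (r l u) = (if k = l then 1 else 0)"
      using \<xi>(2)[OF k, of l] m_le by (simp add: e_def)
  next
    fix v assume "\<forall>k\<in>{1..CARD('n)}. \<xi> k v = 0"
    then show "v = 0" using dual_frame_zero[OF ind _ _ \<xi>] by simp
  qed
  then show ?thesis by blast
qed

text \<open>Involution supplies an expansion of the bracket in the \<open>r k\<close> alone, and the
  coframe forces the coefficients along the \<open>s l\<close> to vanish. Symmetry of the connection
  then expresses \<open>c\<close> through \<open>\<Gamma>\<close>, which eliminates \<open>c\<close>
  from the \<lambda>-system where convenient.\<close>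

lemma bracket_coefficients:
  assumes u: "u \<in> \<Omega>" and ij: "i \<in> {1..m}" "j \<in> {1..m}"
  shows "lie_bracket (r i) (r j) u = (\<Sum>k=1..m. c i j k u *\<^sub>R r k u)"
    and "k \<in> {1..CARD('n)} \<Longrightarrow> m < k \<Longrightarrow> c i j k u = 0"
    and "k \<in> {1..CARD('n)} \<Longrightarrow> \<Gamma> i j k u - \<Gamma> j i k u = c i j k u"
    and "k \<in> {1..m} \<Longrightarrow> c i i k u = 0"
proof -
  obtain \<xi> where "coframe_at u \<xi>" using coframe_at_exists[OF u] by blast
  note \<xi> = coframe_atD[OF this]
  obtain a where a: "lie_bracket (r i) (r j) u = (\<Sum>k=1..m. a k u *\<^sub>R r k u)"
    using involution ij u unfolding in_involution_def by blast
  have c: "lie_bracket (r i) (r j) u = (\<Sum>k=1..m. c i j k u *\<^sub>R r k u) + (\<Sum>l=m+1..CARD('n). c i j l u *\<^sub>R s l u)"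
    if "i \<in> {1..m}" "j \<in> {1..m}" for i j
    using structure_eqs that u unfolding structure_functions_def by blast
  have g: "cov (r i) (r j) u = (\<Sum>k=1..m. \<Gamma> i j k u *\<^sub>R r k u) + (\<Sum>l=m+1..CARD('n). \<Gamma> i j l u *\<^sub>R s l u)"
    if "i \<in> {1..m}" "j \<in> {1..m}" for i j
    using christoffel that u unfolding christoffel_symbols_def by blast
  have xg: "\<xi> k (cov (r i) (r j) u) = \<Gamma> i j k u" if "k \<in> {1..CARD('n)}" "i \<in> {1..m}" "j \<in> {1..m}" for k i j
    using that by (simp only: g linear_add[OF \<xi>(1)] \<xi>(2,3)) simp
  have xc: "\<xi> k (lie_bracket (r i) (r j) u) = c i j k u" if "k \<in> {1..CARD('n)}" "i \<in> {1..m}" "j \<in> {1..m}" for k i j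
    using that by (simp only: c linear_add[OF \<xi>(1)] \<xi>(2,3)) simp
  show z: "c i j k u = 0" if "k \<in> {1..CARD('n)}" "m < k" for k
    using xc[OF that(1) ij] that unfolding a \<xi>(2)[OF that(1)] by simp
  show "lie_bracket (r i) (r j) u = (\<Sum>k=1..m. c i j k u *\<^sub>R r k u)"
    unfolding c[OF ij] by (simp add: z)
  show "\<Gamma> i j k u - \<Gamma> j i k u = c i j k u" if "k \<in> {1..CARD('n)}"
    using cov_symmetric[OF u, of "r i" "r j"] xc[OF that ij] xg[OF that ij] xg[OF that ij(2,1)] linear_diff[OF \<xi>(1)] by metis
  show "c i i k u = 0" if "k \<in> {1..m}"
    using xc[of k i i] ij m_le that linear_0[OF \<xi>(1), of k] by (simp add: lie_bracket_def)
qed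

text \<open>\<open>compat\<close> says that \<open>nabla_i (\<Lambda> r_j) - nabla_j (\<Lambda> r_i) = \<Lambda> [r_i, r_j]\<close>, where \<open>\<Lambda> r_k = lam_k r_k\<close>.\<close>

definition compat :: "(nat \<Rightarrow> real^'n \<Rightarrow> real) \<Rightarrow> nat \<Rightarrow> nat \<Rightarrow> real^'n \<Rightarrow> bool" where
  "compat lam i j u \<longleftrightarrow>
    (lie_deriv (r i) (lam j) u *\<^sub>R r j u + lam j u *\<^sub>R cov (r i) (r j) u)
      - (lie_deriv (r j) (lam i) u *\<^sub>R r i u + lam i u *\<^sub>R cov (r j) (r i) u)
    = (\<Sum>k=1..m. (c i j k u * lam k u) *\<^sub>R r k u)"

lemma compat_iff:
  assumes u: "u \<in> \<Omega>" and ij: "i \<in> {1..m}" "j \<in> {1..m}"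
  shows "compat lam i j u \<longleftrightarrow> (\<forall>k\<in>{1..CARD('n)}.
    ((if k = j then lie_deriv (r i) (lam j) u else 0) + lam j u * \<Gamma> i j k u)
      - ((if k = i then lie_deriv (r j) (lam i) u else 0) + lam i u * \<Gamma> j i k u)
    = (if k \<le> m then c i j k u * lam k u else 0))"
    (is "_ \<longleftrightarrow> (\<forall>k\<in>_. ?E k)")
proof -
  obtain \<xi> where "coframe_at u \<xi>" using coframe_at_exists[OF u] by blast
  note \<xi> = coframe_atD[OF this]
  have g: "cov (r i) (r j) u = (\<Sum>k=1..m. \<Gamma> i j k u *\<^sub>R r k u) + (\<Sum>l=m+1..CARD('n). \<Gamma> i j l u *\<^sub>R s l u)"
    if "i \<in> {1..m}" "j \<in> {1..m}" for i j
    using christoffel that u unfolding christoffel_symbols_def by blast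
  have xg: "\<xi> k (cov (r i) (r j) u) = \<Gamma> i j k u" if "k \<in> {1..CARD('n)}" "i \<in> {1..m}" "j \<in> {1..m}" for k i j
    using that by (simp only: g linear_add[OF \<xi>(1)] \<xi>(2,3)) simp
  define d where "d = (lie_deriv (r i) (lam j) u *\<^sub>R r j u + lam j u *\<^sub>R cov (r i) (r j) u)
      - (lie_deriv (r j) (lam i) u *\<^sub>R r i u + lam i u *\<^sub>R cov (r j) (r i) u)
      - (\<Sum>k=1..m. (c i j k u * lam k u) *\<^sub>R r k u)"
  have "\<xi> k d = 0 \<longleftrightarrow> ?E k" if k: "k \<in> {1..CARD('n)}" for k
    unfolding d_def linear_diff[OF \<xi>(1)] linear_add[OF \<xi>(1)] linear_cmul[OF \<xi>(1)] \<xi>(2)[OF k]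
      xg[OF k ij] xg[OF k ij(2,1)] \<xi>(5)[OF k ij(1)] \<xi>(5)[OF k ij(2)] by simp
  moreover have "d = 0 \<longleftrightarrow> (\<forall>k\<in>{1..CARD('n)}. \<xi> k d = 0)"
    using \<xi>(4)[of d] linear_0[OF \<xi>(1)] by auto
  moreover have "compat lam i j u \<longleftrightarrow> d = 0" by (simp add: compat_def d_def)
  ultimately show ?thesis by simp
qed

text \<open>The three families of equations are the components of one vector identity. Component
  \<open>k = j\<close> is the differential equation for \<open>lam j\<close>, \<open>k = i\<close>
  the one for \<open>lam i\<close>, the other \<open>k\<close> up to \<open>m\<close> give the
  algebraic equations with three indices, and \<open>k > m\<close> the last family, where
  \<open>\<Gamma> i j k = \<Gamma> j i k\<close> by involution.\<close>

lemma lambda_system_iff_compat: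
  assumes U: "U \<subseteq> \<Omega>"
  shows "lambda_system U m r c \<Gamma> lam \<longleftrightarrow> (\<forall>i\<in>{1..m}. \<forall>j\<in>{1..m}. i \<noteq> j \<longrightarrow> (\<forall>u\<in>U. compat lam i j u))"
proof
  assume L: "lambda_system U m r c \<Gamma> lam"
  show "\<forall>i\<in>{1..m}. \<forall>j\<in>{1..m}. i \<noteq> j \<longrightarrow> (\<forall>u\<in>U. compat lam i j u)"
  proof (intro ballI impI)
    fix i j u assume ij: "i \<in> {1..m}" "j \<in> {1..m}" "i \<noteq> j" and uU: "u \<in> U"
    then have u: "u \<in> \<Omega>" using U by blast
    note L1 = L[unfolded lambda_system_def, THEN conjunct1, rule_format, OF _ _ _ uU]
    note L2 = L[unfolded lambda_system_def, THEN conjunct2, THEN conjunct1, rule_format, OF _ _ _ _ _ _ uU]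
    note L3 = L[unfolded lambda_system_def, THEN conjunct2, THEN conjunct2, rule_format, OF _ _ _ _ uU]
    show "compat lam i j u"
      unfolding compat_iff[OF u ij(1,2)]
    proof
      fix k assume k: "k \<in> {1..CARD('n)}"
      have sym: "c i j k u = \<Gamma> i j k u - \<Gamma> j i k u" by (rule bracket_coefficients(3)[OF u ij(1,2) k, symmetric])
      consider "k = j" | "k = i" | "k \<in> {1..m}" "k \<noteq> i" "k \<noteq> j" | "k > m" using k by fastforce
      then show "((if k = j then lie_deriv (r i) (lam j) u else 0) + lam j u * \<Gamma> i j k u)
      - ((if k = i then lie_deriv (r j) (lam i) u else 0) + lam i u * \<Gamma> j i k u)
    = (if k \<le> m then c i j k u * lam k u else 0)"
      proof cases
        case 1
        then show ?thesis unfolding sym using ij L1[OF ij] by (simp add: algebra_simps)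
      next
        case 2
        then show ?thesis unfolding sym using ij L1[OF ij(2,1)] by (simp add: algebra_simps)
      next
        case 3
        then show ?thesis using L2[OF ij(1,2) 3(1) ij(3)] by simp
      next
        case 4
        have "(lam j u - lam i u) * \<Gamma> j i k u = 0" using L3[OF ij, of k] 4 k by simp
        moreover have "\<Gamma> i j k u = \<Gamma> j i k u" using sym bracket_coefficients(2)[OF u ij(1,2) k 4] by simp
        ultimately show ?thesis using 4 ij by (simp add: algebra_simps)
      qed
    qed
  qed
next
  assume C: "\<forall>i\<in>{1..m}. \<forall>j\<in>{1..m}. i \<noteq> j \<longrightarrow> (\<forall>u\<in>U. compat lam i j u)"
  have E: "((if k = j then lie_deriv (r i) (lam j) u else 0) + lam j u * \<Gamma> i j k u)
      - ((if k = i then lie_deriv (r j) (lam i) u else 0) + lam i u * \<Gamma> j i k u)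
    = (if k \<le> m then c i j k u * lam k u else 0)"
    if "i \<in> {1..m}" "j \<in> {1..m}" "i \<noteq> j" "u \<in> U" "k \<in> {1..CARD('n)}" for i j k u
  proof -
    have "u \<in> \<Omega>" using U that(4) by blast
    moreover have "compat lam i j u" using C that(1-4) by blast
    ultimately show ?thesis using compat_iff[OF _ that(1,2), THEN iffD1, rule_format, OF _ _ that(5)] by blast
  qed
  show "lambda_system U m r c \<Gamma> lam"
    unfolding lambda_system_def
  proof (intro conjI ballI impI)
    fix i j u assume ij: "i \<in> {1..m}" "j \<in> {1..m}" "i \<noteq> j" and uU: "u \<in> U"
    then have u: "u \<in> \<Omega>" using U by blast
    have j: "j \<in> {1..CARD('n)}" using ij m_le by simp
    show "lie_deriv (r i) (lam j) u = \<Gamma> j i j u * (lam i u - lam j u)"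
      using E[OF ij uU j, folded bracket_coefficients(3)[OF u ij(1,2) j]] ij by (simp add: algebra_simps)
    fix l assume l: "l \<in> {m+1..CARD('n)}"
    then have l': "l \<in> {1..CARD('n)}" "m < l" by auto
    show "(lam j u - lam i u) * \<Gamma> j i l u = 0"
      using E[OF ij uU l'(1)] bracket_coefficients(3)[OF u ij(1,2) l'(1)] bracket_coefficients(2)[OF u ij(1,2) l'] l'(2) ij
      by (simp add: algebra_simps)
  next
    fix i j k u assume ij: "i \<in> {1..m}" "j \<in> {1..m}" "k \<in> {1..m}" "i \<noteq> j" "j \<noteq> k" "i \<noteq> k" and uU: "u \<in> U"
    then show "lam j u * \<Gamma> i j k u - lam i u * \<Gamma> j i k u - c i j k u * lam k u = 0"
      using E[OF ij(1,2,4) uU, of k] m_le by simp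
  qed
qed

theorem f_system_imp_lambda_system:
  assumes U: "open U" "U \<subseteq> \<Omega>" and f: "smooth_on U f" and lam: "\<And>i. i \<in> {1..m} \<Longrightarrow> smooth_on U (lam i)"
    and sys: "f_system U cov m r lam f"
  shows "lambda_system U m r c \<Gamma> lam"
  unfolding lambda_system_iff_compat[OF U(2)]
proof (intro ballI impI)
  fix i j u assume ij: "i \<in> {1..m}" "j \<in> {1..m}" and u: "u \<in> U"
  have u\<Omega>: "u \<in> \<Omega>" using u U by blast
  note rs = r_smooth[OF _ U(2)]
  have eq: "cov (r i) f x = lam i x *\<^sub>R r i x" if "i \<in> {1..m}" "x \<in> U" for i x
    using sys that unfolding f_system_def by blast
  have *: "cov X (cov (r j) f) u = lie_deriv X (lam j) u *\<^sub>R r j u + lam j u *\<^sub>R cov X (r j) u"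
    if j: "j \<in> {1..m}" for X j
  proof -
    have "cov X (\<lambda>x. lam j x *\<^sub>R r j x) u = cov X (cov (r j) f) u"
      by (rule cov_cong[OF U(1) u]) (use eq j in \<open>auto intro!: smooth_intros U lam rs\<close>)
    then show ?thesis using cov_scaleR[OF lam[OF j] rs[OF j] u] by simp
  qed
  have "cov (lie_bracket (r i) (r j)) f u = (\<Sum>k=1..m. c i j k u *\<^sub>R cov (r k) f u)"
    by (rule cov_linear_left[where I = "{1..m}" and a = "\<lambda>k. c i j k u" and Z = r, OF f u])
      (rule bracket_coefficients(1)[OF u\<Omega> ij])
  also have "\<dots> = (\<Sum>k=1..m. (c i j k u * lam k u) *\<^sub>R r k u)" by (simp add: eq u)
  finally show "compat lam i j u"
    using cov_curvature[OF U u rs[OF ij(1)] rs[OF ij(2)] f] unfolding compat_def *[OF ij(1)] *[OF ij(2)] by simp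
qed

text \<open>Extends \<open>compat\<close> from frame fields to combinations with variable
  coefficients: \<open>T v\<close> is \<open>\<Lambda> (P v)\<close>. The derivatives of the
  coefficients and the structure functions enter both expansions in the same way, apart from the
  factor \<open>lam k\<close>, so one family \<mu> serves both.\<close>

lemma frame_combination_bracket:
  assumes U: "open U" "U \<subseteq> \<Omega>" "u \<in> U" and a: "\<And>i v. i \<in> {1..m} \<Longrightarrow> smooth_on U (\<lambda>u. a i u v)"
    and lam: "\<And>i. i \<in> {1..m} \<Longrightarrow> smooth_on U (lam i)"
    and sys: "lambda_system U m r c \<Gamma> lam"
  defines "P \<equiv> \<lambda>v u. \<Sum>i=1..m. a i u v *\<^sub>R r i u" and "T \<equiv> \<lambda>v u. \<Sum>i=1..m. (a i u v * lam i u) *\<^sub>R r i u"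
  shows "\<exists>\<mu>. lie_bracket (P v) (P w) u = (\<Sum>k=1..m. \<mu> k *\<^sub>R r k u) \<and>
    cov (P v) (T w) u - cov (P w) (T v) u = (\<Sum>k=1..m. (\<mu> k * lam k u) *\<^sub>R r k u)"
proof -
  note rs = r_smooth[OF _ U(2)]
  have u: "u \<in> \<Omega>" using U(2,3) by blast
  have exp: "cov (P v) (\<lambda>u. \<Sum>i=1..m. b i u *\<^sub>R r i u) u
     = (\<Sum>i=1..m. lie_deriv (P v) (b i) u *\<^sub>R r i u) + (\<Sum>i=1..m. \<Sum>j=1..m. (b i u * a j u v) *\<^sub>R cov (r j) (r i) u)"
    if b: "\<And>i. i \<in> {1..m} \<Longrightarrow> smooth_on U (b i)" for b v
  proof -
    have "cov (P v) (\<lambda>u. \<Sum>i=1..m. b i u *\<^sub>R r i u) u = (\<Sum>i=1..m. cov (P v) (\<lambda>u. b i u *\<^sub>R r i u) u)"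
      by (rule cov_sum[OF U(1) _ _ U(3)]) (auto intro!: smooth_intros U b rs)
    also have "\<dots> = (\<Sum>i=1..m. lie_deriv (P v) (b i) u *\<^sub>R r i u + (\<Sum>j=1..m. (b i u * a j u v) *\<^sub>R cov (r j) (r i) u))"
    proof (rule sum.cong[OF refl])
      fix i assume i: "i \<in> {1..m}"
      have "cov (P v) (r i) u = (\<Sum>j=1..m. a j u v *\<^sub>R cov (r j) (r i) u)"
        by (rule cov_linear_left[where I = "{1..m}" and a = "\<lambda>j. a j u v" and Z = r, OF rs[OF i] U(3)]) (simp add: P_def)
      then show "cov (P v) (\<lambda>u. b i u *\<^sub>R r i u) u = lie_deriv (P v) (b i) u *\<^sub>R r i u + (\<Sum>j=1..m. (b i u * a j u v) *\<^sub>R cov (r j) (r i) u)"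
        using cov_scaleR[OF b[OF i] rs[OF i] U(3)] by (simp add: scaleR_sum_right)
    qed
    finally show ?thesis by (simp add: sum.distrib)
  qed
  have lP: "lie_deriv (P v) (lam i) u = (\<Sum>j=1..m. a j u v * lie_deriv (r j) (lam i) u)" if "i \<in> {1..m}" for v i
    unfolding P_def using linear_lie_deriv_arg[OF lam[OF that] U(3), of "{1..m}" "\<lambda>j u. a j u v" r] by simp
  define \<alpha> where "\<alpha> v w i = lie_deriv (P v) (\<lambda>u. a i u w) u" for v w i
  define E where "E j i = lie_deriv (r j) (lam i) u *\<^sub>R r i u + lam i u *\<^sub>R cov (r j) (r i) u" for j i
  have covP: "cov (P v) (P w) u = (\<Sum>i=1..m. \<alpha> v w i *\<^sub>R r i u) + (\<Sum>i=1..m. \<Sum>j=1..m. (a i u w * a j u v) *\<^sub>R cov (r j) (r i) u)" for v w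
    unfolding P_def \<alpha>_def using exp[of "\<lambda>i u. a i u w" v] a unfolding P_def by simp
  have covT: "cov (P v) (T w) u = (\<Sum>i=1..m. (\<alpha> v w i * lam i u) *\<^sub>R r i u) + (\<Sum>i=1..m. \<Sum>j=1..m. (a i u w * a j u v) *\<^sub>R E j i)" for v w
  proof -
    have "lie_deriv (P v) (\<lambda>u. a i u w * lam i u) u = \<alpha> v w i * lam i u + (\<Sum>j=1..m. a i u w * a j u v * lie_deriv (r j) (lam i) u)"
      if i: "i \<in> {1..m}" for i
      using lie_deriv_scaleR[OF a[OF i, of w] lam[OF i] U(3), of "P v"] lP[OF i, of v]
      by (simp add: \<alpha>_def sum_distrib_left mult.assoc)
    then have "(\<Sum>i=1..m. lie_deriv (P v) (\<lambda>u. a i u w * lam i u) u *\<^sub>R r i u)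
      = (\<Sum>i=1..m. (\<alpha> v w i * lam i u) *\<^sub>R r i u) + (\<Sum>i=1..m. \<Sum>j=1..m. (a i u w * a j u v) *\<^sub>R (lie_deriv (r j) (lam i) u *\<^sub>R r i u))"
      by (simp add: scaleR_left_distrib sum.distrib scaleR_sum_left)
    moreover have "cov (P v) (T w) u = (\<Sum>i=1..m. lie_deriv (P v) (\<lambda>u. a i u w * lam i u) u *\<^sub>R r i u)
        + (\<Sum>i=1..m. \<Sum>j=1..m. (a i u w * lam i u * a j u v) *\<^sub>R cov (r j) (r i) u)"
      unfolding T_def by (rule exp) (auto intro!: smooth_intros U a lam)
    ultimately show ?thesis
      by (simp add: E_def scaleR_right_distrib sum.distrib mult.assoc mult.left_commute mult.commute[of "lam _ u"])
  qed
  \<comment> \<open>The \<lambda>-system speaks of distinct indices only; on the diagonal the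
    identity holds because both sides vanish.\<close>
  have ce: "compat lam j i u" if "i \<in> {1..m}" "j \<in> {1..m}" for i j
  proof (cases "i = j")
    case True
    then show ?thesis using bracket_coefficients(4)[OF u that(1,1)] by (simp add: compat_def)
  next
    case False
    then show ?thesis using sys[unfolded lambda_system_iff_compat[OF U(2)], rule_format, OF that(2,1) _ U(3)] by simp
  qed
  define \<mu> where "\<mu> k = \<alpha> v w k - \<alpha> w v k + (\<Sum>i=1..m. \<Sum>j=1..m. a i u w * a j u v * c j i k u)" for k
  have 1: "cov (r j) (r i) u - cov (r i) (r j) u = (\<Sum>k=1..m. (c j i k u * 1) *\<^sub>R r k u)"
    if "i \<in> {1..m}" "j \<in> {1..m}" for i j
    using cov_symmetric[OF u, of "r j" "r i"] bracket_coefficients(1)[OF u that(2,1)] by simp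
  have 2: "E j i - E i j = (\<Sum>k=1..m. (c j i k u * lam k u) *\<^sub>R r k u)"
    if "i \<in> {1..m}" "j \<in> {1..m}" for i j
    using ce[OF that] unfolding compat_def E_def .
  let ?Ce = "\<lambda>k. \<Sum>i=1..m. \<Sum>j=1..m. a i u w * a j u v * c j i k u"
  have A1: "(\<Sum>i=1..m. \<Sum>j=1..m. (a i u w * a j u v) *\<^sub>R cov (r j) (r i) u) - (\<Sum>i=1..m. \<Sum>j=1..m. (a i u v * a j u w) *\<^sub>R cov (r j) (r i) u)
    = (\<Sum>k=1..m. (?Ce k * 1) *\<^sub>R r k u)"
    by (rule antisymmetrized_sum[where c = "\<lambda>j i k. c j i k u" and l = "\<lambda>_. 1"]) (rule 1)
  have A2: "(\<Sum>i=1..m. \<Sum>j=1..m. (a i u w * a j u v) *\<^sub>R E j i) - (\<Sum>i=1..m. \<Sum>j=1..m. (a i u v * a j u w) *\<^sub>R E j i)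
    = (\<Sum>k=1..m. (?Ce k * lam k u) *\<^sub>R r k u)"
    by (rule antisymmetrized_sum[where c = "\<lambda>j i k. c j i k u" and l = "\<lambda>k. lam k u"]) (rule 2)
  have rearrange: "(x1 + s1) - (x2 + s2) = x1 - x2 + (s1 - s2)" for x1 s1 x2 s2 :: "real^'n" by simp
  have "lie_bracket (P v) (P w) u = (\<Sum>i=1..m. \<alpha> v w i *\<^sub>R r i u) - (\<Sum>i=1..m. \<alpha> w v i *\<^sub>R r i u) + (\<Sum>k=1..m. (?Ce k * 1) *\<^sub>R r k u)"
    unfolding cov_symmetric[OF u, symmetric] covP rearrange A1 ..
  also have "\<dots> = (\<Sum>k=1..m. \<mu> k *\<^sub>R r k u)"
    by (simp add: \<mu>_def scaleR_left_distrib scaleR_diff_left sum.distrib sum_subtractf)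
  finally have *: "lie_bracket (P v) (P w) u = (\<Sum>k=1..m. \<mu> k *\<^sub>R r k u)" .
  have "cov (P v) (T w) u - cov (P w) (T v) u = (\<Sum>i=1..m. (\<alpha> v w i * lam i u) *\<^sub>R r i u) - (\<Sum>i=1..m. (\<alpha> w v i * lam i u) *\<^sub>R r i u)
     + (\<Sum>k=1..m. (?Ce k * lam k u) *\<^sub>R r k u)"
    unfolding covT rearrange A2 ..
  also have "\<dots> = (\<Sum>k=1..m. (\<mu> k * lam k u) *\<^sub>R r k u)"
    by (simp add: \<mu>_def distrib_right left_diff_distrib scaleR_left_distrib scaleR_diff_left sum.distrib sum_subtractf)
  finally show ?thesis using * by blast
qed

end

text \<open>The derivative of the inverse at \<open>y\<close> is the inverse operator of the
  derivative of \<open>f\<close> at \<open>g y\<close>. If \<open>g\<close> has class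
  \<open>Ck\<close>, so has this operator, and \<open>g\<close> gains one order.\<close>

lemma smooth_inverse_function:
  fixes f :: "'a::euclidean_space \<Rightarrow> 'a"
  assumes U: "open U" "smooth_on U f" "x0 \<in> U" and id: "\<And>e. frechet_derivative f (at x0) e = e"
  obtains U' V g where "open U'" "U' \<subseteq> U" "x0 \<in> U'" "open V" "f x0 \<in> V" "homeomorphism U' V f g" "smooth_on V g"
proof -
  have "id_blinfun o\<^sub>L blinfun_deriv f x0 = id_blinfun"
    by (rule blinfun_eqI) (simp add: blinfun_deriv_apply[OF smooth_on_differentiable[OF U(2,3)]] id)
  show ?thesis
  proof (rule inverse_function_theorem[OF U(1) has_derivative_blinfun_deriv[OF U(2)]
        smooth_on_continuous[OF smooth_on_blinfun_deriv[OF U(1,2)]] U(3) \<open>_ = id_blinfun\<close>])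
  fix U' V g g'
  assume *: "open U'" "U' \<subseteq> U" "x0 \<in> U'" "open V" "f x0 \<in> V" "homeomorphism U' V f g"
    and g: "\<And>y. y \<in> V \<Longrightarrow> (g has_derivative (g' y)) (at y)"
    and g': "\<And>y. y \<in> V \<Longrightarrow> g' y = inv (blinfun_apply (blinfun_deriv f (g y)))"
    and bij: "\<And>y. y \<in> V \<Longrightarrow> bij (blinfun_apply (blinfun_deriv f (g y)))"
  define N where "N y = Blinfun (g' y)" for y
  have N: "blinfun_apply (N y) = g' y" if "y \<in> V" for y
    unfolding N_def by (rule bounded_linear_Blinfun_apply[OF has_derivative_bounded_linear[OF g[OF that]]])
  have gU: "g ` V \<subseteq> U" using *(2,6) unfolding homeomorphism_def by blast
  have "Ck_on k V g" for k
  proof (induction k)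
    case 0
    show ?case using *(6) by (simp add: homeomorphism_def)
  next
    case (Suc k)
    have "Ck_on k V (\<lambda>y. blinfun_deriv f (g y))"
      by (rule Ck_on_compose[OF *(4) _ Suc gU]) (use smooth_on_blinfun_deriv[OF U(1,2)] in \<open>simp add: smooth_on_def\<close>)
    then have "Ck_on k V N"
    proof (rule Ck_on_blinfun_inverse[OF *(4)])
      show "N y o\<^sub>L blinfun_deriv f (g y) = id_blinfun" if "y \<in> V" for y
        by (rule blinfun_eqI) (simp add: N[OF that] g'[OF that] inv_f_f[OF bij_is_inj[OF bij[OF that]]])
      show "blinfun_deriv f (g y) o\<^sub>L N y = id_blinfun" if "y \<in> V" for y
        by (rule blinfun_eqI) (simp add: N[OF that] g'[OF that] surj_f_inv_f[OF bij_is_surj[OF bij[OF that]]])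
    qed
    then have "Ck_on k V (\<lambda>y. N y v)" for v
      by (intro Ck_on_bilinear[OF bounded_bilinear_blinfun_apply *(4)] Ck_on_const)
    then show ?case by (intro Ck_on_SucI[OF *(4), of g "\<lambda>y. blinfun_apply (N y)"]) (use g N in auto)
  qed
  then have "smooth_on V g" by (simp add: smooth_on_def)
  then show ?thesis by (rule that[OF *])
  qed
qed

section \<open>Commuting fields, their lifts and the slice\<close>

context flat_frame
begin

text \<open>\<open>a i u v\<close> are the coordinates, with respect to the \<open>r i u\<close>, of
  the projection of \<open>v\<close> along the common kernel of the \<open>\<alpha> k\<close>. This
  kernel does not depend on \<open>u\<close>, and that is why the projected constant fields
  commute.\<close>

lemma local_projection:
  fixes \<alpha> :: "nat \<Rightarrow> real^'n \<Rightarrow> real"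
  assumes p: "p \<in> \<Omega>" and \<alpha>: "\<And>i. linear (\<alpha> i)"
    and \<alpha>r: "\<forall>i\<in>{1..m}. \<forall>j\<in>{1..m}. \<alpha> i (r j p) = (if j = i then 1 else 0)"
  shows "\<exists>D a. open D \<and> p \<in> D \<and> D \<subseteq> \<Omega> \<and> (\<forall>i v. smooth_on D (\<lambda>u. a i u v)) \<and> (\<forall>i u. linear (a i u)) \<and>
    (\<forall>u\<in>D. \<forall>i\<in>{1..m}. \<forall>j\<in>{1..m}. a i u (r j u) = (if j = i then 1 else (0::real))) \<and>
    (\<forall>u\<in>D. \<forall>i\<in>{1..m}. \<forall>v. (\<forall>k\<in>{1..m}. \<alpha> k v = 0) \<longrightarrow> a i u v = 0) \<and>
    (\<forall>i\<in>{1..m}. \<forall>v. a i p v = \<alpha> i v) \<and>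
    (\<forall>u\<in>D. \<forall>v w. lie_deriv (\<lambda>u. \<Sum>i=1..m. a i u v *\<^sub>R r i u) (\<lambda>u. \<Sum>i=1..m. a i u w *\<^sub>R r i u) u
        = lie_deriv (\<lambda>u. \<Sum>i=1..m. a i u w *\<^sub>R r i u) (\<lambda>u. \<Sum>i=1..m. a i u v *\<^sub>R r i u) u)"
proof -
  note \<alpha>r = \<alpha>r[rule_format]
  define A where "A i = Blinfun (\<alpha> i)" for i
  have A: "blinfun_apply (A i) = \<alpha> i" for i
    unfolding A_def by (rule bounded_linear_Blinfun_apply) (use \<alpha> linear_conv_bounded_linear in blast)
  \<comment> \<open>\<open>id + K u\<close> carries each \<open>r j p\<close> to
    \<open>r j u\<close> and fixes the common kernel of the \<open>\<alpha> k\<close>; since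
    \<open>K p = 0\<close>, it is invertible near \<open>p\<close>, and its inverse brings
    \<open>v\<close> back to the splitting at \<open>p\<close>.\<close>
  define K where "K u = (\<Sum>i=1..m. blinfun_scaleR_left (r i u - r i p) o\<^sub>L A i)" for u
  define M where "M u = id_blinfun + K u" for u
  have K: "K u x = (\<Sum>i=1..m. \<alpha> i x *\<^sub>R (r i u - r i p))" for u x
    by (simp add: K_def blinfun.sum_left A)
  have M: "M u x = x + (\<Sum>i=1..m. \<alpha> i x *\<^sub>R (r i u - r i p))" for u x
    by (simp add: M_def blinfun.add_left K)
  have bl: "bounded_linear (\<lambda>c. blinfun_scaleR_left c o\<^sub>L A i)" for i
    by (rule bounded_linear_compose[OF bounded_bilinear.bounded_linear_left[OF bounded_bilinear_blinfun_compose]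
          bounded_linear_blinfun_scaleR_left])
  have Ks: "smooth_on \<Omega> K" unfolding K_def
    by (intro smooth_on_sum smooth_on_linear[OF bl] smooth_on_diff smooth_on_const r_smooth open_domain order_refl)
  have "isCont K p" using smooth_on_continuous[OF Ks] open_domain p continuous_on_eq_continuous_at by blast
  then obtain d where d: "d > 0" "\<And>u. dist u p < d \<Longrightarrow> dist (K u) (K p) < 1 / 2"
    unfolding continuous_at_eps_delta by (metis half_gt_zero zero_less_one)
  define D where "D = ball p d \<inter> \<Omega>"
  have D: "open D" "p \<in> D" "D \<subseteq> \<Omega>" using d open_domain p by (auto simp: D_def)
  have Kp: "K p = 0" by (rule blinfun_eqI) (simp add: K)
  define N where "N u = (SOME N. N o\<^sub>L M u = id_blinfun \<and> M u o\<^sub>L N = id_blinfun)" for u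
  have N: "N u o\<^sub>L M u = id_blinfun" "M u o\<^sub>L N u = id_blinfun" if "u \<in> D" for u
  proof -
    have "norm (- K u) \<le> 1 / 2" using d(2)[of u] that by (simp add: D_def dist_commute Kp)
    then have "\<exists>N. N o\<^sub>L M u = id_blinfun \<and> M u o\<^sub>L N = id_blinfun"
      using blinfun_neumann[of "- K u"] unfolding M_def by auto
    from someI_ex[OF this] show "N u o\<^sub>L M u = id_blinfun" "M u o\<^sub>L N u = id_blinfun" unfolding N_def by blast+
  qed
  have NM: "N u (M u x) = x" "M u (N u x) = x" if "u \<in> D" for u x
    using arg_cong[OF N(1)[OF that], of "\<lambda>f. blinfun_apply f x"] arg_cong[OF N(2)[OF that], of "\<lambda>f. blinfun_apply f x"] by auto
  have Ms: "smooth_on D M" unfolding M_def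
    by (intro smooth_on_add smooth_on_const D smooth_on_subset[OF Ks])
  have Ns: "smooth_on D N" by (rule smooth_on_blinfun_inverse[OF D(1) Ms N])
  define a where "a i u v = \<alpha> i (N u v)" for i u v
  have a_s: "smooth_on D (\<lambda>u. a i u v)" for i v
    unfolding a_def using smooth_on_linear[OF blinfun.bounded_linear_right[of "A i"] D(1)
        smooth_on_bilinear[OF bounded_bilinear_blinfun_apply D(1) Ns smooth_on_const]] by (simp add: A)
  have a_lin: "linear (a i u)" for i u
    unfolding a_def by (rule linearI) (simp_all add: blinfun.bilinear_simps linear_add[OF \<alpha>] linear_cmul[OF \<alpha>])
  have \<alpha>sum: "\<alpha> i (\<Sum>j=1..m. b j *\<^sub>R r j p) = b i" if "i \<in> {1..m}" for i b
    using dual_family_sum[of "\<alpha> i" "{1..m}" "\<lambda>j. r j p" i b] \<alpha> \<alpha>r[OF that] that by simp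
  have Mr: "M u (\<Sum>j=1..m. b j *\<^sub>R r j p) = (\<Sum>j=1..m. b j *\<^sub>R r j u)" for u b
  proof -
    have "(\<Sum>i=1..m. \<alpha> i (\<Sum>j=1..m. b j *\<^sub>R r j p) *\<^sub>R (r i u - r i p)) = (\<Sum>i=1..m. b i *\<^sub>R (r i u - r i p))"
      by (intro sum.cong refl) (simp only: \<alpha>sum)
    then show ?thesis unfolding M by (simp add: scaleR_diff_right sum_subtractf)
  qed
  have M0: "M u v = v" if "\<And>k. k \<in> {1..m} \<Longrightarrow> \<alpha> k v = 0" for u v
    unfolding M using that by simp
  have ar: "a i u (r j u) = (if j = i then 1 else 0)" if u: "u \<in> D" and ij: "i \<in> {1..m}" "j \<in> {1..m}" for i j u
  proof -
    have delta: "(\<Sum>k=1..m. (if k = j then 1 else 0) *\<^sub>R r k w) = r j w" for w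
      using sum.delta[of "{1..m}" j "\<lambda>k. r k w"] ij(2) by (simp add: if_distrib[of "\<lambda>c. c *\<^sub>R _"] cong: if_cong)
    have "M u (r j p) = r j u" using Mr[of u "\<lambda>k. if k = j then 1 else 0"] unfolding delta .
    then have "N u (r j u) = r j p" using NM(1)[OF u, of "r j p"] by simp
    then show ?thesis by (simp add: a_def \<alpha>r[OF ij])
  qed
  have a0: "a i u v = 0" if u: "u \<in> D" and i: "i \<in> {1..m}" and v: "\<And>k. k \<in> {1..m} \<Longrightarrow> \<alpha> k v = 0" for i u v
    using NM(1)[OF u, of v] M0[OF v] v[OF i] by (simp add: a_def)
  have ap: "a i p v = \<alpha> i v" if "i \<in> {1..m}" for i v
    using NM(1)[OF D(2), of v] by (simp add: a_def M)
  define P where "P v u = (\<Sum>i=1..m. a i u v *\<^sub>R r i u)" for v u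
  have P_fun: "P v = (\<lambda>u. \<Sum>i=1..m. a i u v *\<^sub>R r i u)" for v by (rule ext) (rule P_def)
  have Ps: "smooth_on D (P v)" for v
    unfolding P_def by (intro smooth_intros D a_s r_smooth)
  \<comment> \<open>\<open>v\<close> and \<open>P v u\<close> differ by an element of the common
    kernel. Hence \<open>\<alpha> i\<close> is constant along the field \<open>P v\<close> and
    annihilates all its derivatives, in particular the brackets.\<close>
  have \<alpha>P: "\<alpha> i (P v u) = \<alpha> i v" if u: "u \<in> D" and i: "i \<in> {1..m}" for i u v
  proof -
    define x where "x = N u v"
    have "v = x + (P v u - (\<Sum>j=1..m. \<alpha> j x *\<^sub>R r j p))"
      using NM(2)[OF u, of v] unfolding x_def[symmetric] M by (simp add: P_def a_def x_def scaleR_diff_right sum_subtractf)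
    then have "\<alpha> i v = \<alpha> i (x + (P v u - (\<Sum>j=1..m. \<alpha> j x *\<^sub>R r j p)))" by (rule arg_cong)
    also have "\<dots> = \<alpha> i x + (\<alpha> i (P v u) - \<alpha> i x)"
      by (simp only: linear_add[OF \<alpha>] linear_diff[OF \<alpha>] \<alpha>sum[OF i])
    finally have "\<alpha> i v = \<alpha> i x + (\<alpha> i (P v u) - \<alpha> i x)" .
    then show ?thesis by simp
  qed
  have \<alpha>D: "\<alpha> i (lie_deriv X (P v) u) = 0" if u: "u \<in> D" and i: "i \<in> {1..m}" for X i u v
  proof -
    have "((\<lambda>u. A i (P v u)) has_derivative (\<lambda>h. A i (frechet_derivative (P v) (at u) h))) (at u)"
      by (rule bounded_linear.has_derivative[OF blinfun.bounded_linear_right smooth_on_has_derivative[OF Ps u]])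
    moreover have "((\<lambda>u. A i (P v u)) has_derivative (\<lambda>h. 0)) (at u)"
      by (rule has_derivative_transform_within_open[OF has_derivative_const[of "\<alpha> i v"] D(1) u]) (simp add: A \<alpha>P[OF _ i])
    ultimately have "(\<lambda>h. A i (frechet_derivative (P v) (at u) h)) = (\<lambda>h. 0)" by (rule has_derivative_unique)
    from fun_cong[OF this, of "X u"] show ?thesis by (simp only: lie_deriv_def A)
  qed
  have comm: "lie_deriv (P v) (P w) u = lie_deriv (P w) (P v) u" if u: "u \<in> D" for u v w
  proof -
    \<comment> \<open>The zero functions always solve the system, which opens the bracket half of
      \<open>frame_combination_bracket\<close>.\<close>
    have "lambda_system D m r c \<Gamma> (\<lambda>_ _. 0)" by (simp add: lambda_system_def)
    from frame_combination_bracket[where a = a and v = v and w = w, OF D(1,3) u a_s smooth_on_const this, folded P_fun]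
    obtain \<mu> where \<mu>: "lie_bracket (P v) (P w) u = (\<Sum>k=1..m. \<mu> k *\<^sub>R r k u)" by blast
    define b where "b = lie_bracket (P v) (P w) u"
    have b0: "\<alpha> k b = 0" if "k \<in> {1..m}" for k
      unfolding b_def lie_bracket_def linear_diff[OF \<alpha>] using \<alpha>D[OF u that] by simp
    \<comment> \<open>\<open>N u\<close> fixes \<open>b\<close>, which lies in the kernel, and turns
      the combination of the \<open>r k u\<close> into the same combination of the
      \<open>r k p\<close>, on which the \<open>\<alpha> k\<close> read off \<mu>.\<close>
    have "b = (\<Sum>k=1..m. \<mu> k *\<^sub>R r k p)"
    proof -
      have "N u b = b" using NM(1)[OF u, of b] M0[OF b0] by simp
      moreover have "N u b = (\<Sum>k=1..m. \<mu> k *\<^sub>R r k p)"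
        using NM(1)[OF u, of "\<Sum>k=1..m. \<mu> k *\<^sub>R r k p"] unfolding Mr \<mu>[symmetric] b_def .
      ultimately show ?thesis by simp
    qed
    then have "\<mu> k = 0" if "k \<in> {1..m}" for k using \<alpha>sum[OF that, of \<mu>] b0[OF that] by simp
    then have "b = 0" using \<mu> unfolding b_def by simp
    then show ?thesis unfolding b_def lie_bracket_def by simp
  qed
  show ?thesis
    by (intro exI[of _ D] exI[of _ a] conjI ballI allI impI) (rule D a_s a_lin ar a0 ap comm[unfolded P_fun]; blast)+
qed


text \<open>Commutation of the lifts has two components: the first is commutation of the
  \<open>P v\<close>, the second combines symmetry of \<open>cov (P v) (T w)\<close> in
  \<open>v\<close> and \<open>w\<close> with the curvature identity.\<close>

lemma prolongation_integrable:
  fixes a :: "nat \<Rightarrow> real^'n \<Rightarrow> real^'n \<Rightarrow> real" and p z0 :: "real^'n"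
  assumes D: "open D" "D \<subseteq> \<Omega>" "p \<in> D"
    and a: "\<And>i v. smooth_on D (\<lambda>u. a i u v)" and a_lin: "\<And>i u. linear (a i u)"
    and lam: "\<forall>i\<in>{1..m}. smooth_on D (lam i)" and sys: "lambda_system D m r c \<Gamma> lam"
  defines "P \<equiv> \<lambda>v u. \<Sum>i=1..m. a i u v *\<^sub>R r i u" and "T \<equiv> \<lambda>v u. \<Sum>i=1..m. (a i u v * lam i u) *\<^sub>R r i u"
  assumes comm: "\<forall>u\<in>D. \<forall>v w. lie_deriv (P v) (P w) u = lie_deriv (P w) (P v) u"
  shows "\<exists>\<delta> \<Theta>. \<delta> > 0 \<and> smooth_on (ball 0 \<delta> \<times> ball (p, z0) \<delta>) \<Theta> \<and>
    (\<forall>v\<in>ball 0 \<delta>. \<forall>y\<in>ball (p, z0) \<delta>. fst (\<Theta> (v, y)) \<in> D) \<and>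
    (\<forall>y\<in>ball (p, z0) \<delta>. \<Theta> (0, y) = y) \<and>
    (\<forall>v\<in>ball 0 \<delta>. \<forall>y\<in>ball (p, z0) \<delta>. \<forall>e. frechet_derivative \<Theta> (at (v, y)) (e, 0) =
        (P e (fst (\<Theta> (v, y))), T e (fst (\<Theta> (v, y))) - B (fst (\<Theta> (v, y))) (P e (fst (\<Theta> (v, y)))) (snd (\<Theta> (v, y)))))"
proof -
  note lam = lam[rule_format] and comm = comm[rule_format]
  \<comment> \<open>If \<open>cov (P e) f = T e\<close>, then the graph of \<open>f\<close> moves
    with exactly this velocity when its base point moves along \<open>P e\<close>.\<close>
  define Q :: "(real^'n) \<times> (real^'n) \<Rightarrow> real^'n \<Rightarrow> (real^'n) \<times> (real^'n)" where
    "Q y e = (P e (fst y), T e (fst y) - B (fst y) (P e (fst y)) (snd y))" for y e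
  define S :: "((real^'n) \<times> (real^'n)) set" where "S = D \<times> UNIV"
  have S: "open S" "(p, z0) \<in> S" using D by (auto simp: S_def open_Times)
  note rs = r_smooth[OF _ D(2)]
  have Ps: "smooth_on D (P v)" for v unfolding P_def by (intro smooth_intros D a rs)
  have Ts: "smooth_on D (T v)" for v unfolding T_def by (intro smooth_intros D a rs lam)
  have Plin: "linear (\<lambda>v. P v u)" for u
    by (rule linearI) (simp_all add: P_def linear_add[OF a_lin] linear_cmul[OF a_lin] scaleR_left_distrib sum.distrib scaleR_sum_right)
  have Tlin: "linear (\<lambda>v. T v u)" for u
    by (rule linearI) (simp_all add: T_def linear_add[OF a_lin] linear_cmul[OF a_lin] distrib_right scaleR_left_distrib sum.distrib scaleR_sum_right mult.assoc)
  have Qlin: "linear (Q y)" for y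
    by (rule linearI) (simp_all add: Q_def linear_add[OF Plin] linear_cmul[OF Plin] linear_add[OF Tlin] linear_cmul[OF Tlin]
        blinfun.add_left blinfun.add_right blinfun.scaleR_left blinfun.scaleR_right scaleR_diff_right)
  have fs: "smooth_on S (\<lambda>y. g (fst y))" if "smooth_on D g" for g :: "real^'n \<Rightarrow> 'b::real_normed_vector"
    by (rule smooth_on_compose[OF S(1) that smooth_on_linear[OF bounded_linear_fst S(1) smooth_on_ident]]) (auto simp: S_def)
  have Qs: "smooth_on S (\<lambda>y. Q y e)" for e
    unfolding Q_def
    by (intro smooth_on_Pair smooth_on_diff smooth_on_bilinear[OF bounded_bilinear_blinfun_apply] S fs Ps Ts
        smooth_on_subset[OF B_smooth D(2)] smooth_on_linear[OF bounded_linear_snd S(1) smooth_on_ident])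
  have DQ: "frechet_derivative (\<lambda>y. Q y e) (at y) (h, k) =
      (frechet_derivative (P e) (at (fst y)) h, frechet_derivative (T e) (at (fst y)) h -
        (B (fst y) (P e (fst y)) k + (B (fst y) (frechet_derivative (P e) (at (fst y)) h) (snd y)
           + frechet_derivative B (at (fst y)) h (P e (fst y)) (snd y))))"
    if y: "y \<in> S" for y e h k
  proof -
    have u: "fst y \<in> D" using y by (auto simp: S_def)
    then have u': "fst y \<in> \<Omega>" using D(2) by blast
    have f: "((\<lambda>y. g (fst y)) has_derivative (\<lambda>h. frechet_derivative g (at (fst y)) (fst h))) (at y)"
      if "smooth_on D g" for g :: "real^'n \<Rightarrow> 'b::real_normed_vector"
      using diff_chain_at[OF has_derivative_fst[OF has_derivative_ident] smooth_on_has_derivative[OF that u]]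
      by (simp add: o_def)
    have "((\<lambda>y. B (fst y) (P e (fst y))) has_derivative (\<lambda>h. B (fst y) (frechet_derivative (P e) (at (fst y)) (fst h)) +
         frechet_derivative B (at (fst y)) (fst h) (P e (fst y)))) (at y)"
      by (rule bounded_bilinear.FDERIV[OF bounded_bilinear_blinfun_apply f[OF smooth_on_subset[OF B_smooth D(2)]] f[OF Ps]])
    from bounded_bilinear.FDERIV[OF bounded_bilinear_blinfun_apply this has_derivative_snd[OF has_derivative_ident]]
    have "((\<lambda>y. B (fst y) (P e (fst y)) (snd y)) has_derivative (\<lambda>h. B (fst y) (P e (fst y)) (snd h) +
       (B (fst y) (frechet_derivative (P e) (at (fst y)) (fst h)) (snd y) +
         frechet_derivative B (at (fst y)) (fst h) (P e (fst y)) (snd y)))) (at y)"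
      by (simp only: blinfun.add_left)
    from has_derivative_Pair[OF f[OF Ps] has_derivative_diff[OF f[OF Ts] this], of e e]
    have "((\<lambda>y. Q y e) has_derivative (\<lambda>h. (frechet_derivative (P e) (at (fst y)) (fst h), frechet_derivative (T e) (at (fst y)) (fst h) -
        (B (fst y) (P e (fst y)) (snd h) + (B (fst y) (frechet_derivative (P e) (at (fst y)) (fst h)) (snd y)
           + frechet_derivative B (at (fst y)) (fst h) (P e (fst y)) (snd y)))))) (at y)"
      unfolding Q_def .
    from fun_cong[OF frechet_derivative_at[OF this], of "(h, k)"] show ?thesis by simp
  qed
  \<comment> \<open>The coefficients \<mu> of the bracket vanish since the \<open>P v\<close>
    commute and the \<open>r k u\<close> are independent; multiplied by \<open>lam k\<close> they
    still vanish.\<close>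
  have covT: "cov (P v) (T w) u = cov (P w) (T v) u" if u: "u \<in> D" for u v w
  proof -
    have u': "u \<in> \<Omega>" using u D(2) by blast
    obtain \<xi> where "coframe_at u \<xi>" using coframe_at_exists[OF u'] by blast
    note \<xi> = coframe_atD[OF this]
    have P_fun: "P v = (\<lambda>u. \<Sum>i=1..m. a i u v *\<^sub>R r i u)" and T_fun: "T v = (\<lambda>u. \<Sum>i=1..m. (a i u v * lam i u) *\<^sub>R r i u)" for v
      by (simp_all add: P_def T_def)
    have "\<exists>\<mu>. lie_bracket (P v) (P w) u = (\<Sum>k=1..m. \<mu> k *\<^sub>R r k u) \<and>
        cov (P v) (T w) u - cov (P w) (T v) u = (\<Sum>k=1..m. (\<mu> k * lam k u) *\<^sub>R r k u)"
      by (rule frame_combination_bracket[where a = a and v = v and w = w, OF D(1,2) u a lam sys, folded P_fun T_fun])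
    then obtain \<mu> where \<mu>: "lie_bracket (P v) (P w) u = (\<Sum>k=1..m. \<mu> k *\<^sub>R r k u)"
        and t: "cov (P v) (T w) u - cov (P w) (T v) u = (\<Sum>k=1..m. (\<mu> k * lam k u) *\<^sub>R r k u)" by blast
    have \<mu>0: "(\<Sum>k=1..m. \<mu> k *\<^sub>R r k u) = 0" using comm[OF u, of v w] \<mu> by (simp add: lie_bracket_def)
    have "\<mu> k = 0" if "k \<in> {1..m}" for k
      using \<xi>(2)[of k \<mu>, unfolded \<mu>0] that m_le linear_0[OF \<xi>(1)] by simp
    then show ?thesis using t by simp
  qed
  have half: "frechet_derivative (\<lambda>y. Q y e) (at y) (Q y v) = (lie_deriv (P v) (P e) u,
      lie_deriv (P v) (T e) u - (B u (P e u) (T v u) - B u (P e u) (B u (P v u) z)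
        + (B u (lie_deriv (P v) (P e) u) z + frechet_derivative B (at u) (P v u) (P e u) z)))"
    if "y \<in> S" "u = fst y" "z = snd y" for y u z e v
    using DQ[OF that(1), of e "P v u" "T v u - B u (P v u) z"] that(2,3)
    by (simp add: Q_def[of y v] lie_deriv_def blinfun.diff_right)
  have Qcomm: "frechet_derivative (\<lambda>y. Q y e) (at y) (Q y v) = frechet_derivative (\<lambda>y. Q y v) (at y) (Q y e)"
    if y: "y \<in> S" for y e v
  proof -
    define u where "u = fst y"
    define z where "z = snd y"
    have u: "u \<in> D" using y by (auto simp: S_def u_def)
    then have u': "u \<in> \<Omega>" using D(2) by blast
    have 1: "lie_deriv (P v) (T e) u + B u (P v u) (T e u) = lie_deriv (P e) (T v) u + B u (P e u) (T v u)"
      using covT[OF u, of v e] by (simp only: cov_def)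
    have 2: "frechet_derivative B (at u) (P v u) (P e u) z + B u (P v u) (B u (P e u) z)
      = frechet_derivative B (at u) (P e u) (P v u) z + B u (P e u) (B u (P v u) z)"
      by (rule B_flat[OF u'])
    have rearr: "l1 + x1 = l2 + x2 \<Longrightarrow> f1 + b1 = f2 + b2 \<Longrightarrow>
        l1 - (x2 - b2 + (g + f1)) = l2 - (x1 - b1 + (g + f2))" for l1 x1 l2 x2 f1 b1 f2 b2 g :: "real^'n"
      by (simp add: algebra_simps)
    show ?thesis
      unfolding half[OF y u_def z_def] comm[OF u, of v e] by (simp only: rearr[OF 1 2])
  qed
  show ?thesis
  proof (rule frobenius_commuting[OF S Qlin Qs Qcomm])
    fix \<delta> :: real and \<Theta>
    assume \<Theta>: "\<delta> > 0" "smooth_on (ball 0 \<delta> \<times> ball (p, z0) \<delta>) \<Theta>"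
      "\<And>v y. v \<in> ball 0 \<delta> \<Longrightarrow> y \<in> ball (p, z0) \<delta> \<Longrightarrow> \<Theta> (v, y) \<in> S"
      "\<And>y. y \<in> ball (p, z0) \<delta> \<Longrightarrow> \<Theta> (0, y) = y"
      "\<And>v y e. v \<in> ball 0 \<delta> \<Longrightarrow> y \<in> ball (p, z0) \<delta> \<Longrightarrow>
        frechet_derivative \<Theta> (at (v, y)) (e, 0) = Q (\<Theta> (v, y)) e"
    have "fst (\<Theta> (v, y)) \<in> D" if "v \<in> ball 0 \<delta>" "y \<in> ball (p, z0) \<delta>" for v y
      using \<Theta>(3)[OF that] by (auto simp: S_def)
    then show ?thesis
      by (intro exI[of _ \<delta>] exI[of _ \<Theta>] conjI ballI allI) (rule \<Theta>(1,2,4) \<Theta>(5)[unfolded Q_def] | assumption)+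
  qed
qed

text \<open>\<open>L\<close> and \<open>M\<close> are the derivatives of the chart and of its
  inverse. The preimage of \<open>S\<close> under \<open>L\<close> has dimension
  \<open>n - m\<close>, lies in the tangent space and so meets the span of the \<open>r i p\<close>
  trivially; by dimension it is a complement. The \<open>\<alpha> i\<close> are the coordinates
  along the \<open>r i p\<close> that vanish on it.\<close>

lemma transverse_slice:
  assumes emb: "embedded_submanifold m \<Xi>" and tr: "transverse m r \<Xi>" and p: "p \<in> \<Xi>" and sub: "\<Xi> \<subseteq> \<Omega>"
  shows "\<exists>W (\<phi> :: 'n vfield) (\<psi> :: 'n vfield) S L M (\<alpha> :: nat \<Rightarrow> real^'n \<Rightarrow> real).
    open W \<and> p \<in> W \<and> open (\<phi> ` W) \<and> smooth_on W \<phi> \<and> smooth_on (\<phi> ` W) \<psi> \<and> (\<forall>x\<in>W. \<psi> (\<phi> x) = x) \<and>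
    subspace S \<and> \<phi> ` (\<Xi> \<inter> W) = \<phi> ` W \<inter> S \<and> linear L \<and> linear M \<and>
    (\<psi> has_derivative M) (at (\<phi> p)) \<and> (\<forall>x. M (L x) = x) \<and> (\<forall>x. L (M x) = x) \<and>
    (\<forall>i. linear (\<alpha> i)) \<and> (\<forall>i\<in>{1..m}. \<forall>j\<in>{1..m}. \<alpha> i (r j p) = (if j = i then 1 else 0)) \<and>
    (\<forall>x. (\<forall>i\<in>{1..m}. \<alpha> i x = 0) \<longleftrightarrow> L x \<in> S)"
proof -
  obtain W and \<phi> \<psi> :: "'n vfield" and S where W: "open W" "p \<in> W" "open (\<phi> ` W)" "smooth_on W \<phi>" "smooth_on (\<phi> ` W) \<psi>"
    and \<psi>\<phi>: "\<And>x. x \<in> W \<Longrightarrow> \<psi> (\<phi> x) = x" and S: "subspace S" "dim S + m = CARD('n)" and slice: "\<phi> ` (\<Xi> \<inter> W) = \<phi> ` W \<inter> S"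
    using emb p unfolding embedded_submanifold_def by meson
  define L where "L = frechet_derivative \<phi> (at p)"
  define M where "M = frechet_derivative \<psi> (at (\<phi> p))"
  have \<phi>': "(\<phi> has_derivative L) (at p)" unfolding L_def by (rule smooth_on_has_derivative[OF W(4,2)])
  have qW: "\<phi> p \<in> \<phi> ` W" using W(2) by blast
  have \<psi>': "(\<psi> has_derivative M) (at (\<phi> p))" unfolding M_def by (rule smooth_on_has_derivative[OF W(5) qW])
  have lin: "linear L" "linear M" using \<phi>' \<psi>' has_derivative_linear by auto
  have "((\<lambda>x. \<psi> (\<phi> x)) has_derivative (\<lambda>x. M (L x))) (at p)" using diff_chain_at[OF \<phi>' \<psi>'] by (simp add: o_def)
  moreover have "((\<lambda>x. \<psi> (\<phi> x)) has_derivative (\<lambda>x. x)) (at p)"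
    by (rule has_derivative_transform_within_open[OF has_derivative_ident W(1,2)]) (simp add: \<psi>\<phi>)
  ultimately have "(\<lambda>x. M (L x)) = (\<lambda>x. x)" by (rule has_derivative_unique)
  then have M_L: "M (L x) = x" for x by (rule fun_cong)
  have pp: "\<psi> (\<phi> p) = p" by (rule \<psi>\<phi>[OF W(2)])
  have \<phi>'2: "(\<phi> has_derivative L) (at (\<psi> (\<phi> p)))" using \<phi>' pp by simp
  have "((\<lambda>x. \<phi> (\<psi> x)) has_derivative (\<lambda>x. L (M x))) (at (\<phi> p))" using diff_chain_at[OF \<psi>' \<phi>'2] by (simp add: o_def)
  moreover have "((\<lambda>x. \<phi> (\<psi> x)) has_derivative (\<lambda>x. x)) (at (\<phi> p))"
    by (rule has_derivative_transform_within_open[OF has_derivative_ident W(3) qW]) (auto simp: \<psi>\<phi>)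
  ultimately have "(\<lambda>x. L (M x)) = (\<lambda>x. x)" by (rule has_derivative_unique)
  then have L_M: "L (M x) = x" for x by (rule fun_cong)
  have qS: "\<phi> p \<in> S" using slice W(2) p by blast
  \<comment> \<open>The inclusion into the tangent space is realised by the curves
    \<open>\<psi> (\<phi> p + t *\<^sub>R L x)\<close>, which stay in \<Xi> because the chart point
    stays in \<open>S\<close>.\<close>
  define T where "T = {x. L x \<in> S}"
  have T_tan: "T \<subseteq> tangent_space \<Xi> p"
  proof
    fix x assume "x \<in> T"
    then have xS: "L x \<in> S" by (simp add: T_def)
    have c: "continuous_on UNIV (\<lambda>t::real. \<phi> p + t *\<^sub>R L x)" by (intro continuous_intros)
    have "open ((\<lambda>t::real. \<phi> p + t *\<^sub>R L x) -` (\<phi> ` W))" by (rule open_vimage[OF W(3) c])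
    moreover have "0 \<in> (\<lambda>t::real. \<phi> p + t *\<^sub>R L x) -` (\<phi> ` W)" using qW by simp
    ultimately obtain \<epsilon> where \<epsilon>: "\<epsilon> > 0" "ball 0 \<epsilon> \<subseteq> (\<lambda>t::real. \<phi> p + t *\<^sub>R L x) -` (\<phi> ` W)"
      using open_contains_ball by blast
    have I: "{-\<epsilon><..<\<epsilon>} = ball 0 \<epsilon>" by (auto simp: ball_def dist_real_def)
    define \<gamma> where "\<gamma> t = \<psi> (\<phi> p + t *\<^sub>R L x)" for t :: real
    have "smooth_on {-\<epsilon><..<\<epsilon>} \<gamma>" unfolding \<gamma>_def
      by (rule smooth_on_compose[OF open_greaterThanLessThan W(5)])
        (use \<epsilon>(2) in \<open>auto intro!: smooth_on_add smooth_on_const smooth_on_linear[OF bounded_linear_scaleR_left] smooth_on_ident simp: I\<close>)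
    moreover have "\<gamma> ` {-\<epsilon><..<\<epsilon>} \<subseteq> \<Xi>"
    proof
      fix y assume "y \<in> \<gamma> ` {-\<epsilon><..<\<epsilon>}"
      then obtain t where t: "t \<in> ball 0 \<epsilon>" "y = \<gamma> t" unfolding I by blast
      have "\<phi> p + t *\<^sub>R L x \<in> \<phi> ` W" using \<epsilon>(2) t(1) by auto
      moreover have "\<phi> p + t *\<^sub>R L x \<in> S" by (rule subspace_add[OF S(1) qS subspace_scale[OF S(1) xS]])
      ultimately have "\<phi> p + t *\<^sub>R L x \<in> \<phi> ` W \<inter> S" ..
      then obtain w where "w \<in> \<Xi> \<inter> W" "\<phi> p + t *\<^sub>R L x = \<phi> w" unfolding slice[symmetric] by blast
      then show "y \<in> \<Xi>" using t(2) \<psi>\<phi>[of w] by (simp add: \<gamma>_def)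
    qed
    moreover have "\<gamma> 0 = p" by (simp add: \<gamma>_def pp)
    moreover have "(\<gamma> has_vector_derivative x) (at 0)"
    proof -
      have "((\<lambda>t::real. \<phi> p + t *\<^sub>R L x) has_vector_derivative L x) (at 0)"
        by (auto intro!: derivative_eq_intros simp: has_vector_derivative_def)
      moreover have "(\<psi> has_derivative M) (at (\<phi> p + 0 *\<^sub>R L x) within range (\<lambda>t::real. \<phi> p + t *\<^sub>R L x))"
        using has_derivative_at_withinI[OF \<psi>'] by simp
      ultimately show ?thesis
        using vector_derivative_diff_chain_within[of "\<lambda>t::real. \<phi> p + t *\<^sub>R L x" "L x" 0 UNIV \<psi> M]
        by (simp add: o_def \<gamma>_def[abs_def] M_L)
    qed
    ultimately show "x \<in> tangent_space \<Xi> p" using \<epsilon>(1) unfolding tangent_space_def by blast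
  qed
  define R where "R = (\<lambda>i. r i p) ` {1..m}"
  have p\<Omega>: "p \<in> \<Omega>" using p sub by blast
  have R: "inj_on (\<lambda>i. r i p) {1..m}" "independent R"
    using frame p\<Omega> unfolding partial_frame_def R_def by blast+
  have cR: "finite R" "card R = m" using card_image[OF R(1)] by (auto simp: R_def)
  have sT: "subspace T" unfolding T_def subspace_def
    using S(1) by (auto simp: linear_0[OF lin(1)] linear_add[OF lin(1)] linear_cmul[OF lin(1)] subspace_0 subspace_add subspace_scale)
  have TMS: "T = M ` S" unfolding T_def by (auto simp: L_M image_iff) (metis M_L)
  have "inj_on M (span S)" by (rule inj_onI) (metis L_M)
  then have dT: "dim T = dim S" unfolding TMS by (rule dim_image_eq[OF lin(2)])
  have RT: "span R \<inter> T = {0}"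
    using tr p T_tan subspace_0[OF sT] span_0[of R] unfolding transverse_def R_def by blast
  have "dim {x + y |x y. x \<in> span R \<and> y \<in> T} + dim (span R \<inter> T) = dim (span R) + dim T"
    by (rule dim_sums_Int[OF subspace_span sT])
  then have "dim {x + y |x y. x \<in> span R \<and> y \<in> T} = CARD('n)"
    using S(2) dim_eq_card_independent[OF R(2)] cR by (simp add: RT dT)
  then have "span {x + y |x y. x \<in> span R \<and> y \<in> T} = UNIV"
    by (subst dim_eq_full[symmetric]) simp
  moreover have "span {x + y |x y. x \<in> span R \<and> y \<in> T} = {x + y |x y. x \<in> span R \<and> y \<in> T}"
    by (rule span_eq_iff[THEN iffD2, OF subspace_sums[OF subspace_span sT]])
  ultimately have sums: "{x + y |x y. x \<in> span R \<and> y \<in> T} = UNIV" by simp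
  obtain BT where BT: "BT \<subseteq> T" "independent BT" "T \<subseteq> span BT" "card BT = dim T"
    using basis_exists[of T] by blast
  have fBT: "finite BT" using BT(2) independent_imp_finite by blast
  have "UNIV \<subseteq> span (R \<union> BT)"
  proof
    fix x :: "real^'n"
    have "x \<in> {x + y |x y. x \<in> span R \<and> y \<in> T}" using sums by simp
    then obtain u v where "x = u + v" "u \<in> span R" "v \<in> span BT" using BT(3) by blast
    then show "x \<in> span (R \<union> BT)" using span_mono[of R "R \<union> BT"] span_mono[of BT "R \<union> BT"] span_add by blast
  qed
  moreover have "card (R \<union> BT) \<le> CARD('n)" using card_Un_le[of R BT] cR BT(4) dT S(2) by simp
  ultimately have ind: "independent (R \<union> BT)"
    using card_le_dim_spanning[of "R \<union> BT" UNIV] cR fBT by simp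
  have rne: "r i p \<noteq> 0" if "i \<in> {1..m}" for i
    using R(2) dependent_zero that unfolding R_def by (metis imageI)
  have "\<exists>g :: real^'n \<Rightarrow> real. linear g \<and> (\<forall>x\<in>R \<union> BT. g x = (if x = r i p then 1 else 0))" for i
    by (rule linear_independent_extend[OF ind])
  then obtain \<alpha> :: "nat \<Rightarrow> real^'n \<Rightarrow> real" where \<alpha>: "\<And>i. linear (\<alpha> i)" "\<And>i x. x \<in> R \<union> BT \<Longrightarrow> \<alpha> i x = (if x = r i p then 1 else 0)"
    using choice[of "\<lambda>i g. linear g \<and> (\<forall>x\<in>R \<union> BT. g x = (if x = r i p then 1 else 0 :: real))"] by blast
  have \<alpha>r: "\<alpha> i (r j p) = (if j = i then 1 else 0)" if "i \<in> {1..m}" "j \<in> {1..m}" for i j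
    using \<alpha>(2)[of "r j p" i] that inj_onD[OF R(1), of j i] by (auto simp: R_def)
  have \<alpha>T: "\<alpha> i x = 0" if i: "i \<in> {1..m}" and x: "x \<in> T" for i x
  proof -
    have "\<alpha> i b = 0" if b: "b \<in> BT" for b
    proof -
      have "b \<noteq> r i p"
      proof
        assume "b = r i p"
        then have "r i p \<in> span R \<inter> T" using b BT(1) i by (auto simp: R_def intro: span_base)
        then show False using RT rne[OF i] by auto
      qed
      then show ?thesis using \<alpha>(2)[of b i] b by simp
    qed
    then show ?thesis using linear_eq_0_on_span[OF \<alpha>(1), of BT i x] x BT(3) by blast
  qed
  have iff: "(\<forall>i\<in>{1..m}. \<alpha> i x = 0) \<longleftrightarrow> L x \<in> S" for x
  proof
    assume 0: "\<forall>i\<in>{1..m}. \<alpha> i x = 0"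
    have "x \<in> {x + y |x y. x \<in> span R \<and> y \<in> T}" using sums by simp
    then obtain u v where x: "x = u + v" "u \<in> span R" "v \<in> T" by blast
    obtain b where "u = (\<Sum>w\<in>R. b w *\<^sub>R w)" using x(2) span_finite[OF cR(1)] by auto
    then have u: "u = (\<Sum>j=1..m. b (r j p) *\<^sub>R r j p)" 
      using sum.reindex[OF R(1), of "\<lambda>w. b w *\<^sub>R w"] by (simp add: R_def o_def)
    have "b (r i p) = 0" if "i \<in> {1..m}" for i
      using dual_family_sum[of "\<alpha> i" "{1..m}" "\<lambda>j. r j p" i "\<lambda>j. b (r j p)"] \<alpha>(1) \<alpha>r[OF that] that 0[rule_format, OF that] \<alpha>T[OF that x(3)]
      by (simp add: x(1) u linear_add[OF \<alpha>(1)])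
    then have "u = 0" unfolding u by simp
    then show "L x \<in> S" using x by (simp add: T_def)
  qed (use \<alpha>T in \<open>auto simp: T_def\<close>)
  show ?thesis
    by (rule exI[of _ W], rule exI[of _ \<phi>], rule exI[of _ \<psi>], rule exI[of _ S], rule exI[of _ L], rule exI[of _ M], rule exI[of _ \<alpha>])
      (use W \<psi>\<phi> S slice lin \<psi>' M_L L_M \<alpha> \<alpha>r iff in simp)
qed


section \<open>The initial value problem near one point\<close>

text \<open>The set \<open>G\<close> is a parameter because uniqueness on \<open>U\<close> does not
  pass to smaller open sets: leaf segments towards \<Xi> could leave them. Arbitrarily small
  neighbourhoods with uniqueness must be constructed.\<close>

theorem local_initial_value_problem:
  fixes h :: "'n vfield"
  assumes lam: "\<forall>i\<in>{1..m}. smooth_on \<Omega> (lam i)" and sys: "lambda_system \<Omega> m r c \<Gamma> lam"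
    and emb: "embedded_submanifold m \<Xi>" and sub: "\<Xi> \<subseteq> \<Omega>" and tr: "transverse m r \<Xi>"
    and h: "smooth_along \<Xi> h" and p: "p \<in> \<Xi>" and G: "open G" "p \<in> G"
  shows "\<exists>U f. open U \<and> p \<in> U \<and> U \<subseteq> G \<and> U \<subseteq> \<Omega> \<and> smooth_on U f \<and> f_system U cov m r lam f \<and>
    (\<forall>u\<in>\<Xi> \<inter> U. f u = h u) \<and>
    (\<forall>f1 f2. smooth_on U f1 \<longrightarrow> smooth_on U f2 \<longrightarrow> f_system U cov m r lam f1 \<longrightarrow> f_system U cov m r lam f2 \<longrightarrow>
      (\<forall>u\<in>\<Xi> \<inter> U. f1 u = f2 u) \<longrightarrow> (\<forall>u\<in>U. f1 u = f2 u))"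
proof -
  have p\<Omega>: "p \<in> \<Omega>" using p sub by blast
  obtain W and \<phi> \<psi> :: "'n vfield" and S L M and \<alpha> :: "nat \<Rightarrow> real^'n \<Rightarrow> real"
    where W: "open W" "p \<in> W" "open (\<phi> ` W)" and \<phi>: "smooth_on W \<phi>" and \<psi>: "smooth_on (\<phi> ` W) \<psi>"
      and \<psi>\<phi>: "\<forall>x\<in>W. \<psi> (\<phi> x) = x" and S: "subspace S" and slice: "\<phi> ` (\<Xi> \<inter> W) = \<phi> ` W \<inter> S"
      and L: "linear L" and M: "linear M" and \<psi>': "(\<psi> has_derivative M) (at (\<phi> p))"
      and M_L: "\<forall>x. M (L x) = x" and L_M: "\<forall>x. L (M x) = x"
      and \<alpha>_lin: "\<forall>i. linear (\<alpha> i)"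
      and \<alpha>r: "\<forall>i\<in>{1..m}. \<forall>j\<in>{1..m}. \<alpha> i (r j p) = (if j = i then 1 else 0)"
      and \<alpha>S: "\<forall>x. (\<forall>i\<in>{1..m}. \<alpha> i x = 0) \<longleftrightarrow> L x \<in> S"
    using transverse_slice[OF emb tr p sub] by (elim exE conjE)
  note \<alpha>_lin = \<alpha>_lin[rule_format]
  obtain WH and H :: "'n vfield" where WH: "open WH" "p \<in> WH" and H: "smooth_on WH H" and Hh: "\<forall>u\<in>\<Xi> \<inter> WH. H u = h u"
    using h[unfolded smooth_along_def, rule_format, OF p] by (elim exE conjE)
  from local_projection[OF p\<Omega> \<alpha>_lin \<alpha>r]
  obtain D a where D: "open D" "p \<in> D" "D \<subseteq> \<Omega>" and a: "\<forall>i v. smooth_on D (\<lambda>u. a i u v)" and a_lin: "\<forall>i u. linear (a i u)"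
    and ar: "\<forall>u\<in>D. \<forall>i\<in>{1..m}. \<forall>j\<in>{1..m}. a i u (r j u) = (if j = i then 1 else (0::real))"
    and a0: "\<forall>u\<in>D. \<forall>i\<in>{1..m}. \<forall>v. (\<forall>k\<in>{1..m}. \<alpha> k v = 0) \<longrightarrow> a i u v = 0"
    and ap: "\<forall>i\<in>{1..m}. \<forall>v. a i p v = \<alpha> i v"
    and comm: "\<forall>u\<in>D. \<forall>v w. lie_deriv (\<lambda>u. \<Sum>i=1..m. a i u v *\<^sub>R r i u) (\<lambda>u. \<Sum>i=1..m. a i u w *\<^sub>R r i u) u
        = lie_deriv (\<lambda>u. \<Sum>i=1..m. a i u w *\<^sub>R r i u) (\<lambda>u. \<Sum>i=1..m. a i u v *\<^sub>R r i u) u"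
    by (elim exE conjE)
  note a = a[rule_format] and a_lin = a_lin[rule_format]
  define P where "P v u = (\<Sum>i=1..m. a i u v *\<^sub>R r i u)" for v u
  define T where "T v u = (\<Sum>i=1..m. (a i u v * lam i u) *\<^sub>R r i u)" for v u
  have lamD: "\<forall>i\<in>{1..m}. smooth_on D (lam i)" using lam smooth_on_subset D(3) by blast
  have sysD: "lambda_system D m r c \<Gamma> lam"
    using sys unfolding lambda_system_iff_compat[OF order_refl] lambda_system_iff_compat[OF D(3)] using D(3) by blast
  from prolongation_integrable[where a = a and ?z0.0 = "H p", OF D(1,3,2) a a_lin lamD sysD comm, folded P_def T_def]
  obtain \<delta> \<Theta> where \<delta>: "\<delta> > 0" and \<Theta>: "smooth_on (ball 0 \<delta> \<times> ball (p, H p) \<delta>) \<Theta>"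
    and \<Theta>D: "\<forall>v\<in>ball 0 \<delta>. \<forall>y\<in>ball (p, H p) \<delta>. fst (\<Theta> (v, y)) \<in> D"
    and \<Theta>0: "\<forall>y\<in>ball (p, H p) \<delta>. \<Theta> (0, y) = y"
    and \<Theta>': "\<forall>v\<in>ball 0 \<delta>. \<forall>y\<in>ball (p, H p) \<delta>. \<forall>e. frechet_derivative \<Theta> (at (v, y)) (e, 0) =
        (P e (fst (\<Theta> (v, y))), T e (fst (\<Theta> (v, y))) - B (fst (\<Theta> (v, y))) (P e (fst (\<Theta> (v, y)))) (snd (\<Theta> (v, y))))"
    by (elim exE conjE)

  \<comment> \<open>\<pi> projects onto the span of the \<open>r i p\<close> along the kernel of the
    \<open>\<alpha> i\<close>, and \<rho> is the complementary projection; one space then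
    parametrises both leaf directions and points of \<Xi>.\<close>
  define \<pi> where "\<pi> x = (\<Sum>i=1..m. \<alpha> i x *\<^sub>R r i p)" for x
  define \<rho> where "\<rho> x = x - \<pi> x" for x
  have \<pi>_lin: "linear \<pi>"
    by (rule linearI) (simp_all add: \<pi>_def linear_add[OF \<alpha>_lin] linear_cmul[OF \<alpha>_lin] scaleR_left_distrib sum.distrib scaleR_sum_right)
  have \<rho>_lin: "linear \<rho>"
    by (rule linearI) (simp_all add: \<rho>_def linear_add[OF \<pi>_lin] linear_cmul[OF \<pi>_lin] scaleR_diff_right)
  have \<pi>_bl: "bounded_linear \<pi>" and \<rho>_bl: "bounded_linear \<rho>" and L_bl: "bounded_linear L" and M_bl: "bounded_linear M"
    using \<pi>_lin \<rho>_lin L M by (simp_all add: linear_conv_bounded_linear)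
  have \<alpha>\<pi>: "\<alpha> i (\<pi> x) = \<alpha> i x" if "i \<in> {1..m}" for i x
    unfolding \<pi>_def
    using dual_family_sum[of "\<alpha> i" "{1..m}" "\<lambda>j. r j p" i "\<lambda>i. \<alpha> i x"] \<alpha>_lin \<alpha>r that by simp
  have \<pi>\<pi>: "\<pi> (\<pi> x) = \<pi> x" for x unfolding \<pi>_def[of "\<pi> x"] \<pi>_def[of x] using \<alpha>\<pi>[of _ x] by (simp add: \<pi>_def)
  have \<rho>\<pi>: "\<rho> (\<pi> x) = 0" for x by (simp add: \<rho>_def \<pi>\<pi>)
  have \<pi>\<rho>: "\<pi> (\<rho> x) = 0" for x by (simp add: \<rho>_def linear_diff[OF \<pi>_lin] \<pi>\<pi>)
  have \<alpha>\<rho>: "\<alpha> i (\<rho> x) = 0" if "i \<in> {1..m}" for i x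
    by (simp add: \<rho>_def linear_diff[OF \<alpha>_lin] \<alpha>\<pi>[OF that])
  have \<rho>S: "L (\<rho> x) \<in> S" for x using \<alpha>S \<alpha>\<rho> by blast
  have S\<pi>: "\<pi> x = 0" if "L x \<in> S" for x
  proof -
    have "\<forall>i\<in>{1..m}. \<alpha> i x = 0" using \<alpha>S that by blast
    then show ?thesis unfolding \<pi>_def by simp
  qed
  have \<rho>\<rho>: "\<rho> (\<rho> x) = \<rho> x" for x unfolding \<rho>_def[of "\<rho> x"] by (simp add: \<pi>\<rho>)

  define q where "q = \<phi> p"
  have qS: "q \<in> S" using slice W(2) p unfolding q_def by blast
  have qW: "q \<in> \<phi> ` W" using W(2) unfolding q_def by blast
  have \<psi>q: "\<psi> q = p" using \<psi>\<phi> W(2) unfolding q_def by blast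
  \<comment> \<open>\<open>\<phi> p + L (\<rho> x)\<close> stays in \<open>S\<close>, so applying
    \<psi> gives a parametrisation of \<Xi> near \<open>p\<close> by the \<rho>-part of
    \<open>x\<close>.\<close>
  define \<kappa> where "\<kappa> x = q + L (\<rho> x)" for x
  have \<kappa>_s: "smooth_on V \<kappa>" if "open V" for V
    unfolding \<kappa>_def by (intro smooth_on_add smooth_on_const smooth_on_linear[OF L_bl] smooth_on_linear[OF \<rho>_bl] smooth_on_ident that)
  define V1 where "V1 = \<kappa> -` (\<phi> ` W)"
  have V1: "open V1" unfolding V1_def
    by (rule open_vimage[OF W(3) smooth_on_continuous[OF \<kappa>_s[OF open_UNIV]]])
  define \<sigma> where "\<sigma> x = \<psi> (\<kappa> x)" for x
  have \<sigma>_s: "smooth_on V1 \<sigma>" unfolding \<sigma>_def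
    by (rule smooth_on_compose[OF V1 \<psi> \<kappa>_s[OF V1]]) (auto simp: V1_def)
  have \<sigma>\<Xi>: "\<sigma> x \<in> \<Xi>" if "x \<in> V1" for x
  proof -
    have "\<kappa> x \<in> \<phi> ` W" using that by (simp add: V1_def)
    moreover have "\<kappa> x \<in> S" unfolding \<kappa>_def by (rule subspace_add[OF S qS \<rho>S])
    ultimately have "\<kappa> x \<in> \<phi> ` (\<Xi> \<inter> W)" unfolding slice by blast
    then obtain w where "w \<in> \<Xi> \<inter> W" "\<kappa> x = \<phi> w" by blast
    then show ?thesis using \<psi>\<phi> by (simp add: \<sigma>_def)
  qed
  have \<kappa>0: "\<kappa> 0 = q" by (simp add: \<kappa>_def linear_0[OF \<rho>_lin] linear_0[OF L])
  have \<sigma>0: "\<sigma> 0 = p" by (simp add: \<sigma>_def \<kappa>0 \<psi>q)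
  \<comment> \<open>Successive restrictions: \<open>\<sigma> x\<close> must lie where the extension
    \<open>H\<close> of the data is defined, then the initial pair in the ball around
    \<open>(p, H p)\<close>, then \<open>\<pi> x\<close> in the ball of admissible
    directions.\<close>
  define V2 where "V2 = V1 \<inter> \<sigma> -` WH"
  have V2: "open V2" unfolding V2_def by (rule continuous_open_preimage[OF smooth_on_continuous[OF \<sigma>_s] V1 WH(1)])
  define k where "k x = (\<sigma> x, H (\<sigma> x))" for x
  have \<sigma>_s2: "smooth_on V2 \<sigma>" by (rule smooth_on_subset[OF \<sigma>_s]) (simp add: V2_def)
  have k_s: "smooth_on V2 k" unfolding k_def
    by (intro smooth_on_Pair V2 \<sigma>_s2 smooth_on_compose[OF V2 H \<sigma>_s2]) (auto simp: V2_def)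
  define V3 where "V3 = V2 \<inter> k -` ball (p, H p) \<delta>"
  have V3: "open V3" unfolding V3_def by (rule continuous_open_preimage[OF smooth_on_continuous[OF k_s] V2 open_ball])
  define V0 where "V0 = V3 \<inter> \<pi> -` ball 0 \<delta>"
  have V0: "open V0" unfolding V0_def
    by (rule continuous_open_preimage[OF linear_continuous_on[OF \<pi>_bl] V3 open_ball])
  have V0_V: "V0 \<subseteq> V1" "V0 \<subseteq> V2" "V0 \<subseteq> V3" by (auto simp: V0_def V3_def V2_def)
  have zV0: "0 \<in> V0"
    using qW WH(2) \<delta> by (simp add: V0_def V3_def V2_def V1_def \<kappa>0 \<sigma>0 k_def linear_0[OF \<pi>_lin])
  define j where "j x = (\<pi> x, k x)" for x
  have k_s0: "smooth_on V0 k" by (rule smooth_on_subset[OF k_s V0_V(2)])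
  have j_s: "smooth_on V0 j" unfolding j_def
    by (intro smooth_on_Pair V0 smooth_on_linear[OF \<pi>_bl] smooth_on_ident k_s0)
  have j_in: "\<pi> x \<in> ball 0 \<delta>" "k x \<in> ball (p, H p) \<delta>" if "x \<in> V0" for x
    using that by (auto simp: V0_def V3_def)
  have j_im: "j ` V0 \<subseteq> ball 0 \<delta> \<times> ball (p, H p) \<delta>" using j_in by (auto simp: j_def)
  define F where "F x = \<Theta> (j x)" for x
  have F_s: "smooth_on V0 F" unfolding F_def by (rule smooth_on_compose[OF V0 \<Theta> j_s j_im])
  \<comment> \<open>Leaf coordinates: \<open>\<rho> x\<close> selects the point \<open>\<sigma> x\<close> of \<open>\<Xi>\<close>, then the leaf through it is followed in direction \<open>\<pi> x\<close>.\<close>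
  define \<Psi> where "\<Psi> x = fst (F x)" for x
  define f0 where "f0 x = snd (F x)" for x
  have \<Psi>_s: "smooth_on V0 \<Psi>" unfolding \<Psi>_def by (rule smooth_on_linear[OF bounded_linear_fst V0 F_s])
  have f0_s: "smooth_on V0 f0" unfolding f0_def by (rule smooth_on_linear[OF bounded_linear_snd V0 F_s])
  have \<Psi>D: "\<Psi> x \<in> D" if "x \<in> V0" for x using \<Theta>D j_in[OF that] by (simp add: \<Psi>_def F_def j_def)
  have F_slice: "F x = k x" if "x \<in> V0" "\<pi> x = 0" for x using \<Theta>0 j_in(2)[OF that(1)] that(2) by (simp add: F_def j_def)

  have \<kappa>_der: "(\<kappa> has_derivative (\<lambda>e. L (\<rho> e))) (at x)" for x
    using has_derivative_add[OF has_derivative_const bounded_linear_imp_has_derivative[OF bounded_linear_compose[OF L_bl \<rho>_bl]]]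
    unfolding \<kappa>_def[abs_def] by simp
  have \<sigma>_der: "(\<sigma> has_derivative (\<lambda>e. frechet_derivative \<psi> (at (\<kappa> x)) (L (\<rho> e)))) (at x)" if "x \<in> V1" for x
  proof -
    have "(\<psi> has_derivative frechet_derivative \<psi> (at (\<kappa> x))) (at (\<kappa> x))"
      by (rule smooth_on_has_derivative[OF \<psi>]) (use that in \<open>simp add: V1_def\<close>)
    from diff_chain_at[OF \<kappa>_der this] show ?thesis by (simp add: \<sigma>_def[abs_def] o_def)
  qed
  \<comment> \<open>The starting point depends on \<open>x\<close> only through
    \<open>\<rho> x\<close>, so in directions killed by \<rho> only the leaf parameter
    moves.\<close>
  have k_der: "frechet_derivative k (at x) e = 0" if x: "x \<in> V2" and e: "\<rho> e = 0" for x e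
  proof -
    have x1: "x \<in> V1" and xH: "\<sigma> x \<in> WH" using x by (auto simp: V2_def)
    have lin: "linear (frechet_derivative \<psi> (at (\<kappa> x)))" "linear (frechet_derivative H (at (\<sigma> x)))"
      using x1 xH by (auto intro!: linear_frechet_derivative smooth_on_differentiable[OF \<psi>] smooth_on_differentiable[OF H] simp: V1_def)
    have "((\<lambda>x. H (\<sigma> x)) has_derivative (\<lambda>e. frechet_derivative H (at (\<sigma> x)) (frechet_derivative \<psi> (at (\<kappa> x)) (L (\<rho> e))))) (at x)"
      using diff_chain_at[OF \<sigma>_der[OF x1] smooth_on_has_derivative[OF H xH]] by (simp add: o_def)
    from frechet_derivative_at[OF has_derivative_Pair[OF \<sigma>_der[OF x1] this]]
    have "frechet_derivative k (at x) = (\<lambda>e. (frechet_derivative \<psi> (at (\<kappa> x)) (L (\<rho> e)),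
        frechet_derivative H (at (\<sigma> x)) (frechet_derivative \<psi> (at (\<kappa> x)) (L (\<rho> e)))))"
      unfolding k_def[abs_def] by simp
    then show ?thesis by (simp add: e linear_0[OF L] linear_0[OF lin(1)] linear_0[OF lin(2)] zero_prod_def)
  qed
  have F_der: "frechet_derivative F (at x) e = (P e (\<Psi> x), T e (\<Psi> x) - B (\<Psi> x) (P e (\<Psi> x)) (f0 x))"
    if x: "x \<in> V0" and e: "\<rho> e = 0" for x e
  proof -
    have x2: "x \<in> V2" using x V0_V(2) by blast
    have \<pi>e: "\<pi> e = e" using e by (simp add: \<rho>_def)
    have "(j has_derivative (\<lambda>e. (\<pi> e, frechet_derivative k (at x) e))) (at x)"
      unfolding j_def[abs_def]
      by (rule has_derivative_Pair[OF bounded_linear_imp_has_derivative[OF \<pi>_bl] smooth_on_has_derivative[OF k_s x2]])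
    moreover have "(\<Theta> has_derivative frechet_derivative \<Theta> (at (j x))) (at (j x))"
      by (rule smooth_on_has_derivative[OF \<Theta>]) (use j_im x in blast)
    ultimately have "(\<Theta> \<circ> j has_derivative (frechet_derivative \<Theta> (at (j x)) \<circ> (\<lambda>e. (\<pi> e, frechet_derivative k (at x) e)))) (at x)"
      by (rule diff_chain_at)
    then have "(F has_derivative (\<lambda>e. frechet_derivative \<Theta> (at (j x)) (\<pi> e, frechet_derivative k (at x) e))) (at x)"
      by (simp add: F_def[abs_def] o_def)
    from fun_cong[OF frechet_derivative_at[OF this], of e]
    have "frechet_derivative F (at x) e = frechet_derivative \<Theta> (at (\<pi> x, k x)) (e, 0)"
      by (simp add: \<pi>e k_der[OF x2 e] j_def)
    also have "\<dots> = (P e (\<Psi> x), T e (\<Psi> x) - B (\<Psi> x) (P e (\<Psi> x)) (f0 x))"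
      using \<Theta>'[rule_format, OF j_in[OF x], of e] by (simp only: \<Psi>_def f0_def F_def j_def)
    finally show ?thesis .
  qed
  have \<Psi>_fd: "frechet_derivative \<Psi> (at x) e = fst (frechet_derivative F (at x) e)"
    and f0_fd: "frechet_derivative f0 (at x) e = snd (frechet_derivative F (at x) e)" if "x \<in> V0" for x e
    using fun_cong[OF frechet_derivative_at[OF has_derivative_fst[OF smooth_on_has_derivative[OF F_s that]]], of e]
      fun_cong[OF frechet_derivative_at[OF has_derivative_snd[OF smooth_on_has_derivative[OF F_s that]]], of e]
    unfolding \<Psi>_def[abs_def] f0_def[abs_def] by simp_all
  have \<Psi>0: "\<Psi> 0 = p"
    using F_slice[OF zV0 linear_0[OF \<pi>_lin]] by (simp add: \<Psi>_def k_def \<sigma>0)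
  \<comment> \<open>On the range of \<pi> the derivative is the projection at \<open>p\<close>,
    hence the identity there; on the range of \<rho> the map equals \<sigma>, whose derivative at 0
    is \<open>M (L (\<rho> e)) = \<rho> e\<close>.\<close>
  have \<Psi>_id: "frechet_derivative \<Psi> (at 0) e = e" for e
  proof -
    have l: "linear (frechet_derivative \<Psi> (at 0))"
      by (rule linear_frechet_derivative[OF smooth_on_differentiable[OF \<Psi>_s zV0]])
    have 1: "frechet_derivative \<Psi> (at 0) (\<pi> e) = \<pi> e"
    proof -
      have "frechet_derivative \<Psi> (at 0) (\<pi> e) = P (\<pi> e) p"
        by (simp add: \<Psi>_fd[OF zV0] F_der[OF zV0 \<rho>\<pi>] \<Psi>0)
      also have "\<dots> = (\<Sum>i=1..m. \<alpha> i e *\<^sub>R r i p)"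
        unfolding P_def by (intro sum.cong refl) (use ap \<alpha>\<pi> in simp)
      finally show ?thesis by (simp add: \<pi>_def)
    qed
    have 2: "frechet_derivative \<Psi> (at 0) (\<rho> e) = \<rho> e"
    proof -
      define V where "V = (\<lambda>t::real. t *\<^sub>R \<rho> e) -` V0"
      have V: "open V" "0 \<in> V"
        unfolding V_def by (rule open_vimage[OF V0]) (auto intro!: continuous_intros simp: zV0)
      have line: "((\<lambda>t::real. t *\<^sub>R \<rho> e) has_derivative (\<lambda>t. t *\<^sub>R \<rho> e)) (at 0)"
        by (auto intro!: derivative_eq_intros)
      have a1: "((\<lambda>t. \<Psi> (t *\<^sub>R \<rho> e)) has_derivative (\<lambda>t. frechet_derivative \<Psi> (at 0) (t *\<^sub>R \<rho> e))) (at 0)"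
      proof -
        have "(\<Psi> has_derivative frechet_derivative \<Psi> (at 0)) (at (0 *\<^sub>R \<rho> e))"
          using smooth_on_has_derivative[OF \<Psi>_s zV0] by simp
        from diff_chain_at[OF line this] show ?thesis by (simp add: o_def)
      qed
      have "((\<lambda>t. \<sigma> (t *\<^sub>R \<rho> e)) has_derivative (\<lambda>t. M (L (\<rho> (t *\<^sub>R \<rho> e))))) (at 0)"
      proof -
        have "frechet_derivative \<psi> (at (\<kappa> 0)) = M" using frechet_derivative_at[OF \<psi>'] by (simp add: \<kappa>0 q_def)
        then have "(\<sigma> has_derivative (\<lambda>e. M (L (\<rho> e)))) (at (0 *\<^sub>R \<rho> e))"
          using \<sigma>_der[of 0] zV0 V0_V(1) by auto
        from diff_chain_at[OF line this] show ?thesis by (simp add: o_def)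
      qed
      then have "((\<lambda>t. \<Psi> (t *\<^sub>R \<rho> e)) has_derivative (\<lambda>t. M (L (\<rho> (t *\<^sub>R \<rho> e))))) (at 0)"
      proof (rule has_derivative_transform_within_open[OF _ V])
        fix t :: real assume "t \<in> V"
        then have "t *\<^sub>R \<rho> e \<in> V0" by (simp add: V_def)
        moreover have "\<pi> (t *\<^sub>R \<rho> e) = 0" by (simp add: linear_cmul[OF \<pi>_lin] \<pi>\<rho>)
        ultimately show "\<sigma> (t *\<^sub>R \<rho> e) = \<Psi> (t *\<^sub>R \<rho> e)" using F_slice by (simp add: \<Psi>_def k_def)
      qed
      from fun_cong[OF has_derivative_unique[OF a1 this], of 1] show ?thesis
        using M_L by (simp add: \<rho>\<rho>)
    qed
    have "frechet_derivative \<Psi> (at 0) e = frechet_derivative \<Psi> (at 0) (\<pi> e + \<rho> e)" by (simp add: \<rho>_def)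
    also have "\<dots> = e" unfolding linear_add[OF l] 1 2 by (simp add: \<rho>_def)
    finally show ?thesis .
  qed
  obtain U' V g where U': "open U'" "U' \<subseteq> V0" "0 \<in> U'" and V: "open V" "\<Psi> 0 \<in> V"
    and hom: "homeomorphism U' V \<Psi> g" and g_s: "smooth_on V g"
    by (rule smooth_inverse_function[OF V0 \<Psi>_s zV0 \<Psi>_id])
  have g\<Psi>: "g (\<Psi> x) = x" if "x \<in> U'" for x using hom that by (simp add: homeomorphism_def)
  have \<Psi>g: "\<Psi> (g y) = y" "g y \<in> U'" if "y \<in> V" for y using hom that by (auto simp: homeomorphism_def)
  have \<Psi>V: "\<Psi> x \<in> V" if "x \<in> U'" for x using hom that by (auto simp: homeomorphism_def)
  \<comment> \<open>Neighbourhoods of product shape: with \<open>x\<close> they contain the whole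
    segment from \<open>\<rho> x\<close> to \<open>x\<close>, whose image under \<Psi> joins \<Xi>
    to \<open>\<Psi> x\<close> within the leaf.\<close>
  define tube where "tube d = {x. norm (\<pi> x) < d \<and> norm (\<rho> x) < d}" for d
  have tube_open: "open (tube d)" for d
  proof -
    have "tube d = \<pi> -` ball 0 d \<inter> \<rho> -` ball 0 d" by (auto simp: tube_def)
    then show ?thesis
      using open_vimage[OF open_ball linear_continuous_on[OF \<pi>_bl], of 0 d] open_vimage[OF open_ball linear_continuous_on[OF \<rho>_bl], of 0 d]
      by (simp add: open_Int)
  qed
  have tube_zero: "0 \<in> tube d" if "d > 0" for d using that by (simp add: tube_def linear_0[OF \<pi>_lin] linear_0[OF \<rho>_lin])
  have tube_base: "\<exists>d>0. tube d \<subseteq> N" if N: "open N" "0 \<in> N" for N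
  proof -
    obtain e where e: "e > 0" "ball 0 e \<subseteq> N" using N open_contains_ball by blast
    have "tube (e / 2) \<subseteq> ball 0 e"
    proof
      fix x assume "x \<in> tube (e / 2)"
      then have "norm (\<pi> x) + norm (\<rho> x) < e" by (simp add: tube_def)
      moreover have "norm x \<le> norm (\<pi> x) + norm (\<rho> x)" using norm_triangle_ineq[of "\<pi> x" "\<rho> x"] by (simp add: \<rho>_def)
      ultimately show "x \<in> ball 0 e" by simp
    qed
    then show ?thesis using e by (intro exI[of _ "e / 2"]) auto
  qed
  obtain d1 where d1: "d1 > 0" "tube d1 \<subseteq> U'" using tube_base[OF U'(1,3)] by blast
  \<comment> \<open>For \<open>u\<close> in \<Xi> the vector \<open>M (\<phi> u - q)\<close> is a
    preimage of \<open>u\<close> under \<Psi>. Keeping it in \<open>U'\<close>, where \<Psi> is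
    injective, identifies it with \<open>g u\<close>, so the data are attained on all of \<Xi> in
    the neighbourhood.\<close>
  define N where "N = W \<inter> (\<lambda>u. M (\<phi> u - q)) -` ball 0 d1"
  have N: "open N" unfolding N_def
    by (rule continuous_open_preimage[OF smooth_on_continuous[OF smooth_on_linear[OF M_bl W(1) smooth_on_diff[OF W(1) \<phi> smooth_on_const]]] W(1) open_ball])
  have pN: "p \<in> N" using W(2) d1(1) by (simp add: N_def q_def[symmetric] linear_0[OF M])
  define N' where "N' = N \<inter> G \<inter> D \<inter> WH"
  have N': "open N'" "p \<in> N'" using N pN G D(1,2) WH by (auto simp: N'_def)
  have "open (U' \<inter> \<Psi> -` N')"
    by (rule continuous_open_preimage[OF continuous_on_subset[OF smooth_on_continuous[OF \<Psi>_s] U'(2)] U'(1) N'(1)])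
  moreover have "0 \<in> U' \<inter> \<Psi> -` N'" using U'(3) N'(2) \<Psi>0 by simp
  ultimately obtain d2 where d2: "d2 > 0" "tube d2 \<subseteq> U' \<inter> \<Psi> -` N'" using tube_base by blast
  have tubeU: "tube d2 \<subseteq> U'" and tubeV0: "tube d2 \<subseteq> V0" using d2(2) U'(2) by blast+
  define U where "U = V \<inter> g -` tube d2"
  have U: "open U" unfolding U_def by (rule continuous_open_preimage[OF smooth_on_continuous[OF g_s] V(1) tube_open])
  have UV: "U \<subseteq> V" by (auto simp: U_def)
  have \<Psi>U: "\<Psi> x \<in> U" if "x \<in> tube d2" for x
  proof -
    have "x \<in> U'" using that tubeU by blast
    then show ?thesis using that by (simp add: U_def \<Psi>V g\<Psi>)
  qed
  have gU: "g u \<in> tube d2" "\<Psi> (g u) = u" if "u \<in> U" for u using that \<Psi>g by (auto simp: U_def)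
  have UN: "u \<in> N'" if "u \<in> U" for u
  proof -
    have "g u \<in> \<Psi> -` N'" using gU(1)[OF that] d2(2) by blast
    then show ?thesis using gU(2)[OF that] by simp
  qed
  have pU: "p \<in> U" using \<Psi>U[OF tube_zero[OF d2(1)]] \<Psi>0 by simp
  have U\<Omega>: "U \<subseteq> \<Omega>" using UN D(3) by (auto simp: N'_def)
  define f where "f u = f0 (g u)" for u
  have f_s: "smooth_on U f"
    unfolding f_def
    by (rule smooth_on_compose[OF U f0_s smooth_on_subset[OF g_s UV]]) (use gU tubeV0 in blast)
  have \<Psi>_der: "frechet_derivative \<Psi> (at x) e = P e (\<Psi> x)"
    and f0_der: "frechet_derivative f0 (at x) e = T e (\<Psi> x) - B (\<Psi> x) (P e (\<Psi> x)) (f0 x)"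
    if "x \<in> V0" "\<rho> e = 0" for x e
    using that by (simp_all add: \<Psi>_fd f0_fd F_der)
  have f_sys: "f_system U cov m r lam f"
    unfolding f_system_def
  proof (intro ballI)
    fix i u assume i: "i \<in> {1..m}" and u: "u \<in> U"
    define x where "x = g u"
    \<comment> \<open>The projection at \<open>u\<close> ignores the \<rho>-part of
      \<open>r i u\<close>, hence \<open>P e u = r i u\<close> although \<open>e\<close> lies in the
      span of the frame at \<open>p\<close>.\<close>
    define e where "e = \<pi> (r i u)"
    have x: "x \<in> tube d2" "\<Psi> x = u" using gU[OF u] by (auto simp: x_def)
    have xV0: "x \<in> V0" using x(1) tubeV0 by blast
    have uD: "u \<in> D" using UN[OF u] by (simp add: N'_def)
    have \<rho>e: "\<rho> e = 0" by (simp add: e_def \<rho>\<pi>)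
    have ae: "a l u e = (if i = l then 1 else 0)" if l: "l \<in> {1..m}" for l
    proof -
      have "a l u (\<rho> (r i u)) = 0" using a0 uD l \<alpha>\<rho> by blast
      moreover have "a l u (r i u) = a l u e + a l u (\<rho> (r i u))"
        unfolding linear_add[OF a_lin, symmetric] e_def by (simp add: \<rho>_def)
      ultimately show ?thesis using ar uD l i by simp
    qed
    have delta: "(\<Sum>l=1..m. (if i = l then y l else 0) *\<^sub>R r l u) = y i *\<^sub>R r i u" for y
      using sum.delta[of "{1..m}" i "\<lambda>l. y l *\<^sub>R r l u"] i by (simp add: if_distrib[of "\<lambda>c. c *\<^sub>R _"] cong: if_cong)
    have Pe: "P e u = r i u"
    proof -
      have "P e u = (\<Sum>l=1..m. (if i = l then 1 else 0) *\<^sub>R r l u)" unfolding P_def by (intro sum.cong refl) (simp add: ae)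
      then show ?thesis unfolding delta by simp
    qed
    have Te: "T e u = lam i u *\<^sub>R r i u"
    proof -
      have "T e u = (\<Sum>l=1..m. (if i = l then lam l u else 0) *\<^sub>R r l u)" unfolding T_def by (intro sum.cong refl) (simp add: ae)
      then show ?thesis unfolding delta .
    qed
    have "((\<lambda>x. f (\<Psi> x)) has_derivative (\<lambda>e. frechet_derivative f (at u) (frechet_derivative \<Psi> (at x) e))) (at x)"
    proof -
      have "(f has_derivative frechet_derivative f (at u)) (at (\<Psi> x))"
        using smooth_on_has_derivative[OF f_s u] x(2) by simp
      from diff_chain_at[OF smooth_on_has_derivative[OF \<Psi>_s xV0] this] show ?thesis by (simp add: o_def)
    qed
    moreover have "((\<lambda>x. f (\<Psi> x)) has_derivative frechet_derivative f0 (at x)) (at x)"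
    proof (rule has_derivative_transform_within_open[OF smooth_on_has_derivative[OF f0_s xV0] tube_open x(1)])
      show "f0 y = f (\<Psi> y)" if "y \<in> tube d2" for y
      proof -
        have "y \<in> U'" using that tubeU by blast
        then show ?thesis by (simp add: f_def g\<Psi>)
      qed
    qed
    ultimately have "(\<lambda>e. frechet_derivative f (at u) (frechet_derivative \<Psi> (at x) e)) = frechet_derivative f0 (at x)"
      by (rule has_derivative_unique)
    from fun_cong[OF this, of e] have "frechet_derivative f (at u) (r i u) = lam i u *\<^sub>R r i u - B u (r i u) (f0 x)"
      unfolding \<Psi>_der[OF xV0 \<rho>e] f0_der[OF xV0 \<rho>e] x(2) Pe Te .
    then show "cov (r i) f u = lam i u *\<^sub>R r i u"
      by (simp add: cov_def lie_deriv_def f_def x_def)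
  qed
  have f_init: "f u = h u" if u: "u \<in> \<Xi> \<inter> U" for u
  proof -
    have uW: "u \<in> W" and uN: "norm (M (\<phi> u - q)) < d1" and uH: "u \<in> WH" using UN[of u] u by (auto simp: N'_def N_def)
    \<comment> \<open>Since \<open>\<phi> u\<close> and \<open>q\<close> lie in \<open>S\<close>,
      the vector \<open>x\<close> has no \<pi>-part, so \<Psi> follows no leaf and returns the point
      \<open>\<sigma> x = u\<close>.\<close>
    define x where "x = M (\<phi> u - q)"
    have "\<phi> u \<in> S" using slice u uW by blast
    then have "L x \<in> S" unfolding x_def using L_M subspace_diff[OF S _ qS] by simp
    then have \<pi>x: "\<pi> x = 0" by (rule S\<pi>)
    then have \<rho>x: "\<rho> x = x" by (simp add: \<rho>_def)
    have "x \<in> tube d1" using uN d1(1) by (simp add: tube_def \<pi>x \<rho>x x_def[symmetric])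
    then have xU: "x \<in> U'" using d1(2) by blast
    then have xV0: "x \<in> V0" using U'(2) by blast
    have "\<kappa> x = \<phi> u" using L_M by (simp add: \<kappa>_def \<rho>x) (simp add: x_def)
    then have \<sigma>x: "\<sigma> x = u" using \<psi>\<phi> uW by (simp add: \<sigma>_def)
    have Fx: "F x = (u, H u)" using F_slice[OF xV0 \<pi>x] by (simp add: k_def \<sigma>x)
    then have "g u = x" using g\<Psi>[OF xU] by (simp add: \<Psi>_def)
    then have "f u = H u" using Fx by (simp add: f_def f0_def)
    then show ?thesis using Hh u uH by simp
  qed
  have unique: "f1 u = f2 u" if s: "smooth_on U f1" "smooth_on U f2"
    and e: "f_system U cov m r lam f1" "f_system U cov m r lam f2" and i: "\<forall>u\<in>\<Xi> \<inter> U. f1 u = f2 u" and u: "u \<in> U" for f1 f2 u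
  proof -
    define x where "x = g u"
    have x: "x \<in> tube d2" "\<Psi> x = u" using gU[OF u] by (auto simp: x_def)
    \<comment> \<open>Along the image of this segment both solutions obey the same linear equation
      with derivative prescribed by \<open>P v\<close>, and at time 0 they agree because the curve
      starts on \<Xi>.\<close>
    define w where "w t = \<rho> x + t *\<^sub>R \<pi> x" for t :: real
    have w_tube: "w t \<in> tube d2" if t: "t \<in> {0..1}" for t
    proof -
      have "\<pi> (w t) = t *\<^sub>R \<pi> x" "\<rho> (w t) = \<rho> x"
        by (simp_all add: w_def linear_add[OF \<pi>_lin] linear_add[OF \<rho>_lin] linear_cmul[OF \<pi>_lin] linear_cmul[OF \<rho>_lin] \<pi>\<rho> \<pi>\<pi> \<rho>\<pi> \<rho>\<rho>)
      moreover have "norm (t *\<^sub>R \<pi> x) \<le> norm (\<pi> x)" using t by (simp add: mult_left_le_one_le)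
      ultimately show ?thesis using x(1) by (auto simp: tube_def)
    qed
    define \<gamma> where "\<gamma> t = \<Psi> (w t)" for t
    define v where "v = \<pi> x"
    have \<gamma>U: "\<gamma> t \<in> U" if "t \<in> {0..1}" for t unfolding \<gamma>_def by (rule \<Psi>U[OF w_tube[OF that]])
    have wV0: "w t \<in> V0" if "t \<in> {0..1}" for t using w_tube[OF that] tubeV0 by blast
    have \<gamma>': "(\<gamma> has_vector_derivative P v (\<gamma> t)) (at t within {0..1})" if t: "t \<in> {0..1}" for t
    proof -
      have "(w has_vector_derivative v) (at t within {0..1})"
        unfolding w_def[abs_def] v_def by (auto intro!: derivative_eq_intros simp: has_vector_derivative_def)
      from vector_derivative_diff_chain_within[OF this has_derivative_at_withinI[OF smooth_on_has_derivative[OF \<Psi>_s wV0[OF t]]]]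
      show ?thesis by (simp add: o_def \<gamma>_def[abs_def] \<Psi>_der[OF wV0[OF t]] v_def \<rho>\<pi>)
    qed
    have cov_fi: "frechet_derivative f' (at w) (P v w) = T v w - B w (P v w) (f' w)"
      if "smooth_on U f'" "f_system U cov m r lam f'" "w \<in> U" for f' w
    proof -
      have "cov (P v) f' w = (\<Sum>i=1..m. a i w v *\<^sub>R cov (r i) f' w)"
        by (rule cov_linear_left[where I = "{1..m}" and a = "\<lambda>i. a i w v" and Z = r, OF that(1,3)]) (simp add: P_def)
      also have "\<dots> = T v w" unfolding T_def using that(2,3) by (intro sum.cong refl) (simp add: f_system_def)
      finally show ?thesis by (simp add: cov_def lie_deriv_def eq_diff_eq)
    qed
    have \<gamma>c: "continuous_on {0..1} \<gamma>"
      using \<gamma>' unfolding continuous_on_eq_continuous_within by (blast intro: has_vector_derivative_continuous)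
    have Pv: "smooth_on U (P v)" unfolding P_def
      by (intro smooth_intros U smooth_on_subset[OF a] r_smooth) (use UN U\<Omega> in \<open>auto simp: N'_def\<close>)
    have "continuous_on U (\<lambda>w. B w (P v w))"
      by (rule smooth_on_continuous[OF smooth_on_bilinear[OF bounded_bilinear_blinfun_apply U smooth_on_subset[OF B_smooth U\<Omega>] Pv]])
    then have "continuous_on {0..1} (\<lambda>t. B (\<gamma> t) (P v (\<gamma> t)))"
      by (rule continuous_on_compose2[OF _ \<gamma>c]) (use \<gamma>U in auto)
    then have "bounded ((\<lambda>t. B (\<gamma> t) (P v (\<gamma> t))) ` {0..1})"
      by (intro compact_imp_bounded compact_continuous_image compact_Icc)
    then obtain C where "\<forall>y\<in>(\<lambda>t. B (\<gamma> t) (P v (\<gamma> t))) ` {0..1}. norm y \<le> C" unfolding bounded_iff by blast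
    then have C: "norm (B (\<gamma> t) (P v (\<gamma> t))) \<le> C" if "t \<in> {0..1}" for t using that by blast
    have "f1 (\<gamma> 1) - f2 (\<gamma> 1) = 0"
    proof (rule linear_ode_zero[where \<tau> = 1 and L = C and w = "\<lambda>t. f1 (\<gamma> t) - f2 (\<gamma> t)"
          and w' = "\<lambda>t. - B (\<gamma> t) (P v (\<gamma> t)) (f1 (\<gamma> t) - f2 (\<gamma> t))"])
      fix t :: real assume t: "t \<in> {0..1}"
      have d: "((\<lambda>t. f' (\<gamma> t)) has_vector_derivative T v (\<gamma> t) - B (\<gamma> t) (P v (\<gamma> t)) (f' (\<gamma> t))) (at t within {0..1})"
        if f': "smooth_on U f'" "f_system U cov m r lam f'" for f'
        using vector_derivative_diff_chain_within[OF \<gamma>'[OF t] has_derivative_at_withinI[OF smooth_on_has_derivative[OF f'(1) \<gamma>U[OF t]]]]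
        by (simp add: o_def cov_fi[OF f' \<gamma>U[OF t]])
      show "((\<lambda>t. f1 (\<gamma> t) - f2 (\<gamma> t)) has_vector_derivative - B (\<gamma> t) (P v (\<gamma> t)) (f1 (\<gamma> t) - f2 (\<gamma> t))) (at t within {0..1})"
        using has_vector_derivative_diff[OF d[OF s(1) e(1)] d[OF s(2) e(2)]] by (simp add: blinfun.diff_right)
      show "norm (- B (\<gamma> t) (P v (\<gamma> t)) (f1 (\<gamma> t) - f2 (\<gamma> t))) \<le> C * norm (f1 (\<gamma> t) - f2 (\<gamma> t))"
        unfolding norm_minus_cancel by (rule order_trans[OF norm_blinfun mult_right_mono[OF C[OF t] norm_ge_zero]])
    next
      have w0: "w 0 \<in> V0" using wV0[of 0] by simp
      have "\<pi> (w 0) = 0" by (simp add: w_def \<pi>\<rho>)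
      then have "\<gamma> 0 = \<sigma> (w 0)" using F_slice[OF w0] by (simp add: \<gamma>_def \<Psi>_def k_def)
      then have "\<gamma> 0 \<in> \<Xi> \<inter> U" using \<sigma>\<Xi>[of "w 0"] w0 V0_V(1) \<gamma>U[of 0] by auto
      then show "f1 (\<gamma> 0) - f2 (\<gamma> 0) = 0" using i by simp
    qed simp
    moreover have "\<gamma> 1 = u" by (simp add: \<gamma>_def w_def \<rho>_def x(2))
    ultimately show ?thesis by simp
  qed
  have "U \<subseteq> G" using UN by (auto simp: N'_def)
  then show ?thesis using U pU U\<Omega> f_s f_sys f_init unique
    by (intro exI[of _ U] exI[of _ f] conjI) blast+
qed


section \<open>Gluing the local solutions\<close>

lemma f_system_subset: "f_system U nabla' m r lam f \<Longrightarrow> V \<subseteq> U \<Longrightarrow> f_system V nabla' m r lam f"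
  unfolding f_system_def by blast

lemma f_system_cov_cong:
  assumes "open U" "smooth_on U f" "\<And>u. u \<in> U \<Longrightarrow> f u = g u" "f_system U cov m r lam f"
  shows "f_system U cov m r lam g"
  using assms(4) cov_cong[OF assms(1) _ assms(2,3)] unfolding f_system_def by simp

text \<open>Local solutions agree on \<Xi>, but their domains may meet away from it. Each gets a
  large domain \<open>W p\<close> of existence and a much smaller domain \<open>V p\<close> of
  uniqueness, so that an overlap can be treated inside one uniqueness domain.\<close>

theorem initial_value_problem:
  fixes h :: "'n vfield"
  assumes lam: "\<forall>i\<in>{1..m}. smooth_on \<Omega> (lam i)" and sys: "lambda_system \<Omega> m r c \<Gamma> lam"
    and emb: "embedded_submanifold m \<Xi>" and sub: "\<Xi> \<subseteq> \<Omega>" and tr: "transverse m r \<Xi>"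
    and h: "smooth_along \<Xi> h"
  obtains \<Omega>' f where "open \<Omega>'" "\<Xi> \<subseteq> \<Omega>'" "\<Omega>' \<subseteq> \<Omega>" "solves_initial_value_problem \<Omega>' cov m r lam \<Xi> h f"
    "\<And>g u. solves_initial_value_problem \<Omega>' cov m r lam \<Xi> h g \<Longrightarrow> u \<in> \<Omega>' \<Longrightarrow> g u = f u"
proof -
  define sol where "sol U f \<longleftrightarrow> smooth_on U f \<and> f_system U cov m r lam f" for U and f :: "'n vfield"
  define uniq where "uniq U \<longleftrightarrow> (\<forall>f1 f2 :: 'n vfield. sol U f1 \<longrightarrow> sol U f2 \<longrightarrow> (\<forall>u\<in>\<Xi> \<inter> U. f1 u = f2 u) \<longrightarrow> (\<forall>u\<in>U. f1 u = f2 u))" for U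
  have sol_subset: "sol V f" if "sol U f" "V \<subseteq> U" for U V f
    using that smooth_on_subset f_system_subset unfolding sol_def by blast
  have loc: "\<exists>U f. open U \<and> p \<in> U \<and> U \<subseteq> G \<and> U \<subseteq> \<Omega> \<and> sol U f \<and> (\<forall>u\<in>\<Xi> \<inter> U. f u = h u) \<and> uniq U"
    if pG: "p \<in> \<Xi>" "open G" "p \<in> G" for p G
  proof -
    obtain U f where U: "open U" "p \<in> U" "U \<subseteq> G" "U \<subseteq> \<Omega>" and f: "smooth_on U f" "f_system U cov m r lam f"
      and init: "\<forall>u\<in>\<Xi> \<inter> U. f u = h u"
      and unique: "\<forall>f1 f2. smooth_on U f1 \<longrightarrow> smooth_on U f2 \<longrightarrow> f_system U cov m r lam f1 \<longrightarrow> f_system U cov m r lam f2 \<longrightarrow>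
        (\<forall>u\<in>\<Xi> \<inter> U. f1 u = f2 u) \<longrightarrow> (\<forall>u\<in>U. f1 u = f2 u)"
      using local_initial_value_problem[OF lam sys emb sub tr h pG] by (elim exE conjE)
    have "uniq U" unfolding uniq_def sol_def
      by (intro allI impI ballI, elim conjE) (rule unique[rule_format], assumption+, erule (1) bspec, assumption)
    moreover have "sol U f" unfolding sol_def by (intro conjI f)
    ultimately show ?thesis by (intro exI[of _ U] exI[of _ f] conjI U init)
  qed
  define good where "good p U f \<longleftrightarrow> open U \<and> p \<in> U \<and> sol U f \<and> (\<forall>u\<in>\<Xi> \<inter> U. f u = h u)" for p U f
  have "\<forall>p\<in>\<Xi>. \<exists>U. \<exists>f. good p U f"
  proof
    fix p assume "p \<in> \<Xi>"
    from loc[OF this open_UNIV UNIV_I] show "\<exists>U. \<exists>f. good p U f" unfolding good_def by (elim exE conjE) (intro exI conjI)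
  qed
  from bchoice[OF this] obtain W where "\<forall>p\<in>\<Xi>. \<exists>f. good p (W p) f" ..
  from bchoice[OF this] obtain F where good: "\<forall>p\<in>\<Xi>. good p (W p) (F p)" ..
  have W: "open (W p)" "p \<in> W p" and F: "sol (W p) (F p)" "\<forall>u\<in>\<Xi> \<inter> W p. F p u = h u" if "p \<in> \<Xi>" for p
    using good[rule_format, OF that] unfolding good_def by simp_all
  \<comment> \<open>Radius three: if balls around \<open>p\<close> and \<open>q\<close> meet and the
    radius at \<open>q\<close> is the smaller one, every point of the second ball is within one
    radius at \<open>p\<close> plus two at \<open>q\<close>, hence within
    \<open>3 * \<epsilon> p\<close> of \<open>p\<close>.\<close>
  have "\<forall>p\<in>\<Xi>. \<exists>e. e > 0 \<and> ball p (3 * e) \<subseteq> W p"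
  proof
    fix p assume p: "p \<in> \<Xi>"
    obtain e where "e > 0" "ball p e \<subseteq> W p" using W(1,2)[OF p] open_contains_ball by blast
    then show "\<exists>e. e > 0 \<and> ball p (3 * e) \<subseteq> W p" by (intro exI[of _ "e / 3"]) auto
  qed
  from bchoice[OF this] obtain \<epsilon> where "\<forall>p\<in>\<Xi>. \<epsilon> p > 0 \<and> ball p (3 * \<epsilon> p) \<subseteq> W p" ..
  then have \<epsilon>: "\<epsilon> p > 0" "ball p (3 * \<epsilon> p) \<subseteq> W p" if "p \<in> \<Xi>" for p using that by blast+
  \<comment> \<open>The local result is applied a second time, inside the ball, to obtain a
    neighbourhood that itself has the uniqueness property.\<close>
  have "\<forall>p\<in>\<Xi>. \<exists>U. open U \<and> p \<in> U \<and> U \<subseteq> ball p (\<epsilon> p) \<and> U \<subseteq> \<Omega> \<and> uniq U"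
  proof
    fix p assume p: "p \<in> \<Xi>"
    from loc[OF p open_ball centre_in_ball[THEN iffD2, OF \<epsilon>(1)[OF p]]]
    show "\<exists>U. open U \<and> p \<in> U \<and> U \<subseteq> ball p (\<epsilon> p) \<and> U \<subseteq> \<Omega> \<and> uniq U"
      by (elim exE conjE) (intro exI conjI)
  qed
  from bchoice[OF this] obtain V where
    "\<forall>p\<in>\<Xi>. open (V p) \<and> p \<in> V p \<and> V p \<subseteq> ball p (\<epsilon> p) \<and> V p \<subseteq> \<Omega> \<and> uniq (V p)" ..
  then have V: "open (V p)" "p \<in> V p" "V p \<subseteq> ball p (\<epsilon> p)" "V p \<subseteq> \<Omega>" "uniq (V p)" if "p \<in> \<Xi>" for p
    using that by simp_all
  \<comment> \<open>Of two overlapping patches the one of smaller radius lies in the domain of the solution around the centre of the other.\<close>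
  have F_eq: "F p x = F q x" if pq: "p \<in> \<Xi>" "q \<in> \<Xi>" "x \<in> V p" "x \<in> V q" "\<epsilon> q \<le> \<epsilon> p" for p q x
  proof -
    have 1: "V q \<subseteq> W p"
    proof
      fix y assume y: "y \<in> V q"
      have "dist p x < \<epsilon> p" "dist q x < \<epsilon> q" "dist q y < \<epsilon> q"
        using V(3)[OF pq(1)] V(3)[OF pq(2)] pq(3,4) y by auto
      moreover have "dist p y \<le> dist p x + (dist q x + dist q y)"
        using dist_triangle[of p y x] dist_triangle[of x y q] by (simp add: dist_commute)
      ultimately have "y \<in> ball p (3 * \<epsilon> p)" using pq(5) by simp
      then show "y \<in> W p" using \<epsilon>(2)[OF pq(1)] by blast
    qed
    have "ball q (\<epsilon> q) \<subseteq> ball q (3 * \<epsilon> q)" using \<epsilon>(1)[OF pq(2)] by (intro subset_ball) simp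
    then have 2: "V q \<subseteq> W q" using V(3)[OF pq(2)] \<epsilon>(2)[OF pq(2)] by blast
    have "\<forall>u\<in>\<Xi> \<inter> V q. F p u = F q u" 
    proof
      fix u assume "u \<in> \<Xi> \<inter> V q"
      then have "u \<in> \<Xi> \<inter> W p" "u \<in> \<Xi> \<inter> W q" using 1 2 by blast+
      then show "F p u = F q u" using F(2)[OF pq(1)] F(2)[OF pq(2)] by simp
    qed
    then show ?thesis
      using V(5)[OF pq(2), unfolded uniq_def, rule_format, OF sol_subset[OF F(1)[OF pq(1)] 1] sol_subset[OF F(1)[OF pq(2)] 2] _ pq(4)]
      by blast
  qed
  define \<Omega>' where "\<Omega>' = (\<Union>p\<in>\<Xi>. V p)"
  \<comment> \<open>Any patch containing \<open>x\<close> may be chosen, since \<open>F_eq\<close>,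
    used in one order of the radii or the other, makes the values agree.\<close>
  define f where "f x = F (SOME p. p \<in> \<Xi> \<and> x \<in> V p) x" for x
  have f: "f x = F p x" if p: "p \<in> \<Xi>" "x \<in> V p" for p x
  proof -
    define q where "q = (SOME p. p \<in> \<Xi> \<and> x \<in> V p)"
    have "q \<in> \<Xi> \<and> x \<in> V q" unfolding q_def by (rule someI[of _ p]) (use p in simp)
    then show ?thesis
      using F_eq[of p q x] F_eq[of q p x] p unfolding f_def q_def[symmetric] by (cases "\<epsilon> q \<le> \<epsilon> p") auto
  qed
  have VW: "V p \<subseteq> W p" if p: "p \<in> \<Xi>" for p
  proof -
    have "ball p (\<epsilon> p) \<subseteq> ball p (3 * \<epsilon> p)" using \<epsilon>(1)[OF p] by (intro subset_ball) simp
    then show ?thesis using V(3)[OF p] \<epsilon>(2)[OF p] by blast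
  qed
  have FV: "sol (V p) (F p)" if "p \<in> \<Xi>" for p by (rule sol_subset[OF F(1)[OF that] VW[OF that]])
  have fV: "sol (V p) f" if p: "p \<in> \<Xi>" for p
  proof -
    note FV = FV[OF p, unfolded sol_def]
    have eq: "F p u = f u" if "u \<in> V p" for u using f[OF p that] by simp
    show ?thesis unfolding sol_def
      using smooth_on_cong[OF V(1)[OF p] eq conjunct1[OF FV]] f_system_cov_cong[OF V(1)[OF p] conjunct1[OF FV] eq conjunct2[OF FV]]
      by blast
  qed
  have f_init: "f u = h u" if "u \<in> \<Xi>" for u
    using f[OF that V(2)[OF that]] F(2)[OF that] W(2)[OF that] that by simp
  have "smooth_on \<Omega>' f"
  proof (rule smooth_on_local)
    fix x assume "x \<in> \<Omega>'"
    then obtain p where p: "p \<in> \<Xi>" "x \<in> V p" by (auto simp: \<Omega>'_def)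
    then show "\<exists>T. open T \<and> x \<in> T \<and> smooth_on T f" using V(1)[OF p(1)] fV[OF p(1)] unfolding sol_def by blast
  qed
  moreover have "f_system \<Omega>' cov m r lam f"
    using fV unfolding sol_def f_system_def \<Omega>'_def by blast
  ultimately have sol': "solves_initial_value_problem \<Omega>' cov m r lam \<Xi> h f"
    unfolding solves_initial_value_problem_def using f_init by blast
  show ?thesis
  proof (rule that[OF _ _ _ sol'])
    show "open \<Omega>'" using V(1) by (auto simp: \<Omega>'_def)
    show "\<Xi> \<subseteq> \<Omega>'" using V(2) by (auto simp: \<Omega>'_def)
    show "\<Omega>' \<subseteq> \<Omega>" using V(4) by (auto simp: \<Omega>'_def)
    fix g u assume g: "solves_initial_value_problem \<Omega>' cov m r lam \<Xi> h g" and "u \<in> \<Omega>'"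
    then obtain p where p: "p \<in> \<Xi>" "u \<in> V p" by (auto simp: \<Omega>'_def)
    have "V p \<subseteq> \<Omega>'" using p(1) by (auto simp: \<Omega>'_def)
    moreover have "sol \<Omega>' g" using g unfolding sol_def solves_initial_value_problem_def by blast
    ultimately have gV: "sol (V p) g" using sol_subset by blast
    have "\<forall>u\<in>\<Xi> \<inter> V p. g u = f u" using g f_init unfolding solves_initial_value_problem_def by simp
    then show "g u = f u" using V(5)[OF p(1), unfolded uniq_def, rule_format, OF gV fV[OF p(1)] _ p(2)] by blast
  qed
qed

end

section \<open>Transfer to the given connection\<close>

lemma flat_christoffel_christoffel_map:
  assumes "open \<Omega>" "connection_on \<Omega> nabla" "symmetric_connection_on \<Omega> nabla" "flat_connection_on \<Omega> nabla"
  shows "flat_christoffel \<Omega> (christoffel_map nabla)"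
  using smooth_on_christoffel_map[OF assms(2,1)] christoffel_map_symmetric[OF assms(2,1,3)]
    christoffel_map_flat[OF assms(2,1,4)] assms(1)
  by unfold_locales

theorem proposition5p1:
  fixes \<Omega> :: "(real^'n::finite) set"
    and nabla :: "'n vfield \<Rightarrow> 'n vfield \<Rightarrow> 'n vfield"
    and m :: nat
    and r s :: "nat \<Rightarrow> 'n vfield"
    and c \<Gamma> :: "nat \<Rightarrow> nat \<Rightarrow> nat \<Rightarrow> real^'n \<Rightarrow> real"
  assumes "open \<Omega>"
    and "connection_on \<Omega> nabla"
    and "symmetric_connection_on \<Omega> nabla"
    and "flat_connection_on \<Omega> nabla"
    and "partial_frame \<Omega> m r"
    and "in_involution \<Omega> m r"
    and "frame_completion \<Omega> m r s"
    and "structure_functions \<Omega> m r s c"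
    and "christoffel_symbols \<Omega> nabla m r s \<Gamma>"
  shows
    "(\<forall>p\<in>\<Omega>. \<forall>f\<in>F_set \<Omega> nabla m r p. \<forall>U lam.
        F_witness \<Omega> nabla m r p f U lam \<longrightarrow> lambda_system U m r c \<Gamma> lam) \<and>
     (\<forall>lam \<Xi> h.
        (\<forall>i\<in>{1..m}. smooth_on \<Omega> (lam i)) \<and> lambda_system \<Omega> m r c \<Gamma> lam \<and>
        embedded_submanifold m \<Xi> \<and> \<Xi> \<subseteq> \<Omega> \<and> transverse m r \<Xi> \<and> smooth_along \<Xi> h \<longrightarrow>
        (\<exists>\<Omega>'. open \<Omega>' \<and> \<Xi> \<subseteq> \<Omega>' \<and> \<Omega>' \<subseteq> \<Omega> \<and>
           (\<exists>f. solves_initial_value_problem \<Omega>' nabla m r lam \<Xi> h f \<and>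
              (\<forall>g. solves_initial_value_problem \<Omega>' nabla m r lam \<Xi> h g \<longrightarrow> (\<forall>u\<in>\<Omega>'. g u = f u)))))"
proof -
  interpret flat_christoffel \<Omega> "christoffel_map nabla"
    by (rule flat_christoffel_christoffel_map[OF assms(1-4)])
  have r_smooth: "smooth_on \<Omega> (r i)" if "i \<in> {1..m}" for i
    using assms(5) that unfolding partial_frame_def by blast
  have nabla: "nabla (r i) f u = cov (r i) f u"
    if "open U" "U \<subseteq> \<Omega>" "smooth_on U f" "u \<in> U" "i \<in> {1..m}" for U f u i
    unfolding cov_def
    by (rule connection_christoffel_map[OF assms(2) that(1,2) smooth_on_subset[OF r_smooth[OF that(5)] that(2)] that(3,4)])
  \<comment> \<open>\<open>nabla\<close> and \<open>cov\<close> agree on smooth fields over open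
    subsets of \<open>\<Omega>\<close>, which is why the equivalence is stated for open
    \<open>U\<close> and smooth \<open>f\<close>; all results for \<open>cov\<close> are carried
    over through it.\<close>
  have f_sys: "f_system U nabla m r lam f \<longleftrightarrow> f_system U cov m r lam f"
    if "open U" "U \<subseteq> \<Omega>" "smooth_on U f" for U lam f
    unfolding f_system_def using nabla[OF that] by simp
  interpret flat_frame \<Omega> "christoffel_map nabla" m r s c \<Gamma>
  proof unfold_locales
    show "christoffel_symbols \<Omega> cov m r s \<Gamma>"
      using assms(9) nabla[OF assms(1) order_refl r_smooth] unfolding christoffel_symbols_def by simp
  qed (rule assms)+
  have ivp: "solves_initial_value_problem U nabla m r lam \<Xi> h f \<longleftrightarrow> solves_initial_value_problem U cov m r lam \<Xi> h f"
    if "open U" "U \<subseteq> \<Omega>" for U lam \<Xi> h f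
    unfolding solves_initial_value_problem_def using f_sys[OF that] by blast
  show ?thesis
  proof (intro conjI ballI allI impI)
    fix p f U lam assume "F_witness \<Omega> nabla m r p f U lam"
    then have U: "open U" "U \<subseteq> \<Omega>" and f: "smooth_on U f" and lam: "\<And>i. i \<in> {1..m} \<Longrightarrow> smooth_on U (lam i)"
      and sys: "f_system U nabla m r lam f"
      unfolding F_witness_def by simp_all
    show "lambda_system U m r c \<Gamma> lam"
      by (rule f_system_imp_lambda_system[OF U f lam sys[unfolded f_sys[OF U f]]])
  next
    fix lam \<Xi> h
    assume "(\<forall>i\<in>{1..m}. smooth_on \<Omega> (lam i)) \<and> lambda_system \<Omega> m r c \<Gamma> lam \<and>
        embedded_submanifold m \<Xi> \<and> \<Xi> \<subseteq> \<Omega> \<and> transverse m r \<Xi> \<and> smooth_along \<Xi> h"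
    then have lam: "\<forall>i\<in>{1..m}. smooth_on \<Omega> (lam i)" and sys: "lambda_system \<Omega> m r c \<Gamma> lam"
      and \<Xi>: "embedded_submanifold m \<Xi>" "\<Xi> \<subseteq> \<Omega>" "transverse m r \<Xi>" and h: "smooth_along \<Xi> h"
      by simp_all
    show "\<exists>\<Omega>'. open \<Omega>' \<and> \<Xi> \<subseteq> \<Omega>' \<and> \<Omega>' \<subseteq> \<Omega> \<and>
           (\<exists>f. solves_initial_value_problem \<Omega>' nabla m r lam \<Xi> h f \<and>
              (\<forall>g. solves_initial_value_problem \<Omega>' nabla m r lam \<Xi> h g \<longrightarrow> (\<forall>u\<in>\<Omega>'. g u = f u)))"
    proof (rule initial_value_problem[OF lam sys \<Xi> h])
      fix \<Omega>' f
      assume \<Omega>': "open \<Omega>'" "\<Xi> \<subseteq> \<Omega>'" "\<Omega>' \<subseteq> \<Omega>"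
        and f: "solves_initial_value_problem \<Omega>' cov m r lam \<Xi> h f"
        and unique: "\<And>g u. solves_initial_value_problem \<Omega>' cov m r lam \<Xi> h g \<Longrightarrow> u \<in> \<Omega>' \<Longrightarrow> g u = f u"
      note ivp = ivp[OF \<Omega>'(1,3), symmetric]
      show ?thesis
        by (intro exI[of _ \<Omega>'] exI[of _ f] conjI allI impI ballI \<Omega>' f[unfolded ivp] unique[unfolded ivp])
    qed
  qed
qed

end
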